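(* Let $n\ge2$. There exist constants $\tau_n,c_n>0$ depending only on $n$ such that the following holds. Let $1<p<n$ and put $p^*=\frac{np}{n-p}$. For $w\in A_\infty$ let the exponent $p^*_w$ be defined by $$\frac1p-\frac1{p^*_w}=\frac1n\,\frac1{1+\tau_n([w]_{A_\infty}-1)}.$$ There exists $c_{n,p}>0$, depending only on $n$ and $p$, such that if $w\in A_\infty$ satisfies $[w]_{A_\infty}\le1+c_{n,p}$, then for every cube $Q$ and every $f\in W^{1,1}_{\rm loc}(\mathbb{R}^n)$, $$\left(\frac1{w(Q)}\int_Q|f-f_Q|^{p^*_w}w\,dx\right)^{\frac1{p^*_w}}\le c_n\,p^*\,\big(1+\tau_n([w]_{A_\infty}-1)\big)^{\frac1p}\,\ell(Q)\left(\frac1{w(Q)}\int_Q|\nabla f|^pw\,dx\right)^{\frac1p}.$$ Moreover, for every cube $Q$ and every such $f$, $$\left\|f-f_Q\right\|_{L^{p^*_w,p}\left(Q,\frac{w(x)dx}{w(Q)}\right)}\le c_n\,p^*\,\big(1+\tau_n([w]_{A_\infty}-1)\big)^{\frac1p}\,\ell(Q)\left(\frac1{w(Q)}\int_Q|\nabla f|^pw\,dx\right)^{\frac1p}.$$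
   Context: Cubes $Q\subset\mathbb{R}^n$ have sides parallel to the coordinate axes; $\ell(Q)$ is the side length. A weight is a locally integrable function $w$ on $\mathbb{R}^n$ with $0<w(x)<\infty$ for a.e. $x$; $w(Q)=\int_Q w\,dx$; $f_Q=\frac1{|Q|}\int_Q f\,dx$ is the unweighted average. For $1<p<\infty$, $w\in A_p$ means $\sup_Q\left(\frac1{|Q|}\int_Q w\right)\left(\frac1{|Q|}\int_Q w^{1-p'}\right)^{p-1}<\infty$, $p'=p/(p-1)$; $w\in A_1$ means $\sup_Q\left(\frac1{|Q|}\int_Q w\right)\operatorname{ess\,sup}_Q (w^{-1})<\infty$. $A_\infty:=\bigcup_{p\ge1}A_p$; equivalently $w\in A_\infty$ iff the Fujii--Wilson constant $[w]_{A_\infty}:=\sup_Q\frac1{w(Q)}\int_Q M(w\chi_Q)\,dx$ is finite, where $Mf(x)=\sup_{Q\ni x}\frac1{|Q|}\int_Q|f|$. One always has $[w]_{A_\infty}\ge1$. For a probability measure $\mu$ on $Q$ and $1\le p\le q<\infty$, the Lorentz quasi-norm is $\|g\|_{L^{q,p}(Q,\mu)}=\left(p\int_0^\infty t^{p-1}\,\mu(\{x\in Q:|g(x)|>t\})^{p/q}\,dt\right)^{1/p}$. Here $W^{1,1}_{\rm loc}(\mathbb{R}^n)$ is the space of locally integrable functions with locally integrable weak gradient $\nabla f$; right-hand sides may be infinite. *)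

theory Defs
  imports "HOL-Analysis.Analysis" "HOL-Probability.Essential_Supremum"
begin

(* Quantities that may be infinite live in ennreal.  The power is only used with exponent a > 0,
   where \<infinity> to the power a is \<infinity>. *)
definition epowr :: "ennreal \<Rightarrow> real \<Rightarrow> ennreal"  (infixr "epowr" 80) where
  "x epowr a = (if x = top then top else ennreal (enn2real x powr a))"

(* Closed axis-parallel cube with lower corner a and side length l; vec l is the constant vector. *)
definition cube :: "real^'n \<Rightarrow> real \<Rightarrow> (real^'n) set" where
  "cube a l = cbox a (a + vec l)"

definition cubes :: "(real^'n) set set" where
  "cubes = {cube a l |a l. 0 < l}"

definition locally_integrable :: "(real^'n \<Rightarrow> 'b::euclidean_space) \<Rightarrow> bool" where
  "locally_integrable f \<longleftrightarrow> (\<forall>K. compact K \<longrightarrow> f absolutely_integrable_on K)"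

(* The upper bound w x < \<infinity> is automatic because w is real-valued. *)
definition weight :: "(real^'n \<Rightarrow> real) \<Rightarrow> bool" where
  "weight w \<longleftrightarrow> locally_integrable w \<and> (AE x in lebesgue. 0 < w x)"

definition weight_of :: "(real^'n \<Rightarrow> real) \<Rightarrow> (real^'n) set \<Rightarrow> ennreal" where
  "weight_of w Q = (\<integral>\<^sup>+x\<in>Q. ennreal (w x) \<partial>lebesgue)"

definition cube_mean :: "(real^'n \<Rightarrow> real) \<Rightarrow> (real^'n) set \<Rightarrow> real" where
  "cube_mean f Q = (1 / measure lebesgue Q) * (LINT x:Q|lebesgue. f x)"

definition cube_emean :: "(real^'n \<Rightarrow> ennreal) \<Rightarrow> (real^'n) set \<Rightarrow> ennreal" where
  "cube_emean h Q = (\<integral>\<^sup>+x\<in>Q. h x \<partial>lebesgue) / emeasure lebesgue Q"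

(* For p > 1 the exponent 1 - p' is 1 - p / (p - 1). *)
definition A_const :: "real \<Rightarrow> (real^'n \<Rightarrow> real) \<Rightarrow> ennreal" where
  "A_const p w =
    (if p = 1
     then (SUP Q\<in>cubes. cube_emean (\<lambda>x. ennreal (w x)) Q
                        * esssup (lebesgue_on Q) (\<lambda>x. inverse (ennreal (w x))))
     else (SUP Q\<in>cubes. cube_emean (\<lambda>x. ennreal (w x)) Q
                        * cube_emean (\<lambda>x. ennreal (w x powr (1 - p / (p - 1)))) Q epowr (p - 1)))"

definition A_class :: "real \<Rightarrow> (real^'n \<Rightarrow> real) set" where
  "A_class p = {w. weight w \<and> A_const p w < top}"

definition A_infty :: "(real^'n \<Rightarrow> real) set" where
  "A_infty = (\<Union>p\<in>{1..}. A_class p)"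

definition maximal_function :: "(real^'n \<Rightarrow> real) \<Rightarrow> real^'n \<Rightarrow> ennreal" where
  "maximal_function f x = (SUP Q\<in>{Q\<in>cubes. x \<in> Q}. cube_emean (\<lambda>y. ennreal \<bar>f y\<bar>) Q)"

definition FW_const :: "(real^'n \<Rightarrow> real) \<Rightarrow> ennreal" where
  "FW_const w =
    (SUP Q\<in>cubes. (\<integral>\<^sup>+x\<in>Q. maximal_function (\<lambda>y. w y * indicator Q y) x \<partial>lebesgue)
                  / weight_of w Q)"

definition partial_deriv :: "'n \<Rightarrow> (real^'n \<Rightarrow> real) \<Rightarrow> real^'n \<Rightarrow> real" where
  "partial_deriv i \<phi> x = frechet_derivative \<phi> (at x) (axis i 1)"

primrec C_k :: "nat \<Rightarrow> (real^'n \<Rightarrow> real) \<Rightarrow> bool" where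
  "C_k 0 \<phi> \<longleftrightarrow> continuous_on UNIV \<phi>"
| "C_k (Suc k) \<phi> \<longleftrightarrow> (\<forall>x. \<phi> differentiable at x) \<and> (\<forall>i. C_k k (partial_deriv i \<phi>))"

definition test_functions :: "(real^'n \<Rightarrow> real) set" where
  "test_functions = {\<phi>. (\<forall>k. C_k k \<phi>) \<and> compact (closure {x. \<phi> x \<noteq> 0})}"

definition has_weak_gradient :: "(real^'n \<Rightarrow> real) \<Rightarrow> (real^'n \<Rightarrow> real^'n) \<Rightarrow> bool" where
  "has_weak_gradient f g \<longleftrightarrow> locally_integrable g \<and>
    (\<forall>\<phi>\<in>test_functions. \<forall>i.
      (LINT x|lebesgue. f x * partial_deriv i \<phi> x) = - (LINT x|lebesgue. g x $ i * \<phi> x))"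

definition W11_loc :: "(real^'n \<Rightarrow> real) set" where
  "W11_loc = {f. locally_integrable f \<and> (\<exists>g. has_weak_gradient f g)}"

definition lorentz_norm :: "'a measure \<Rightarrow> real \<Rightarrow> real \<Rightarrow> ('a \<Rightarrow> real) \<Rightarrow> ennreal" where
  "lorentz_norm \<mu> q p g =
    (ennreal p * (\<integral>\<^sup>+t\<in>{0<..}. ennreal (t powr (p - 1))
                     * emeasure \<mu> {x\<in>space \<mu>. \<bar>g x\<bar> > t} epowr (p / q) \<partial>lborel)) epowr (1 / p)"

definition weighted_prob :: "(real^'n \<Rightarrow> real) \<Rightarrow> (real^'n) set \<Rightarrow> (real^'n) measure" where
  "weighted_prob w Q = density (lebesgue_on Q) (\<lambda>x. ennreal (w x) / weight_of w Q)"

end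

theory Submission
  imports Defs
begin

text \<open>
  Write \<open>\<delta> = [w] - 1\<close> for the deviation of the Fujii--Wilson constant from 1. Since the maximal function
  of \<open>w\<close> restricted to a cube \<open>Q\<close> dominates both \<open>w\<close> and the mean \<open>w_Q\<close>, the integral of \<open>(w_Q - w)\<^sup>+\<close> over \<open>Q\<close>
  is at most \<open>\<delta> w(Q)\<close>. Hence passing to a dyadic child changes the mean by a factor at least \<open>1 - 2^n \<delta>\<close>,
  which gives \<open>|R| / |Q| \<le> (w(R) / w(Q))^(1 / (1 + \<tau> \<delta>))\<close> for dyadic subcubes, and a stopping argument
  bounds the \<open>A_p\<close> constant once \<open>\<delta>\<close> is small depending on \<open>p\<close>. The unweighted (1,1) Poincare inequality then
  becomes a weighted one with the \<open>p\<close>-mean of the gradient. Telescoping over dyadic cubes and splitting the sum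
  as in Hedberg's inequality against the dyadic maximal function yields a weak-type estimate whose constant
  is linear in the exponent, because it comes from a geometric series of ratio \<open>2^(- 1 / p*_w)\<close>. To keep the constants
  bounded as \<open>p\<close> tends to 1, the strong and Lorentz estimates are obtained from the weak one by Maz'ya truncation.
\<close>

subsection \<open>Lebesgue points along a subsequence\<close>

text \<open>The delicate point is how the constants depend on \<open>p\<close>. The smallness of
  \<open>\<delta>\<close> that depends on \<open>p\<close> is spent only on the mean of
  \<open>w\<close> to the power \<open>- 1 / (p - 1)\<close>; the constant of the estimates may grow
  only like the exponent. Hence Holder's inequality is replaced by a pointwise two-term split whose
  parameter absorbs the growing factor of that moment bound, and maximal functions enter only
  through the dyadic weak (1,1) inequality, whose constant is 1 for every weight, never through an
  \<open>L^p\<close> bound with its factor \<open>p / (p - 1)\<close>. The value of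
  \<open>\<tau>\<close> is \<open>2 ^ (n + 1)\<close>: with it the loss of mass in one dyadic
  subdivision, at most the factor \<open>(1 - 2 ^ n * \<delta>) / 2 ^ n\<close>, fits the exponent.
  The factor \<open>(1 + \<tau> * \<delta>) powr (1 / p)\<close> of the statement is at least 1 and
  only gives room. Truncated functions are never given weak gradients of their own: the truncation
  is composed with the mollified function, where the chain rule is classical, and the limit is taken
  afterwards.\<close>

lemma nn_integral_lborel_shift:
  fixes f :: "'a::euclidean_space \<Rightarrow> ennreal"
  assumes [measurable]: "f \<in> borel_measurable borel"
  shows "(\<integral>\<^sup>+x. f (x + z) \<partial>lborel) = (\<integral>\<^sup>+x. f x \<partial>lborel)"
proof -
  have "(\<integral>\<^sup>+x. f x \<partial>lborel) = (\<integral>\<^sup>+x. f x \<partial>distr lborel borel ((+) z))"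
    by (simp add: lborel_distr_plus)
  also have "\<dots> = (\<integral>\<^sup>+x. f (z + x) \<partial>lborel)"
    by (subst nn_integral_distr) auto
  finally show ?thesis by (simp add: add.commute)
qed

lemma finite_measure_sandwich:
  fixes A :: "'a::euclidean_space set"
  assumes A: "A \<in> sets borel" "emeasure lborel A < \<infinity>" and e: "0 < (e::real)"
  obtains K U where "compact K" "K \<subseteq> A" "A \<subseteq> U" "open U" "emeasure lborel (U - K) \<le> ennreal e"
proof -
  have e2: "0 < e/2" using e by simp
  obtain U where U: "open U" "A \<subseteq> U" "emeasure lborel (U - A) < e/2"
    using outer_regular_lborel[OF A(1) e2] by blast
  \<comment> \<open>Inner regularity is available for finite measures, so it is applied to the
    restriction of Lebesgue measure to \<open>A\<close>, which agrees with Lebesgue measure on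
    subsets of \<open>A\<close>.\<close>
  define M where "M = density lborel (indicator A)"
  have M1: "emeasure M B = emeasure lborel (A \<inter> B)" if "B \<in> sets borel" for B
    unfolding M_def using A that
    by (subst emeasure_density) (auto simp: indicator_inter_arith[symmetric])
  have "emeasure M A = (SUP K\<in>{K. K \<subseteq> A \<and> compact K}. emeasure M K)"
    by (rule inner_regular) (use A M1[of UNIV] in \<open>auto simp: M_def\<close>)
  moreover have "emeasure M A = emeasure lborel A" using M1[OF A(1)] by simp
  ultimately have sup: "emeasure lborel A = (SUP K\<in>{K. K \<subseteq> A \<and> compact K}. emeasure M K)" by simp
  have "\<exists>K. K \<subseteq> A \<and> compact K \<and> emeasure lborel A \<le> emeasure lborel K + e/2"
  proof (cases "emeasure lborel A = 0")
    case True then show ?thesis by (intro exI[of _ "{}"]) auto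
  next
    case False
    have "emeasure lborel A - e/2 < emeasure lborel A"
      using False A e by (intro ennreal_between) (auto simp: zero_less_iff_neq_zero)
    then obtain K where K: "K \<subseteq> A" "compact K" "emeasure lborel A - e/2 < emeasure M K"
      unfolding sup by (auto simp: less_SUP_iff)
    have "emeasure M K = emeasure lborel K"
      using K M1[of K] by (simp add: borel_compact inf.absorb2)
    with K show ?thesis
      by (metis add.commute ennreal_minus_le_iff le_cases less_le_not_le) 
  qed
  then obtain K where K: "K \<subseteq> A" "compact K" "emeasure lborel A \<le> emeasure lborel K + e/2" by blast
  have Kb: "K \<in> sets borel" using K by (simp add: borel_compact)
  have fin: "emeasure lborel K < \<infinity>" using K A emeasure_mono[of K A lborel] by (auto simp: top.not_eq_extremum dest: le_less_trans)
  have "emeasure lborel (A - K) \<le> e/2"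
    using K Kb A fin by (subst emeasure_Diff) (auto simp: ennreal_minus_le_iff)
  moreover have "U - K = (U - A) \<union> (A - K)" using U K by auto
  ultimately have "emeasure lborel (U - K) \<le> ennreal (e/2) + ennreal (e/2)"
    using U A Kb emeasure_subadditive[of "U - A" lborel "A - K"]
    by (simp add: order_trans[OF _ add_mono] less_imp_le borel_open)
  also have "\<dots> = ennreal e" using e by (simp flip: ennreal_plus)
  finally show ?thesis using that[OF K(2,1) U(2,1)] by simp
qed

text \<open>The property passes to sums and to dominated limits, so induction over integrable
  functions reduces it to sets of finite measure. For these, approximation by a compact
  \<open>K\<close> and an open \<open>U\<close> confines the change under a small shift to
  \<open>U - K\<close> and a translate of it.\<close>

lemma L1_translation:
  fixes f :: "'a::euclidean_space \<Rightarrow> real"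
  assumes "integrable lborel f"
  shows "\<forall>e>0. \<exists>d>0. \<forall>z. norm z < d \<longrightarrow> (\<integral>\<^sup>+x. ennreal \<bar>f (x + z) - f x\<bar> \<partial>lborel) \<le> ennreal e"
  using assms
proof (induction f rule: integrable_induct)
  case (base A c)
  show ?case
  proof (intro allI impI)
    fix e :: real assume e: "0 < e"
    define e' where "e' = e / (2 * (\<bar>c\<bar> + 1))"
    have e': "0 < e'" using e by (simp add: e'_def)
    obtain K U where KU: "compact K" "K \<subseteq> A" "A \<subseteq> U" "open U" "emeasure lborel (U - K) \<le> ennreal e'"
      using finite_measure_sandwich[OF _ base(2) e'] base by auto
    obtain d where d: "0 < d" "(\<Union>x\<in>K. ball x d) \<subseteq> U"
      using compact_subset_open_imp_ball_epsilon_subset[OF KU(1,4)] KU by blast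
    have UK[measurable]: "U - K \<in> sets borel" using KU borel_open[of U] borel_compact[of K] by blast
    have "(\<integral>\<^sup>+x. ennreal \<bar>indicator A (x + z) *\<^sub>R c - indicator A x *\<^sub>R c\<bar> \<partial>lborel) \<le> ennreal e"
      if z: "norm z < d" for z
    proof -
      have Kz: "x + z \<in> U" "x - z \<in> U" if "x \<in> K" for x
      proof -
        have "x + z \<in> ball x d" "x - z \<in> ball x d" using z by (auto simp: dist_norm)
        then show "x + z \<in> U" "x - z \<in> U" using d that by blast+
      qed
      \<comment> \<open>Points of \<open>K\<close> are shifted into \<open>U\<close>. So whenever
        exactly one of \<open>x\<close> and \<open>x + z\<close> lies in \<open>A\<close>, one of
        them lies in \<open>U - K\<close>, and the integrand is bounded by two indicators of a set
        of measure at most \<open>e'\<close>.\<close>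
      have "x \<in> A \<Longrightarrow> x + z \<notin> A \<Longrightarrow> x \<in> U - K \<or> x + z \<in> U - K" for x
        using KU Kz[of x] by blast
      moreover have "x \<notin> A \<Longrightarrow> x + z \<in> A \<Longrightarrow> x \<in> U - K \<or> x + z \<in> U - K" for x
        using KU Kz(2)[of "x + z"] by auto
      moreover have c2: "ennreal \<bar>c\<bar> \<le> ennreal \<bar>c\<bar> * 2"
        using mult_left_mono[of 1 2 "ennreal \<bar>c\<bar>"] by simp
      ultimately have "ennreal \<bar>indicator A (x + z) *\<^sub>R c - indicator A x *\<^sub>R c\<bar>
          \<le> ennreal \<bar>c\<bar> * (indicator (U - K) (x + z) + indicator (U - K) x)" for x
        by (cases "x \<in> A"; cases "x + z \<in> A"; cases "x \<in> U - K"; cases "x + z \<in> U - K") 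
           (auto simp: c2)
      then have "(\<integral>\<^sup>+x. ennreal \<bar>indicator A (x + z) *\<^sub>R c - indicator A x *\<^sub>R c\<bar> \<partial>lborel)
          \<le> (\<integral>\<^sup>+x. ennreal \<bar>c\<bar> * (indicator (U - K) (x + z) + indicator (U - K) x) \<partial>lborel)"
        by (intro nn_integral_mono)
      also have "\<dots> = ennreal \<bar>c\<bar> * (emeasure lborel (U - K) + emeasure lborel (U - K))"
        by (simp add: nn_integral_cmult nn_integral_add nn_integral_lborel_shift[of "indicator (U-K)"])
      also have "\<dots> \<le> ennreal \<bar>c\<bar> * (ennreal e' + ennreal e')"
        using KU by (intro mult_left_mono add_mono) auto
      also have "\<dots> = ennreal (\<bar>c\<bar> * (2 * e'))"
        using e' by (simp add: ennreal_mult' flip: ennreal_plus)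
      also have "\<dots> \<le> ennreal e"
        using e by (intro ennreal_leI) (simp add: e'_def field_simps)
      finally show ?thesis .
    qed
    then show "\<exists>d>0. \<forall>z. norm z < d \<longrightarrow> (\<integral>\<^sup>+x. ennreal \<bar>indicator A (x + z) *\<^sub>R c - indicator A x *\<^sub>R c\<bar> \<partial>lborel) \<le> ennreal e"
      using d by blast
  qed
next
  case (add f g)
  have [measurable]: "f \<in> borel_measurable borel" "g \<in> borel_measurable borel"
    using borel_measurable_integrable[OF add.hyps(1)] borel_measurable_integrable[OF add.hyps(2)] by auto
  show ?case
  proof (intro allI impI)
    fix e :: real assume e: "0 < e"
    then have e2: "0 < e/2" by simp
    obtain d1 where d1: "d1 > 0"
      "\<And>z. norm z < d1 \<Longrightarrow> (\<integral>\<^sup>+x. ennreal \<bar>f (x + z) - f x\<bar> \<partial>lborel) \<le> ennreal (e/2)"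
      using add.IH(1)[rule_format, OF e2] by blast
    obtain d2 where d2: "d2 > 0"
      "\<And>z. norm z < d2 \<Longrightarrow> (\<integral>\<^sup>+x. ennreal \<bar>g (x + z) - g x\<bar> \<partial>lborel) \<le> ennreal (e/2)"
      using add.IH(2)[rule_format, OF e2] by blast
    note d = d1(1) d2(1) d1(2) d2(2)
    have "(\<integral>\<^sup>+x. ennreal \<bar>f (x + z) + g (x + z) - (f x + g x)\<bar> \<partial>lborel) \<le> ennreal e"
      if z: "norm z < min d1 d2" for z
    proof -
      have "(\<integral>\<^sup>+x. ennreal \<bar>f (x + z) + g (x + z) - (f x + g x)\<bar> \<partial>lborel)
        \<le> (\<integral>\<^sup>+x. ennreal \<bar>f (x + z) - f x\<bar> + ennreal \<bar>g (x + z) - g x\<bar> \<partial>lborel)"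
        by (intro nn_integral_mono) (simp flip: ennreal_plus)
      also have "\<dots> \<le> ennreal (e/2) + ennreal (e/2)"
        using d z by (subst nn_integral_add) (auto intro!: add_mono)
      also have "\<dots> = ennreal e" using e by (simp flip: ennreal_plus)
      finally show ?thesis .
    qed
    then show "\<exists>d>0. \<forall>z. norm z < d \<longrightarrow> (\<integral>\<^sup>+x. ennreal \<bar>f (x + z) + g (x + z) - (f x + g x)\<bar> \<partial>lborel) \<le> ennreal e"
      using d by (intro exI[of _ "min d1 d2"]) auto
  qed
next
  case (lim f s)
  have [measurable]: "f \<in> borel_measurable borel" "\<And>i. s i \<in> borel_measurable borel"
    using borel_measurable_integrable[OF \<open>integrable lborel f\<close>]
      borel_measurable_integrable[OF \<open>integrable lborel (s _)\<close>] by auto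
  show ?case
  proof (intro allI impI)
    fix e :: real assume e: "0 < e"
    have "(\<lambda>i. \<integral>\<^sup>+x. ennreal (norm (s i x - f x)) \<partial>lborel) \<longlonglongrightarrow> (\<integral>\<^sup>+(x::'a). 0 \<partial>lborel)"
    proof (rule nn_integral_dominated_convergence[where w="\<lambda>x. 3 * ennreal (norm (f x))"])
      show "(\<integral>\<^sup>+x. 3 * ennreal (norm (f x)) \<partial>lborel) < \<infinity>"
        using lim.hyps(4) by (simp add: nn_integral_cmult integrable_iff_bounded ennreal_mult_less_top)
      show "AE x in lborel. ennreal (norm (s i x - f x)) \<le> 3 * ennreal (norm (f x))" for i
      proof (rule AE_I2)
        fix x have "norm (s i x - f x) \<le> 3 * norm (f x)"
          using lim.hyps(3)[of x i] by auto
        then have "ennreal (norm (s i x - f x)) \<le> ennreal (3 * norm (f x))" by (rule ennreal_leI)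
        then show "ennreal (norm (s i x - f x)) \<le> 3 * ennreal (norm (f x))"
          by (simp add: ennreal_mult)
      qed
      show "AE x in lborel. (\<lambda>i. ennreal (norm (s i x - f x))) \<longlonglongrightarrow> 0"
      proof (rule AE_I2)
        fix x have "(\<lambda>i. norm (s i x - f x)) \<longlonglongrightarrow> 0"
          using tendsto_norm_zero[OF LIM_zero[OF lim.hyps(2)[of x]]] by simp
        then show "(\<lambda>i. ennreal (norm (s i x - f x))) \<longlonglongrightarrow> 0"
          by (metis ennreal_0 tendsto_ennrealI)
      qed
    qed auto
    then have "\<forall>\<^sub>F i in sequentially. (\<integral>\<^sup>+x. ennreal (norm (s i x - f x)) \<partial>lborel) < ennreal (e/4)"
      using e by (auto simp: order_tendsto_iff)
    then obtain i where i: "(\<integral>\<^sup>+x. ennreal \<bar>s i x - f x\<bar> \<partial>lborel) < ennreal (e/4)"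
      by (auto simp: eventually_sequentially)
    have e2: "0 < e/2" using e by simp
    obtain d where d: "d > 0"
      "\<And>z. norm z < d \<Longrightarrow> (\<integral>\<^sup>+x. ennreal \<bar>s i (x + z) - s i x\<bar> \<partial>lborel) \<le> ennreal (e/2)"
      using lim.IH[rule_format, OF e2] by blast
    have "(\<integral>\<^sup>+x. ennreal \<bar>f (x + z) - f x\<bar> \<partial>lborel) \<le> ennreal e" if z: "norm z < d" for z
    proof -
      have "(\<integral>\<^sup>+x. ennreal \<bar>f (x + z) - f x\<bar> \<partial>lborel) \<le> 
        (\<integral>\<^sup>+x. ennreal \<bar>s i (x+z) - f (x+z)\<bar> + (ennreal \<bar>s i (x + z) - s i x\<bar> + ennreal \<bar>s i x - f x\<bar>) \<partial>lborel)"
        by (intro nn_integral_mono) (simp flip: ennreal_plus)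
      also have "\<dots> = (\<integral>\<^sup>+x. ennreal \<bar>s i x - f x\<bar> \<partial>lborel) + ((\<integral>\<^sup>+x. ennreal \<bar>s i (x + z) - s i x\<bar> \<partial>lborel)
         + (\<integral>\<^sup>+x. ennreal \<bar>s i x - f x\<bar> \<partial>lborel))"
        by (subst nn_integral_lborel_shift[symmetric, of _ z]) (simp_all add: nn_integral_add)
      also have "\<dots> \<le> ennreal (e/4) + (ennreal (e/2) + ennreal (e/4))"
        using i d z by (intro add_mono) auto
      also have "\<dots> = ennreal e" using e by (simp flip: ennreal_plus)
      finally show ?thesis .
    qed
    then show "\<exists>d>0. \<forall>z. norm z < d \<longrightarrow> (\<integral>\<^sup>+x. ennreal \<bar>f (x + z) - f x\<bar> \<partial>lborel) \<le> ennreal e"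
      using d by blast
  qed
qed


section \<open>Almost everywhere convergence of mean oscillations along a subsequence\<close>

lemma nn_integral_tendsto_zero_AE_subseq:
  fixes F :: "nat \<Rightarrow> 'a \<Rightarrow> ennreal"
  assumes [measurable]: "\<And>k. F k \<in> borel_measurable M"
    and lim: "(\<lambda>k. \<integral>\<^sup>+x. F k x \<partial>M) \<longlonglongrightarrow> 0"
  shows "\<exists>s::nat \<Rightarrow> nat. strict_mono s \<and> (AE x in M. (\<lambda>k. F (s k) x) \<longlonglongrightarrow> 0)"
proof -
  have "\<forall>\<^sub>F k in sequentially. (\<integral>\<^sup>+x. F k x \<partial>M) < 1"
    using lim by (rule order_tendstoD) simp
  then obtain N where N: "\<And>k. N \<le> k \<Longrightarrow> (\<integral>\<^sup>+x. F k x \<partial>M) < 1"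
    by (auto simp: eventually_sequentially)
  \<comment> \<open>Capping at 1 gives real integrable functions, to which the subsequence theorem
    for \<open>L^1\<close> convergence applies. A capped sequence that tends to zero is eventually
    below the cap, so the uncapped one has the same limit.\<close>
  define u where "u k x = enn2real (min 1 (F (k + N) x))" for k x
  have [measurable]: "u k \<in> borel_measurable M" for k unfolding u_def by measurable
  have u: "ennreal (u k x) = min 1 (F (k + N) x)" for k x
    unfolding u_def by (rule ennreal_enn2real) (auto simp: min_less_iff_disj)
  have u0: "0 \<le> u k x" for k x by (simp add: u_def)
  have le: "(\<integral>\<^sup>+x. ennreal (norm (u k x)) \<partial>M) \<le> (\<integral>\<^sup>+x. F (k + N) x \<partial>M)" for k
    by (intro nn_integral_mono) (simp add: u u0)
  have int: "integrable M (u k)" for k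
    unfolding integrable_iff_bounded using le[of k] N[of "k + N"]
    by (auto intro: le_less_trans less_trans[OF _ ennreal_less_top, of _ 1])
  have "(\<lambda>k. \<integral>\<^sup>+x. ennreal (norm (u k x)) \<partial>M) \<longlonglongrightarrow> 0"
    by (rule tendsto_sandwich[OF _ _ tendsto_const LIMSEQ_ignore_initial_segment[OF lim, of N]])
       (use le in auto)
  then have "(\<lambda>k. enn2real (\<integral>\<^sup>+x. ennreal (norm (u k x)) \<partial>M)) \<longlonglongrightarrow> 0"
    by (intro tendsto_enn2real) simp_all
  then have "(\<lambda>k. \<integral>x. norm (u k x) \<partial>M) \<longlonglongrightarrow> 0"
    using int by (simp add: integral_eq_nn_integral)
  from tendsto_L1_AE_subseq[OF int this]
  obtain s :: "nat \<Rightarrow> nat" where s: "strict_mono s" "AE x in M. (\<lambda>n. u (s n) x) \<longlonglongrightarrow> 0" by blast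
  have "AE x in M. (\<lambda>k. F (s k + N) x) \<longlonglongrightarrow> 0"
    using s(2)
  proof eventually_elim
    case (elim x)
    then have "(\<lambda>n. ennreal (u (s n) x)) \<longlonglongrightarrow> ennreal 0" by (rule tendsto_ennrealI)
    then have l: "(\<lambda>n. min 1 (F (s n + N) x)) \<longlonglongrightarrow> 0" by (simp add: u)
    then have "\<forall>\<^sub>F n in sequentially. min 1 (F (s n + N) x) < 1"
      by (rule order_tendstoD) simp
    then have "\<forall>\<^sub>F n in sequentially. min 1 (F (s n + N) x) = F (s n + N) x"
      by eventually_elim (auto simp: min_def split: if_splits)
    with l show ?case by (simp cong: tendsto_cong)
  qed
  with s(1) show ?thesis
    by (intro exI[of _ "\<lambda>k. s k + N"]) (auto simp: strict_mono_def)
qed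

text \<open>Borel representatives on \<open>lborel\<close> are used throughout the analysis, since
  the many exchanges of integrals need joint measurability in products. Lebesgue measurable data are
  replaced by such representatives only near the end.\<close>

definition locally_integrable_borel :: "(real^'n \<Rightarrow> real) \<Rightarrow> bool" where
  "locally_integrable_borel f \<longleftrightarrow>
    f \<in> borel_measurable borel \<and> (\<forall>a b. set_integrable lborel (cbox a b) f)"

text \<open>Only almost everywhere convergence along a subsequence is ever needed, so that \<open>L\<^sup>1\<close>-continuity of
  translations replaces the Lebesgue differentiation theorem.\<close>

definition mean_osc :: "(real^'n \<Rightarrow> real) \<Rightarrow> real \<Rightarrow> real^'n \<Rightarrow> ennreal" where
  "mean_osc f r x =
    (\<integral>\<^sup>+z\<in>cbox (- vec r) (vec r). ennreal \<bar>f (x + z) - f x\<bar> \<partial>lborel) / ennreal (r ^ CARD('n))"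

lemma locally_integrable_borel_measurable[measurable_dest]:
  "locally_integrable_borel f \<Longrightarrow> f \<in> borel_measurable borel"
  by (simp add: locally_integrable_borel_def)

lemma mean_osc_measurable[measurable]:
  assumes [measurable]: "f \<in> borel_measurable borel"
  shows "mean_osc f r \<in> borel_measurable borel"
proof -
  have [measurable]: "(\<lambda>(x, z). ennreal \<bar>f (x + z) - f x\<bar> * indicator (cbox (- vec r) (vec r)) z)
     \<in> borel_measurable (borel \<Otimes>\<^sub>M lborel)" by measurable
  show ?thesis unfolding mean_osc_def by measurable
qed

lemma emeasure_lborel_cbox_vec:
  fixes a :: "real^'n"
  assumes "0 \<le> l"
  shows "emeasure lborel (cbox a (a + vec l)) = ennreal (l ^ CARD('n))"
proof -
  have "a \<bullet> b \<le> (a + vec l) \<bullet> b" if "b \<in> Basis" for b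
    using that assms by (auto simp: Basis_vec_def inner_axis)
  moreover have "(\<Prod>b\<in>Basis. (a + vec l - a) \<bullet> b) = (\<Prod>b\<in>(Basis::(real^'n) set). l)"
    by (intro prod.cong) (auto simp: Basis_vec_def inner_axis)
  ultimately show ?thesis by (simp add: emeasure_lborel_cbox_eq)
qed

text \<open>By Tonelli the integral is an average over \<open>z\<close> of translation differences,
  each small by \<open>L1_translation\<close> for \<open>f\<close> cut off to a box enlarged by 1.
  The box of \<open>z\<close> has volume \<open>(2 * r) ^ n\<close> but the normalisation is
  \<open>r ^ n\<close>; this costs the factor \<open>2 ^ n\<close>.\<close>

lemma mean_osc_L1:
  fixes f :: "real^'n \<Rightarrow> real"
  assumes f: "locally_integrable_borel f" and e: "0 < e"
  shows "\<exists>d>0. \<forall>r. 0 < r \<longrightarrow> r < d \<longrightarrow> (\<integral>\<^sup>+x\<in>cbox a b. mean_osc f r x \<partial>lborel) \<le> ennreal e"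
proof -
  have [measurable]: "f \<in> borel_measurable borel" using f by measurable
  let ?n = "CARD('n)"
  define K where "K = cbox (a - vec 1) (b + vec 1)"
  define g where "g x = indicator K x * f x" for x
  have [measurable]: "K \<in> sets borel" by (simp add: K_def)
  have [measurable]: "g \<in> borel_measurable borel" unfolding g_def by measurable
  have "integrable lborel g"
    using f unfolding locally_integrable_borel_def set_integrable_def g_def K_def by auto
  moreover have "0 < e / 2 ^ ?n" using e by simp
  ultimately obtain d where d: "0 < d" 
    "\<And>z. norm z < d \<Longrightarrow> (\<integral>\<^sup>+x. ennreal \<bar>g (x + z) - g x\<bar> \<partial>lborel) \<le> ennreal (e / 2 ^ ?n)"
    using L1_translation by metis
  have "(\<integral>\<^sup>+x\<in>cbox a b. mean_osc f r x \<partial>lborel) \<le> ennreal e" if r: "0 < r" "r < min 1 (d / ?n)" for r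
  proof -
    let ?B = "cbox (- vec r) (vec r) :: (real^'n) set"
    have eB: "emeasure lborel ?B = ennreal ((2 * r) ^ ?n)"
    proof -
      have eq: "- vec r + vec (2 * r) = (vec r :: real^'n)" by (simp add: vec_eq_iff)
      show ?thesis using emeasure_lborel_cbox_vec[of "2*r" "- vec r :: real^'n", unfolded eq] r by simp
    qed
    have zd: "norm z < d" if "z \<in> ?B" for z
    proof -
      have "norm z \<le> (\<Sum>i\<in>UNIV. \<bar>z $ i\<bar>)" by (rule norm_le_l1_cart)
      also have "\<dots> \<le> (\<Sum>i\<in>(UNIV::'n set). r)"
        using that by (intro sum_mono) (auto simp: mem_box_cart abs_le_iff minus_le_iff)
      also have "\<dots> < d" using r by (simp add: field_simps)
      finally show ?thesis .
    qed
    have fg: "f (x + z) - f x = g (x + z) - g x" if "x \<in> cbox a b" "z \<in> ?B" for x z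
    proof -
      have "a $ i \<le> x $ i" "x $ i \<le> b $ i" "-r \<le> z $ i" "z $ i \<le> r" for i
        using that by (auto simp: mem_box_cart)
      then have "a $ i - 1 \<le> x $ i" "x $ i \<le> b $ i + 1" "a $ i - 1 \<le> x $ i + z $ i" "x $ i + z $ i \<le> b $ i + 1" for i
        using r by (smt (verit) min_less_iff_conj)+
      then have "x \<in> K" "x + z \<in> K" by (auto simp: K_def mem_box_cart)
      then show ?thesis by (simp add: g_def)
    qed
    have [measurable]: "(\<lambda>(x, z). ennreal \<bar>g (x + z) - g x\<bar> * indicator ?B z)
     \<in> borel_measurable (lborel \<Otimes>\<^sub>M lborel)" by measurable
    have "(\<integral>\<^sup>+x\<in>cbox a b. mean_osc f r x \<partial>lborel)
       \<le> (\<integral>\<^sup>+x. (\<integral>\<^sup>+z\<in>?B. ennreal \<bar>g (x + z) - g x\<bar> \<partial>lborel) / ennreal (r ^ ?n) \<partial>lborel)"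
      unfolding mean_osc_def
      by (intro nn_integral_mono) (auto simp: indicator_def fg intro!: divide_right_mono_ennreal nn_integral_mono)
    also have "\<dots> = (\<integral>\<^sup>+x. (\<integral>\<^sup>+z\<in>?B. ennreal \<bar>g (x + z) - g x\<bar> \<partial>lborel) \<partial>lborel) / ennreal (r ^ ?n)"
      by (subst nn_integral_divide) auto
    also have "(\<integral>\<^sup>+x. (\<integral>\<^sup>+z\<in>?B. ennreal \<bar>g (x + z) - g x\<bar> \<partial>lborel) \<partial>lborel)
        = (\<integral>\<^sup>+z. (\<integral>\<^sup>+x. ennreal \<bar>g (x + z) - g x\<bar> * indicator ?B z \<partial>lborel) \<partial>lborel)"
      by (rule lborel_pair.Fubini'[symmetric]) measurable
    also have "\<dots> = (\<integral>\<^sup>+z\<in>?B. (\<integral>\<^sup>+x. ennreal \<bar>g (x + z) - g x\<bar> \<partial>lborel) \<partial>lborel)"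
      by (simp add: nn_integral_multc)
    also have "\<dots> \<le> (\<integral>\<^sup>+z\<in>?B. ennreal (e / 2 ^ ?n) \<partial>lborel)"
      using d zd by (intro nn_integral_mono) (auto simp: indicator_def)
    also have "\<dots> = ennreal (e / 2 ^ ?n) * ennreal ((2 * r) ^ ?n)"
      by (simp add: nn_integral_cmult eB)
    also have "\<dots> = ennreal (e * r ^ ?n)"
      using e r by (simp add: power_mult_distrib flip: ennreal_mult')
    finally have "(\<integral>\<^sup>+x\<in>cbox a b. mean_osc f r x \<partial>lborel) \<le> ennreal (e * r ^ ?n) / ennreal (r ^ ?n)"
      by (simp add: divide_right_mono_ennreal)
    also have "\<dots> = ennreal e" using e r by (simp add: divide_ennreal)
    finally show ?thesis .
  qed
  then show ?thesis using d by (intro exI[of _ "min 1 (d / ?n)"]) auto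
qed

lemma mean_osc_tendsto:
  fixes f :: "real^'n \<Rightarrow> real"
  assumes f: "locally_integrable_borel f" and r: "r \<longlonglongrightarrow> 0" "\<And>k. 0 < r k"
  shows "(\<lambda>k. \<integral>\<^sup>+x\<in>cbox a b. mean_osc f (r k) x \<partial>lborel) \<longlonglongrightarrow> 0"
proof (rule tendsto_zero_ennreal)
  fix e :: real assume "0 < e"
  then obtain d where d: "d > 0" "\<And>s. 0 < s \<Longrightarrow> s < d \<Longrightarrow> (\<integral>\<^sup>+x\<in>cbox a b. mean_osc f s x \<partial>lborel) \<le> ennreal (e/2)"
    using mean_osc_L1[OF f, of "e/2" a b] by auto
  have "\<forall>\<^sub>F k in sequentially. r k < d" using r(1) d(1) by (rule order_tendstoD)
  then show "\<forall>\<^sub>F k in sequentially. (\<integral>\<^sup>+x\<in>cbox a b. mean_osc f (r k) x \<partial>lborel) < ennreal e"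
  proof eventually_elim
    case (elim k)
    have "ennreal (e/2) < ennreal e" using \<open>0 < e\<close> by (simp add: ennreal_less_iff)
    with d(2)[OF r(2) elim] show ?case by (rule le_less_trans)
  qed
qed

lemma mean_osc_AE_subseq:
  fixes f :: "real^'n \<Rightarrow> real"
  assumes f: "locally_integrable_borel f" and r: "r \<longlonglongrightarrow> 0" "\<And>k. 0 < r k"
  obtains s :: "nat \<Rightarrow> nat" where "strict_mono s"
    "AE x in lborel. x \<in> cbox a b \<longrightarrow> (\<lambda>k. mean_osc f (r (s k)) x) \<longlonglongrightarrow> 0"
proof -
  have [measurable]: "f \<in> borel_measurable borel" using f by measurable
  have "\<exists>s::nat \<Rightarrow> nat. strict_mono s \<and>
     (AE x in lborel. (\<lambda>k. mean_osc f (r (s k)) x * indicator (cbox a b) x) \<longlonglongrightarrow> 0)"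
    by (intro nn_integral_tendsto_zero_AE_subseq mean_osc_tendsto f r) auto
  then obtain s :: "nat \<Rightarrow> nat" where s: "strict_mono s" 
    "AE x in lborel. (\<lambda>k. mean_osc f (r (s k)) x * indicator (cbox a b) x) \<longlonglongrightarrow> 0" by blast
  have "AE x in lborel. x \<in> cbox a b \<longrightarrow> (\<lambda>k. mean_osc f (r (s k)) x) \<longlonglongrightarrow> 0"
    using s(2) by eventually_elim auto
  with s(1) that show ?thesis by blast
qed

subsection \<open>Mollification\<close>

text \<open>The function \<open>exp (- 1 / u)\<close> divided by \<open>u ^ m\<close>, extended by
  zero. The derivative is a combination of the next two members of the family, so the smoothness of
  the bumps rests on one differentiation formula.\<close>

definition flat :: "nat \<Rightarrow> real \<Rightarrow> real" where
  "flat m u = (if 0 < u then (1 / u) ^ m * exp (- (1 / u)) else 0)"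

lemma flat_Suc: "flat m u = u * flat (Suc m) u"
  by (simp add: flat_def)

lemma flat_at_0: "(flat m \<longlongrightarrow> 0) (at 0)"
proof -
  have "((\<lambda>u. inverse u ^ m / exp (inverse u)) \<longlongrightarrow> (0::real)) (at_right 0)"
    by (rule filterlim_compose[OF tendsto_power_div_exp_0 filterlim_inverse_at_top_right])
  moreover have "\<forall>\<^sub>F u in at_right 0. inverse u ^ m / exp (inverse u) = flat m u"
    by (auto simp: eventually_at_filter flat_def exp_minus divide_inverse)
  ultimately have r: "(flat m \<longlongrightarrow> 0) (at_right 0)" by (rule Lim_transform_eventually)
  have "\<forall>\<^sub>F u in at_left 0. flat m u = 0" by (auto simp: eventually_at_filter flat_def)
  then have "(flat m \<longlongrightarrow> 0) (at_left 0)" by (rule tendsto_eventually)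
  with r show ?thesis by (simp add: filterlim_split_at)
qed

lemma flat_has_derivative:
  "(flat m has_real_derivative (flat (m + 2) u - m * flat (m + 1) u)) (at u)"
proof (cases "u = 0")
  case True
  \<comment> \<open>At the origin the difference quotient is \<open>flat (Suc m)\<close> itself,
    whose limit is already known to be zero.\<close>
  have "((\<lambda>h. (flat m (0 + h) - flat m 0) / h) \<longlongrightarrow> 0) (at 0)"
    by (rule Lim_transform_eventually[OF flat_at_0[of "Suc m"]])
       (auto simp: eventually_at_filter flat_def)
  then show ?thesis using True by (simp add: DERIV_def flat_def)
next
  case False
  show ?thesis
  proof (cases "0 < u")
    case True
    have "((\<lambda>u. (1 / u) ^ m * exp (- (1 / u))) has_real_derivative (flat (m + 2) u - m * flat (m + 1) u)) (at u)"
    proof -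
      have i: "((\<lambda>u. 1 / u) has_real_derivative - ((1 / u) ^ 2)) (at u)"
        using True by (auto intro!: derivative_eq_intros simp: power2_eq_square)
      have e: "((\<lambda>u. exp (- (1 / u))) has_real_derivative exp (- (1 / u)) * - (- ((1 / u) ^ 2))) (at u)"
        by (rule DERIV_chain2[OF DERIV_exp DERIV_minus[OF i]])
      have p: "((\<lambda>u. (1 / u) ^ m) has_real_derivative - m * (1 / u) ^ (m + 1)) (at u)"
      proof (cases m)
        case (Suc k)
        show ?thesis unfolding Suc
          by (rule DERIV_cong[OF DERIV_power_Suc[OF i, of k]]) (simp add: power2_eq_square algebra_simps add_divide_distrib diff_divide_distrib)
      qed simp
      have "- m * (1 / u) ^ (m + 1) * exp (- (1 / u)) + exp (- (1 / u)) * - (- ((1 / u) ^ 2)) * (1 / u) ^ m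
        = flat (m + 2) u - m * flat (m + 1) u"
        using True by (simp add: flat_def power_add power2_eq_square algebra_simps)
      then show ?thesis by (rule DERIV_cong[OF DERIV_mult[OF p e]])
    qed
    then show ?thesis
    proof (rule has_field_derivative_transform_within_open)
      show "open {0::real<..}" "u \<in> {0<..}" using True by auto
    qed (simp add: flat_def)
  next
    case False
    have "((\<lambda>u. 0) has_real_derivative (flat (m + 2) u - m * flat (m + 1) u)) (at u)"
      using False by (simp add: flat_def)
    then show ?thesis
    proof (rule has_field_derivative_transform_within_open)
      show "open {..<0::real}" "u \<in> {..<0}" using False \<open>u \<noteq> 0\<close> by auto
    qed (simp add: flat_def)
  qed
qed

text \<open>Put \<open>v = x * (1 - x)\<close>. Since
  \<open>flat (2 * k) v = v ^ 2 * flat (2 * k + 2) v\<close> and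
  \<open>flat (2 * k + 1) v = v * flat (2 * k + 2) v\<close>, all terms produced by the product rule
  share the factor \<open>flat (2 * k + 2) v\<close>; the recursion collects the cofactors.\<close>

primrec bump_poly :: "nat \<Rightarrow> real poly" where
  "bump_poly 0 = 1"
| "bump_poly (Suc k) = pderiv (bump_poly k) * [:0, 1, -1:] ^ 2
     + bump_poly k * [:1, -2:] * (1 - smult (of_nat (2 * k)) [:0, 1, -1:])"

text \<open>The \<open>k\<close>-th derivative of \<open>exp (- 1 / (x * (1 - x)))\<close>, extended by zero outside the unit interval.\<close>

definition bump :: "nat \<Rightarrow> real \<Rightarrow> real" where
  "bump k x = poly (bump_poly k) x * flat (2 * k) (x * (1 - x))"

lemma bump_has_derivative: "(bump k has_real_derivative bump (Suc k) x) (at x)"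
proof -
  let ?v = "x * (1 - x)"
  have inner: "((\<lambda>x. x * (1 - x)) has_real_derivative (1 - 2 * x)) (at x)"
    by (auto intro!: derivative_eq_intros)
  have "((\<lambda>x. flat (2 * k) (x * (1 - x))) has_real_derivative
      (flat (2 * k + 2) ?v - real (2 * k) * flat (2 * k + 1) ?v) * (1 - 2 * x)) (at x)"
    by (rule DERIV_chain2[OF flat_has_derivative inner])
  from DERIV_mult[OF poly_DERIV[of "bump_poly k" x] this]
  have "(bump k has_real_derivative (poly (pderiv (bump_poly k)) x * flat (2 * k) ?v
     + ((flat (2 * k + 2) ?v - real (2 * k) * flat (2 * k + 1) ?v) * (1 - 2 * x)) * poly (bump_poly k) x)) (at x)" (is "(_ has_real_derivative ?D) _")
    unfolding bump_def by simp
  moreover have "?D = bump (Suc k) x"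
  proof -
    define v F where "v = ?v" and "F = flat (2 * k + 2) v"
    have F: "flat (2 * k) v = v * (v * F)" "flat (2 * k + 1) v = v * F"
      using flat_Suc[of "2 * k" v] flat_Suc[of "2 * k + 1" v] by (simp_all add: F_def)
    have v: "poly [:0, 1, -1:] x = v" by (simp add: v_def algebra_simps)
    have "bump (Suc k) x = (poly (pderiv (bump_poly k)) x * v ^ 2
        + poly (bump_poly k) x * (1 - 2 * x) * (1 - real (2 * k) * v)) * F"
      unfolding bump_def bump_poly.simps poly_add poly_mult poly_power poly_diff poly_smult poly_1 v
      by (simp add: F_def v_def)
    then show ?thesis unfolding v_def[symmetric] F F_def[symmetric]
      by (simp add: power2_eq_square algebra_simps)
  qed
  ultimately show ?thesis by simp
qed

lemma bump_outside: "x \<notin> {0..1} \<Longrightarrow> bump k x = 0"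
  by (auto simp: bump_def flat_def zero_less_mult_iff)

lemma bump_continuous: "continuous_on UNIV (bump k)"
  by (intro continuous_at_imp_continuous_on ballI DERIV_isCont[OF bump_has_derivative])

lemma bump_measurable[measurable]: "bump k \<in> borel_measurable borel"
  by (rule borel_measurable_continuous_onI[OF bump_continuous])

lemma bump_0_nonneg: "0 \<le> bump 0 x"
  by (simp add: bump_def flat_def)

lemma bump_0_le: "bump 0 x \<le> 1"
  by (simp add: bump_def flat_def)

lemma bump_0_ge:
  assumes "1 / 4 \<le> x" "x \<le> 3 / 4"
  shows "exp (- 16 / 3) \<le> bump 0 x"
proof -
  have "0 \<le> (x - 1 / 4) * (3 / 4 - x)" using assms by simp
  moreover have "(x - 1 / 4) * (3 / 4 - x) = x * (1 - x) - 3 / 16" by (simp add: field_simps)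
  ultimately have v: "3 / 16 \<le> x * (1 - x)" by simp
  then have "1 / (x * (1 - x)) \<le> 1 / (3 / 16)" by (intro divide_left_mono) auto
  then show ?thesis using v by (simp add: bump_def flat_def)
qed

text \<open>Coordinate \<open>i\<close> carries a derivative of order \<open>m i\<close>. Admitting
  all orders closes the family under partial derivatives: each one raises an entry of
  \<open>m\<close> and divides by \<open>r\<close>. Membership in every \<open>C_k\<close> is then
  an induction over arbitrary \<open>m\<close>.\<close>

definition cube_bump :: "('n \<Rightarrow> nat) \<Rightarrow> real \<Rightarrow> real^'n \<Rightarrow> real" where
  "cube_bump m r y = (\<Prod>i\<in>UNIV. bump (m i) (y $ i / r))"

lemma cube_bump_has_derivative:
  fixes y :: "real^'n"
  assumes "r \<noteq> 0"
  shows "(cube_bump m r has_derivative (\<lambda>h. \<Sum>i\<in>UNIV. h $ i / r * cube_bump (m(i := Suc (m i))) r y)) (at y)"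
proof -
  have "((\<lambda>y. bump (m i) (y $ i / r)) has_derivative (\<lambda>h. bump (Suc (m i)) (y $ i / r) * (h $ i / r))) (at y)" for i
  proof -
    have "((\<lambda>y. y $ i / r) has_derivative (\<lambda>h. h $ i / r)) (at y)"
      by (intro bounded_linear_imp_has_derivative bounded_linear_divide[THEN bounded_linear_compose] bounded_linear_vec_nth)
    then show ?thesis
      using bump_has_derivative[of "m i" "y $ i / r", unfolded has_field_derivative_def]
      by (rule has_derivative_compose)
  qed
  then have "(cube_bump m r has_derivative (\<lambda>h. \<Sum>i\<in>UNIV. bump (Suc (m i)) (y $ i / r) * (h $ i / r)
      * (\<Prod>j\<in>UNIV - {i}. bump (m j) (y $ j / r)))) (at y)"
    unfolding cube_bump_def by (rule has_derivative_prod)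
  moreover have "bump (Suc (m i)) (y $ i / r) * (h $ i / r) * (\<Prod>j\<in>UNIV - {i}. bump (m j) (y $ j / r))
      = h $ i / r * cube_bump (m(i := Suc (m i))) r y" for i and h :: "real^'n"
    unfolding cube_bump_def by (subst prod.remove[of UNIV i]) (auto intro!: prod.cong)
  ultimately show ?thesis by (simp only:)
qed

lemma cube_bump_outside:
  assumes "0 < r" "y \<notin> cbox 0 (vec r)"
  shows "cube_bump m r y = 0"
proof -
  from assms obtain i where "y $ i / r \<notin> {0..1}"
    by (auto simp: mem_box_cart not_le divide_simps split: if_splits)
  then have "bump (m i) (y $ i / r) = 0" by (rule bump_outside)
  then show ?thesis unfolding cube_bump_def by (intro prod_zero) auto
qed

lemma cube_bump_continuous:
  fixes m :: "'n::finite \<Rightarrow> nat"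
  assumes "r \<noteq> 0"
  shows "continuous_on UNIV (cube_bump m r)"
  using cube_bump_has_derivative[OF assms]
  by (intro continuous_at_imp_continuous_on ballI has_derivative_continuous) blast

lemma cube_bump_measurable[measurable]: "cube_bump (m :: 'n::finite \<Rightarrow> nat) r \<in> borel_measurable borel"
  unfolding cube_bump_def by measurable

lemma cube_bump_bounded:
  fixes m :: "'n::finite \<Rightarrow> nat"
  assumes r: "0 < r"
  obtains B where "0 \<le> B" "\<And>y. \<bar>cube_bump m r y\<bar> \<le> B"
proof -
  have "compact (cube_bump m r ` cbox 0 (vec r))"
    using r by (intro compact_continuous_image continuous_on_subset[OF cube_bump_continuous]) auto
  then obtain B where B: "\<And>z. z \<in> cube_bump m r ` cbox 0 (vec r) \<Longrightarrow> norm z \<le> B"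
    using compact_imp_bounded bounded_iff by metis
  have "\<bar>cube_bump m r y\<bar> \<le> max 0 B" for y
    using B[of "cube_bump m r y"] cube_bump_outside[OF r, of y m] by (cases "y \<in> cbox 0 (vec r)") auto
  then show ?thesis using that[of "max 0 B"] by auto
qed

lemma cube_bump_shift_derivative:
  fixes m :: "'n::finite \<Rightarrow> nat"
  assumes r: "0 < r"
  shows "((\<lambda>y. c * cube_bump m r (y - x)) has_derivative
      (\<lambda>h. c * (\<Sum>i\<in>UNIV. h $ i / r * cube_bump (m(i := Suc (m i))) r (y - x)))) (at y)"
    and "partial_deriv i (\<lambda>y. c * cube_bump m r (y - x)) = (\<lambda>y. c / r * cube_bump (m(i := Suc (m i))) r (y - x))"
proof -
  show d: "((\<lambda>y. c * cube_bump m r (y - x)) has_derivative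
      (\<lambda>h. c * (\<Sum>i\<in>UNIV. h $ i / r * cube_bump (m(i := Suc (m i))) r (y - x)))) (at y)" for y
  proof -
    have "((\<lambda>y. y - x) has_derivative (\<lambda>h. h)) (at y)" by (auto intro!: derivative_eq_intros)
    from has_derivative_compose[OF this cube_bump_has_derivative]
    show ?thesis using r by (intro has_derivative_mult_right) auto
  qed
  show "partial_deriv i (\<lambda>y. c * cube_bump m r (y - x)) = (\<lambda>y. c / r * cube_bump (m(i := Suc (m i))) r (y - x))"
  proof
    fix y
    have "partial_deriv i (\<lambda>y. c * cube_bump m r (y - x)) y
       = c * (\<Sum>j\<in>UNIV. axis i 1 $ j / r * cube_bump (m(j := Suc (m j))) r (y - x))"
      unfolding partial_deriv_def frechet_derivative_at[OF d, symmetric] ..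
    also have "(\<Sum>j\<in>UNIV. axis i 1 $ j / r * cube_bump (m(j := Suc (m j))) r (y - x))
      = (\<Sum>j\<in>UNIV. if j = i then 1 / r * cube_bump (m(i := Suc (m i))) r (y - x) else 0)"
      by (intro sum.cong) (auto simp: axis_def)
    also have "\<dots> = 1 / r * cube_bump (m(i := Suc (m i))) r (y - x)" by simp
    finally show "partial_deriv i (\<lambda>y. c * cube_bump m r (y - x)) y = c / r * cube_bump (m(i := Suc (m i))) r (y - x)"
      by simp
  qed
qed

lemma C_k_cube_bump:
  fixes m :: "'n::finite \<Rightarrow> nat"
  assumes r: "0 < r"
  shows "C_k k (\<lambda>y. c * cube_bump m r (y - x))"
proof (induction k arbitrary: c m)
  case 0
  have "continuous_on UNIV (\<lambda>y. cube_bump m r (y - x))"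
    using r by (intro continuous_on_compose2[OF cube_bump_continuous] continuous_intros) auto
  then show ?case by (auto intro: continuous_intros)
next
  case (Suc k)
  show ?case unfolding C_k.simps cube_bump_shift_derivative(2)[OF r]
    using Suc cube_bump_shift_derivative(1)[OF r] unfolding differentiable_def by blast
qed

lemma cube_bump_test_function:
  fixes m :: "'n::finite \<Rightarrow> nat"
  assumes r: "0 < r"
  shows "(\<lambda>y. cube_bump m r (y - x)) \<in> test_functions"
proof -
  have "{y. cube_bump m r (y - x) \<noteq> 0} \<subseteq> cbox x (x + vec r)"
  proof
    fix y assume "y \<in> {y. cube_bump m r (y - x) \<noteq> 0}"
    then have "y - x \<in> cbox 0 (vec r)" using cube_bump_outside[OF r] by auto
    then show "y \<in> cbox x (x + vec r)" by (auto simp: mem_box_cart algebra_simps)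
  qed
  then have "bounded {y. cube_bump m r (y - x) \<noteq> 0}"
    using bounded_cbox bounded_subset by blast
  then have "compact (closure {y. cube_bump m r (y - x) \<noteq> 0})" by simp
  moreover have "C_k k (\<lambda>y. cube_bump m r (y - x))" for k
    using C_k_cube_bump[OF r, of k 1] by simp
  ultimately show ?thesis by (simp add: test_functions_def)
qed

definition bump_integral :: "'n::finite itself \<Rightarrow> real \<Rightarrow> real" where
  "bump_integral _ r = (LINT y|lborel. cube_bump (\<lambda>_::'n. 0) r y)"

lemma cube_bump_0_nonneg: "0 \<le> cube_bump (\<lambda>_. 0) r y"
  unfolding cube_bump_def by (intro prod_nonneg) (simp add: bump_0_nonneg)

lemma cube_bump_0_le: "cube_bump (\<lambda>_. 0) r y \<le> 1"
  unfolding cube_bump_def by (intro prod_le_1) (simp add: bump_0_nonneg bump_0_le)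

lemma cube_bump_integrable:
  fixes m :: "'n::finite \<Rightarrow> nat"
  assumes f: "locally_integrable_borel f" and r: "0 < r"
  shows "integrable lborel (\<lambda>y. f y * cube_bump m r (y - x))"
proof -
  have [measurable]: "f \<in> borel_measurable borel" using f by measurable
  obtain B where B: "0 \<le> B" "\<And>y. \<bar>cube_bump m r y\<bar> \<le> B" using cube_bump_bounded[OF r] by blast
  have "integrable lborel (\<lambda>y. B * (indicator (cbox x (x + vec r)) y *\<^sub>R f y))"
    using f unfolding locally_integrable_borel_def set_integrable_def by (intro integrable_mult_right) auto
  then show ?thesis
  proof (rule Bochner_Integration.integrable_bound)
    show "AE y in lborel. norm (f y * cube_bump m r (y - x)) \<le> norm (B * (indicator (cbox x (x + vec r)) y *\<^sub>R f y))"
    proof (rule AE_I2)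
      fix y
      show "norm (f y * cube_bump m r (y - x)) \<le> norm (B * (indicator (cbox x (x + vec r)) y *\<^sub>R f y))"
      proof (cases "y \<in> cbox x (x + vec r)")
        case True
        then show ?thesis using B mult_right_mono[OF B(2)[of "y - x"], of "\<bar>f y\<bar>"] by (simp add: abs_mult mult_ac)
      next
        case False
        then have "y - x \<notin> cbox 0 (vec r)" by (auto simp: mem_box_cart algebra_simps)
        then show ?thesis using cube_bump_outside[OF r, of "y - x" m] by simp
      qed
    qed
  qed measurable
qed

lemma const_locally_integrable_borel: "locally_integrable_borel (\<lambda>_::real^'n. c)"
proof -
  have "integrable lborel (indicat_real (cbox a b))" for a b :: "real^'n"
    using emeasure_lborel_cbox_finite[of a b] by (intro integrable_real_indicator) auto
  then show ?thesis unfolding locally_integrable_borel_def set_integrable_def by auto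
qed

lemma integral_cube_bump_shift:
  fixes x :: "real^'n"
  shows "(LINT y|lborel. cube_bump (\<lambda>_. 0) r (y - x)) = bump_integral TYPE('n) r"
proof -
  have "(LINT y|lborel. cube_bump (\<lambda>_::'n. 0) r y) = (LINT y|distr lborel borel ((+) (- x)). cube_bump (\<lambda>_::'n. 0) r y)"
    by (simp add: lborel_distr_plus)
  also have "\<dots> = (LINT y|lborel. cube_bump (\<lambda>_::'n. 0) r (- x + y))"
    by (subst integral_distr) auto
  finally show ?thesis by (simp add: bump_integral_def)
qed

text \<open>Only the order \<open>r ^ n\<close> of the normalising integral matters. It is read off
  the central cube of side \<open>r / 2\<close>, where each factor is at least
  \<open>exp (- 16 / 3)\<close>, because \<open>x * (1 - x)\<close> is at least 3/16 on the middle
  half of the unit interval.\<close>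

lemma bump_integral_ge:
  assumes r: "0 < r"
  shows "(exp (- 16 / 3) * (r / 2)) ^ CARD('n) \<le> bump_integral TYPE('n::finite) r"
proof -
  define a :: "real^'n" where "a = vec (r / 4)"
  let ?K = "cbox a (a + vec (r / 2))"
  let ?b = "exp (- 16 / 3) :: real"
  have K: "emeasure lborel ?K = ennreal ((r / 2) ^ CARD('n))"
    using r by (intro emeasure_lborel_cbox_vec) simp
  have "?b ^ CARD('n) * (r / 2) ^ CARD('n) = (LINT y|lborel. ?b ^ CARD('n) * indicator ?K y)"
    using r by (simp add: measure_def K)
  also have "\<dots> \<le> (LINT y|lborel. cube_bump (\<lambda>_::'n. 0) r y)"
  proof (rule integral_mono)
    show "integrable lborel (\<lambda>y. ?b ^ CARD('n) * indicator ?K y)"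
      using K by (intro integrable_mult_right integrable_real_indicator) auto
    show "integrable lborel (cube_bump (\<lambda>_::'n. 0) r)"
      using cube_bump_integrable[OF const_locally_integrable_borel[of 1] r, of _ 0] by simp
    fix y :: "real^'n"
    show "?b ^ CARD('n) * indicator ?K y \<le> cube_bump (\<lambda>_::'n. 0) r y"
    proof (cases "y \<in> ?K")
      case True
      then have "1 / 4 \<le> y $ i / r" "y $ i / r \<le> 3 / 4" for i
        using r by (auto simp: mem_box_cart a_def field_simps)
      then have "(\<Prod>i\<in>(UNIV::'n set). ?b) \<le> cube_bump (\<lambda>_::'n. 0) r y"
        unfolding cube_bump_def by (intro prod_mono conjI bump_0_ge) auto
      with True show ?thesis by simp
    qed (simp add: cube_bump_0_nonneg)
  qed
  finally show ?thesis unfolding bump_integral_def by (simp only: power_mult_distrib)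
qed

lemma bump_integral_pos:
  assumes r: "0 < r"
  shows "0 < bump_integral TYPE('n::finite) r"
proof -
  have "0 < (exp (- 16 / 3) * (r / 2)) ^ CARD('n)" using r by simp
  also note bump_integral_ge[OF r]
  finally show ?thesis .
qed

text \<open>The kernel is one-sided: it averages over the cube with lower corner \<open>x\<close>
  and side \<open>r\<close>. The difference \<open>y - x\<close> in its argument, rather than
  \<open>x - y\<close>, matches the translated bumps that serve as test functions.\<close>

definition mollify :: "(real^'n \<Rightarrow> real) \<Rightarrow> real \<Rightarrow> real^'n \<Rightarrow> real" where
  "mollify f r x = (LINT y|lborel. f y * cube_bump (\<lambda>_. 0) r (y - x)) / bump_integral TYPE('n) r"

text \<open>The normalised kernel is at most \<open>(2 * exp (16 / 3)) ^ n / r ^ n\<close> and lives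
  in a box of radius \<open>r\<close>. So the single quantity \<open>mean_osc\<close> governs both
  the \<open>L^1\<close> and the almost everywhere convergence of mollifications.\<close>

lemma mollify_diff_le:
  fixes f :: "real^'n \<Rightarrow> real"
  assumes f: "locally_integrable_borel f" and r: "0 < r"
  shows "ennreal \<bar>mollify f r x - f x\<bar> \<le> ennreal ((2 * exp (16 / 3)) ^ CARD('n)) * mean_osc f r x"
proof -
  have [measurable]: "f \<in> borel_measurable borel" using f by measurable
  let ?N = "bump_integral TYPE('n) r" and ?\<phi> = "\<lambda>y. cube_bump (\<lambda>_::'n. 0) r (y - x)" and ?n = "CARD('n)"
  have N: "0 < ?N" by (rule bump_integral_pos[OF r])
  note i1 = cube_bump_integrable[OF f r, of "\<lambda>_. 0" x]
  note i2 = cube_bump_integrable[OF const_locally_integrable_borel[of "f x"] r, of "\<lambda>_. 0" x]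
  have "f x = (LINT y|lborel. f x * ?\<phi> y) / ?N" using N by (simp add: integral_cube_bump_shift)
  then have "mollify f r x - f x = (LINT y|lborel. f y * ?\<phi> y - f x * ?\<phi> y) / ?N"
    unfolding mollify_def using Bochner_Integration.integral_diff[OF i1 i2] by (simp add: diff_divide_distrib)
  then have "ennreal \<bar>mollify f r x - f x\<bar> = ennreal (norm (LINT y|lborel. f y * ?\<phi> y - f x * ?\<phi> y)) / ennreal ?N"
    using N by (simp add: divide_ennreal)
  also have "\<dots> \<le> (\<integral>\<^sup>+y. ennreal (norm (f y * ?\<phi> y - f x * ?\<phi> y)) \<partial>lborel) / ennreal ?N"
    by (intro divide_right_mono_ennreal integral_norm_bound_ennreal Bochner_Integration.integrable_diff i1 i2)
  also have "(\<integral>\<^sup>+y. ennreal (norm (f y * ?\<phi> y - f x * ?\<phi> y)) \<partial>lborel)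
      = (\<integral>\<^sup>+z. ennreal (norm (f (z + x) * ?\<phi> (z + x) - f x * ?\<phi> (z + x))) \<partial>lborel)"
    by (rule nn_integral_lborel_shift[symmetric]) measurable
  also have "\<dots> \<le> (\<integral>\<^sup>+z\<in>cbox (- vec r) (vec r). ennreal \<bar>f (x + z) - f x\<bar> \<partial>lborel)" (is "_ \<le> ?I")
  proof (rule nn_integral_mono)
    fix z :: "real^'n"
    show "ennreal (norm (f (z + x) * ?\<phi> (z + x) - f x * ?\<phi> (z + x)))
      \<le> ennreal \<bar>f (x + z) - f x\<bar> * indicator (cbox (- vec r) (vec r)) z"
    proof (cases "z \<in> cbox (- vec r) (vec r)")
      case True
      have "norm (f (z + x) * ?\<phi> (z + x) - f x * ?\<phi> (z + x)) = \<bar>f (x + z) - f x\<bar> * cube_bump (\<lambda>_. 0) r z"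
        using cube_bump_0_nonneg[of r z] by (simp add: abs_mult add.commute flip: left_diff_distrib)
      also have "\<dots> \<le> \<bar>f (x + z) - f x\<bar> * 1" by (intro mult_left_mono cube_bump_0_le) simp
      finally show ?thesis using True by (simp add: ennreal_leI)
    next
      case False
      have "cbox 0 (vec r) \<subseteq> (cbox (- vec r) (vec r) :: (real^'n) set)"
      proof
        fix y :: "real^'n" assume "y \<in> cbox 0 (vec r)"
        then have y: "0 \<le> y $ i" "y $ i \<le> r" for i by (auto simp: mem_box_cart)
        have "- r \<le> y $ i" for i using r y(1)[of i] by linarith
        with y show "y \<in> cbox (- vec r) (vec r)" by (simp add: mem_box_cart)
      qed
      then have "cube_bump (\<lambda>_. 0) r z = 0" using False cube_bump_outside[OF r] by blast
      then show ?thesis by simp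
    qed
  qed
  finally have "ennreal \<bar>mollify f r x - f x\<bar> \<le> ?I / ennreal ?N" by (simp add: divide_right_mono_ennreal)
  also have "\<dots> = ?I * ennreal (1 / ?N)"
    using N by (simp add: divide_ennreal_def inverse_ennreal inverse_eq_divide)
  also have "\<dots> \<le> ?I * ennreal ((2 * exp (16 / 3)) ^ ?n / r ^ ?n)"
  proof (intro mult_left_mono ennreal_leI)
    have "1 / ?N \<le> 1 / (exp (- 16 / 3) * (r / 2)) ^ ?n"
      using bump_integral_ge[OF r, where 'n='n] r N by (intro divide_left_mono) auto
    also have "\<dots> = (1 / (exp (- 16 / 3) * (r / 2))) ^ ?n" by (rule power_one_over[symmetric])
    also have "1 / (exp (- 16 / 3) * (r / 2)) = 2 * exp (16 / 3) / r"
      using r by (simp add: exp_minus field_simps)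
    finally show "1 / ?N \<le> (2 * exp (16 / 3)) ^ ?n / r ^ ?n" by (simp add: power_divide)
  qed simp
  also have "\<dots> = ennreal ((2 * exp (16 / 3)) ^ ?n) * mean_osc f r x"
    using r by (simp add: mean_osc_def divide_ennreal[symmetric] ennreal_times_divide mult.commute)
  finally show ?thesis .
qed

subsection \<open>The Poincare inequality\<close>

lemma mollify_measurable[measurable]:
  fixes f :: "real^'n \<Rightarrow> real"
  assumes [measurable]: "f \<in> borel_measurable borel"
  shows "mollify f r \<in> borel_measurable borel"
proof -
  have [measurable]: "(\<lambda>(x, y). f y * cube_bump (\<lambda>_. 0) r (y - x)) \<in> borel_measurable (borel \<Otimes>\<^sub>M lborel)"
    by measurable
  show ?thesis unfolding mollify_def by measurable
qed

text \<open>The Poincare inequality integrates along segments, so derivatives along lines suffice.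
  This reduces differentiation under the integral to one real parameter, with a Lipschitz bound for
  the kernel supplying the majorant.\<close>

lemma integral_cube_bump_line_deriv:
  fixes f :: "real^'n \<Rightarrow> real" and m :: "'n \<Rightarrow> nat"
  assumes f: "locally_integrable_borel f" and r: "0 < r"
  shows "((\<lambda>t. LINT y|lborel. f y * cube_bump m r (y - (x + t *\<^sub>R v))) has_real_derivative
    (LINT y|lborel. f y * (\<Sum>i\<in>UNIV. - v $ i / r * cube_bump (m(i := Suc (m i))) r (y - (x + t *\<^sub>R v))))) (at t)"
proof -
  have [measurable]: "f \<in> borel_measurable borel" using f by measurable
  define K where "K t y = cube_bump m r (y - (x + t *\<^sub>R v))" for t y
  define K' where "K' t y = (\<Sum>i\<in>UNIV. - v $ i / r * cube_bump (m(i := Suc (m i))) r (y - (x + t *\<^sub>R v)))" for t y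
  have [measurable]: "K t \<in> borel_measurable borel" "K' t \<in> borel_measurable borel" for t
    unfolding K_def K'_def by measurable
  have dK: "((\<lambda>t. K t y) has_real_derivative K' t y) (at t)" for t y
  proof -
    have "((\<lambda>t. y - (x + t *\<^sub>R v)) has_derivative (\<lambda>h. - (h *\<^sub>R v))) (at t)"
      by (auto intro!: derivative_eq_intros)
    from has_derivative_compose[OF this cube_bump_has_derivative[of r m]]
    have "((\<lambda>t. K t y) has_derivative (\<lambda>h. \<Sum>i\<in>UNIV. (- (h *\<^sub>R v)) $ i / r
        * cube_bump (m(i := Suc (m i))) r (y - (x + t *\<^sub>R v)))) (at t)"
      using r by (simp add: K_def)
    moreover have "(\<lambda>h. \<Sum>i\<in>UNIV. (- (h *\<^sub>R v)) $ i / r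
        * cube_bump (m(i := Suc (m i))) r (y - (x + t *\<^sub>R v))) = (*) (K' t y)"
      by (rule ext, unfold K'_def sum_distrib_right, rule sum.cong) (simp_all add: mult_ac)
    ultimately show ?thesis by (simp add: has_field_derivative_def)
  qed
  have "\<exists>B\<ge>0. \<forall>i y. \<bar>cube_bump (m(i := Suc (m i))) r y\<bar> \<le> B"
  proof -
    have "\<forall>i. \<exists>B\<ge>0. \<forall>y. \<bar>cube_bump (m(i := Suc (m i))) r y\<bar> \<le> B"
      using cube_bump_bounded[OF r] by metis
    then obtain B where B: "\<And>i. 0 \<le> B i" "\<And>i y. \<bar>cube_bump (m(i := Suc (m i))) r y\<bar> \<le> B i" by metis
    have "B i \<le> sum B UNIV" for i by (rule member_le_sum) (auto simp: B)
    then have "\<bar>cube_bump (m(i := Suc (m i))) r y\<bar> \<le> sum B UNIV" for i y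
      using B(2)[of i y] order_trans by blast
    moreover have "0 \<le> sum B UNIV" by (intro sum_nonneg B)
    ultimately show ?thesis by blast
  qed
  then obtain B where B: "0 \<le> B" "\<And>i y. \<bar>cube_bump (m(i := Suc (m i))) r y\<bar> \<le> B" by blast
  define L where "L = (\<Sum>i\<in>UNIV. \<bar>v $ i\<bar> / r * B)"
  have L0: "0 \<le> L" unfolding L_def using B r by (intro sum_nonneg) auto
  have K'L: "\<bar>K' t y\<bar> \<le> L" for t y
  proof -
    have "\<bar>K' t y\<bar> \<le> (\<Sum>i\<in>UNIV. \<bar>- v $ i / r * cube_bump (m(i := Suc (m i))) r (y - (x + t *\<^sub>R v))\<bar>)"
      unfolding K'_def by (rule sum_abs)
    also have "\<dots> \<le> L" unfolding L_def
    proof (rule sum_mono)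
      fix i
      show "\<bar>- v $ i / r * cube_bump (m(i := Suc (m i))) r (y - (x + t *\<^sub>R v))\<bar> \<le> \<bar>v $ i\<bar> / r * B"
        unfolding abs_mult using B r by (intro mult_mono) auto
    qed
    finally show ?thesis .
  qed
  have lip: "\<bar>K (t + h) y - K t y\<bar> \<le> L * \<bar>h\<bar>" for t h y
  proof -
    have "norm (K (t + h) y - K t y) \<le> L * norm (t + h - t)"
      by (rule field_differentiable_bound[where S=UNIV and f'="\<lambda>t. K' t y"])
         (use dK K'L in auto)
    then show ?thesis by simp
  qed
  have int: "integrable lborel (\<lambda>y. f y * K t y)" for t
    unfolding K_def by (rule cube_bump_integrable[OF f r])
  define g where "g t = (LINT y|lborel. f y * K t y)" for t
  have "((\<lambda>h. (g (t + h) - g t) / h) \<longlongrightarrow> (LINT y|lborel. f y * K' t y)) (at 0)"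
    unfolding tendsto_at_iff_sequentially comp_def
  proof (intro allI impI)
    fix h :: "nat \<Rightarrow> real" assume h: "\<forall>i. h i \<in> UNIV - {0}" "h \<longlonglongrightarrow> 0"
    \<comment> \<open>The increments are bounded, so all shifted kernels vanish outside one box
      \<open>S\<close>; the product of the Lipschitz constant with \<open>\<bar>f\<bar>\<close> on
      \<open>S\<close> is then an integrable majorant for the whole sequence.\<close>
    from h(2) have "Bseq h" by (rule convergent_imp_Bseq[OF convergentI])
    then obtain M where M: "0 < M" "\<And>k. \<bar>h k\<bar> \<le> M" by (auto simp: Bseq_def)
    define R where "R = norm x + (\<bar>t\<bar> + M) * norm v + CARD('n) * r"
    define S :: "(real^'n) set" where "S = cbox (- vec R) (vec R)"
    have supp: "K s y = 0" if s: "\<bar>s\<bar> \<le> \<bar>t\<bar> + M" and y: "y \<notin> S" for s y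
    proof (rule ccontr)
      assume "K s y \<noteq> 0"
      then have "y - (x + s *\<^sub>R v) \<in> cbox 0 (vec r)"
        using cube_bump_outside[OF r, of "y - (x + s *\<^sub>R v)" m] by (auto simp: K_def)
      then have c: "0 \<le> (y - (x + s *\<^sub>R v)) $ i" "(y - (x + s *\<^sub>R v)) $ i \<le> r" for i
        by (auto simp: mem_box_cart simp del: vector_minus_component)
      have "norm (y - (x + s *\<^sub>R v)) \<le> (\<Sum>i\<in>UNIV. \<bar>(y - (x + s *\<^sub>R v)) $ i\<bar>)" by (rule norm_le_l1_cart)
      also have "\<dots> \<le> (\<Sum>i\<in>(UNIV::'n set). r)" using c by (intro sum_mono) (simp only: abs_of_nonneg)
      finally have "norm (y - (x + s *\<^sub>R v)) \<le> CARD('n) * r" by simp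
      moreover have "norm y \<le> norm (y - (x + s *\<^sub>R v)) + norm (x + s *\<^sub>R v)"
        by (metis diff_add_cancel norm_triangle_ineq)
      moreover have "norm (x + s *\<^sub>R v) \<le> norm x + \<bar>s\<bar> * norm v"
        using norm_triangle_ineq[of x "s *\<^sub>R v"] by simp
      moreover have "\<bar>s\<bar> * norm v \<le> (\<bar>t\<bar> + M) * norm v" using s by (rule mult_right_mono) simp
      ultimately have "norm y \<le> R" unfolding R_def by linarith
      then have "\<bar>y $ i\<bar> \<le> R" for i using component_le_norm_cart[of y i] by linarith
      then have "- R \<le> y $ i" "y $ i \<le> R" for i by (simp_all add: abs_le_iff minus_le_iff)
      then have "y \<in> S" by (simp add: S_def mem_box_cart)
      with y show False by simp
    qed
    let ?q = "\<lambda>k y. f y * ((K (t + h k) y - K t y) / h k)"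
    have "(\<lambda>k. LINT y|lborel. ?q k y) \<longlonglongrightarrow> (LINT y|lborel. f y * K' t y)"
    proof (rule integral_dominated_convergence[where w="\<lambda>y. L * (indicator S y *\<^sub>R \<bar>f y\<bar>)"])
      have "set_integrable lborel S (\<lambda>y. \<bar>f y\<bar>)"
        using f unfolding locally_integrable_borel_def S_def by (intro set_integrable_abs) auto
      then show "integrable lborel (\<lambda>y. L * (indicator S y *\<^sub>R \<bar>f y\<bar>))"
        unfolding set_integrable_def by (intro integrable_mult_right) auto
      show "AE y in lborel. (\<lambda>k. ?q k y) \<longlonglongrightarrow> f y * K' t y"
      proof (rule AE_I2)
        fix y
        have "((\<lambda>h. (K (t + h) y - K t y) / h) \<longlongrightarrow> K' t y) (at 0)"
          using dK[of y t] by (simp add: DERIV_def)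
        then have "(\<lambda>k. (K (t + h k) y - K t y) / h k) \<longlonglongrightarrow> K' t y"
          using h unfolding tendsto_at_iff_sequentially comp_def by blast
        then show "(\<lambda>k. ?q k y) \<longlonglongrightarrow> f y * K' t y" by (intro tendsto_mult_left)
      qed
      show "AE y in lborel. norm (?q k y) \<le> L * (indicator S y *\<^sub>R \<bar>f y\<bar>)" for k
      proof (rule AE_I2)
        fix y
        have hk: "h k \<noteq> 0" using h(1) by auto
        show "norm (?q k y) \<le> L * (indicator S y *\<^sub>R \<bar>f y\<bar>)"
        proof (cases "y \<in> S")
          case True
          have "\<bar>(K (t + h k) y - K t y) / h k\<bar> \<le> L"
            using lip[of t "h k" y] hk by (simp add: abs_divide divide_le_eq)
          then have "\<bar>f y\<bar> * \<bar>(K (t + h k) y - K t y) / h k\<bar> \<le> \<bar>f y\<bar> * L" by (rule mult_left_mono) simp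
          then show ?thesis using True by (simp add: abs_mult mult.commute)
        next
          case False
          have "\<bar>t + h k\<bar> \<le> \<bar>t\<bar> + M" using M(2)[of k] by linarith
          then show ?thesis using supp[OF _ False, of "t + h k"] supp[OF _ False, of t] M False by simp
        qed
      qed
    qed measurable
    moreover have "(g (t + h k) - g t) / h k = (LINT y|lborel. ?q k y)" for k
    proof -
      have "g (t + h k) - g t = (LINT y|lborel. f y * K (t + h k) y - f y * K t y)"
        unfolding g_def using int by simp
      also have "\<dots> / h k = (LINT y|lborel. (f y * K (t + h k) y - f y * K t y) / h k)" by simp
      finally show ?thesis by (simp add: right_diff_distrib diff_divide_distrib)
    qed
    ultimately show "(\<lambda>k. (g (t + h k) - g t) / h k) \<longlonglongrightarrow> (LINT y|lborel. f y * K' t y)" by (simp only:)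
  qed
  then show ?thesis unfolding DERIV_def g_def K_def K'_def .
qed

definition weak_gradient_borel :: "(real^'n \<Rightarrow> real) \<Rightarrow> ('n \<Rightarrow> real^'n \<Rightarrow> real) \<Rightarrow> bool" where
  "weak_gradient_borel f g \<longleftrightarrow> locally_integrable_borel f \<and> (\<forall>i. locally_integrable_borel (g i)) \<and>
    (\<forall>\<phi>\<in>test_functions. \<forall>i. (LINT x|lborel. f x * partial_deriv i \<phi> x) = - (LINT x|lborel. g i x * \<phi> x))"

text \<open>Differentiating the kernel in the base point is minus differentiating it in the
  integration variable, and the defining identity of the weak gradient contributes another minus
  sign. The two cancel and leave the mollification of \<open>g\<close>.\<close>

lemma mollify_line_deriv:
  fixes f :: "real^'n \<Rightarrow> real"
  assumes fg: "weak_gradient_borel f g" and r: "0 < r"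
  shows "((\<lambda>t. mollify f r (x + t *\<^sub>R v)) has_real_derivative (\<Sum>i\<in>UNIV. v $ i * mollify (g i) r (x + t *\<^sub>R v))) (at t)"
proof -
  let ?N = "bump_integral TYPE('n) r" and ?m = "\<lambda>i. (\<lambda>_. 0)(i := Suc 0) :: 'n \<Rightarrow> nat" and ?p = "x + t *\<^sub>R v"
  have f: "locally_integrable_borel f" and g: "\<And>i. locally_integrable_borel (g i)"
    and wk: "\<And>\<phi> i. \<phi> \<in> test_functions \<Longrightarrow> (LINT x|lborel. f x * partial_deriv i \<phi> x) = - (LINT x|lborel. g i x * \<phi> x)"
    using fg by (auto simp: weak_gradient_borel_def)
  have 1: "(LINT y|lborel. f y * (cube_bump (?m i) r (y - ?p) / r)) = - (LINT y|lborel. g i y * cube_bump (\<lambda>_. 0) r (y - ?p))" for i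
    using wk[OF cube_bump_test_function[OF r, of "\<lambda>_. 0" ?p], of i]
    using cube_bump_shift_derivative(2)[OF r, of i 1 "\<lambda>_. 0" ?p] by simp
  have "(LINT y|lborel. f y * (\<Sum>i\<in>UNIV. - v $ i / r * cube_bump (?m i) r (y - ?p)))
      = (LINT y|lborel. (\<Sum>i\<in>UNIV. - v $ i * (f y * (cube_bump (?m i) r (y - ?p) / r))))"
    by (intro Bochner_Integration.integral_cong refl) (simp add: sum_distrib_left mult_ac)
  also have "\<dots> = (\<Sum>i\<in>UNIV. (LINT y|lborel. - v $ i * (f y * (cube_bump (?m i) r (y - ?p) / r))))"
    using integrable_divide[OF cube_bump_integrable[OF f r], of _ ?p r]
    by (intro Bochner_Integration.integral_sum integrable_mult_right) simp
  also have "\<dots> = (\<Sum>i\<in>UNIV. v $ i * (LINT y|lborel. g i y * cube_bump (\<lambda>_. 0) r (y - ?p)))"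
    by (simp only: integral_mult_right_zero 1) simp
  finally have e: "(LINT y|lborel. f y * (\<Sum>i\<in>UNIV. - v $ i / r * cube_bump (?m i) r (y - ?p))) / ?N
      = (\<Sum>i\<in>UNIV. v $ i * mollify (g i) r ?p)"
    by (simp add: mollify_def sum_divide_distrib)
  show ?thesis unfolding mollify_def[of f] e[symmetric]
    using integral_cube_bump_line_deriv[OF f r, of "\<lambda>_. 0" x v t] by (intro DERIV_cdivide) simp
qed

lemma mollify_line_continuous:
  fixes g :: "real^'n \<Rightarrow> real"
  assumes g: "locally_integrable_borel g" and r: "0 < r"
  shows "isCont (\<lambda>t. mollify g r (x + t *\<^sub>R v)) t"
proof -
  have "isCont (\<lambda>t. LINT y|lborel. g y * cube_bump (\<lambda>_. 0) r (y - (x + t *\<^sub>R v))) t"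
    by (rule DERIV_isCont[OF integral_cube_bump_line_deriv[OF g r]])
  moreover have "bump_integral TYPE('n) r \<noteq> 0" using bump_integral_pos[OF r, where 'n='n] by simp
  ultimately show ?thesis unfolding mollify_def by (rule isCont_divide[OF _ continuous_const])
qed

section \<open>Averages over segments and the smooth Poincare inequality\<close>

lemma nn_integral_lborel_scale:
  fixes F :: "real^'n \<Rightarrow> ennreal"
  assumes [measurable]: "F \<in> borel_measurable borel" and c: "1 / 2 \<le> c"
  shows "(\<integral>\<^sup>+x. F (b + c *\<^sub>R x) \<partial>lborel) \<le> 2 ^ CARD('n) * (\<integral>\<^sup>+x. F x \<partial>lborel)"
proof -
  let ?n = "CARD('n)"
  have c0: "c \<noteq> 0" using c by simp
  have "(\<integral>\<^sup>+x. F x \<partial>lborel) = (\<integral>\<^sup>+x. F x \<partial>density (distr lborel borel (\<lambda>x. b + c *\<^sub>R x)) (\<lambda>_. ennreal (\<bar>c\<bar> ^ ?n)))"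
    using lborel_affine[OF c0, of b] by simp
  also have "\<dots> = ennreal (\<bar>c\<bar> ^ ?n) * (\<integral>\<^sup>+x. F (b + c *\<^sub>R x) \<partial>lborel)"
    by (simp add: nn_integral_density nn_integral_distr nn_integral_cmult)
  finally have e: "(\<integral>\<^sup>+x. F x \<partial>lborel) = ennreal (\<bar>c\<bar> ^ ?n) * (\<integral>\<^sup>+x. F (b + c *\<^sub>R x) \<partial>lborel)" .
  have "1 \<le> 2 ^ ?n * \<bar>c\<bar> ^ ?n"
    using c one_le_power[of "2 * c" ?n] by (simp add: power_mult_distrib)
  then have "ennreal 1 \<le> ennreal (2 ^ ?n * \<bar>c\<bar> ^ ?n)" by (rule ennreal_leI)
  then have "1 * (\<integral>\<^sup>+x. F (b + c *\<^sub>R x) \<partial>lborel) \<le> (2 ^ ?n * ennreal (\<bar>c\<bar> ^ ?n)) * (\<integral>\<^sup>+x. F (b + c *\<^sub>R x) \<partial>lborel)"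
    by (intro mult_right_mono) (auto simp: ennreal_mult ennreal_power[symmetric])
  then show ?thesis unfolding e by (simp add: mult.assoc)
qed

text \<open>For fixed \<open>t\<close> the point \<open>x + t *\<^sub>R (y - x)\<close> is an affine
  function of \<open>y\<close> with factor \<open>t\<close> and of \<open>x\<close> with factor
  \<open>1 - t\<close>. Integrating first in whichever variable has the factor at least 1/2 keeps
  the Jacobian below \<open>2 ^ n\<close>, so no singularity at the end points of \<open>t\<close>
  appears.\<close>

lemma nn_integral_segments_le:
  fixes \<gamma> :: "real^'n \<Rightarrow> ennreal"
  assumes \<gamma>[measurable]: "\<gamma> \<in> borel_measurable borel" and Q: "Q \<in> sets borel" "convex Q"
  shows "(\<integral>\<^sup>+x\<in>Q. (\<integral>\<^sup>+y\<in>Q. (\<integral>\<^sup>+t\<in>{0..1}. \<gamma> (x + t *\<^sub>R (y - x)) \<partial>lborel) \<partial>lborel) \<partial>lborel)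
    \<le> 2 ^ CARD('n) * emeasure lborel Q * (\<integral>\<^sup>+z\<in>Q. \<gamma> z \<partial>lborel)"
proof -
  note Q(1)[measurable]
  let ?C = "2 ^ CARD('n) * (\<integral>\<^sup>+z\<in>Q. \<gamma> z \<partial>lborel)"
  have far: "(\<integral>\<^sup>+x\<in>Q. \<gamma> (b + c *\<^sub>R x) \<partial>lborel) \<le> ?C"
    if c: "1 / 2 \<le> c" and b: "\<And>x. x \<in> Q \<Longrightarrow> b + c *\<^sub>R x \<in> Q" for b c
  proof -
    have "(\<integral>\<^sup>+x\<in>Q. \<gamma> (b + c *\<^sub>R x) \<partial>lborel) \<le> (\<integral>\<^sup>+x. \<gamma> (b + c *\<^sub>R x) * indicator Q (b + c *\<^sub>R x) \<partial>lborel)"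
      using b by (intro nn_integral_mono) (auto simp: indicator_def)
    also have "\<dots> \<le> ?C"
      by (rule nn_integral_lborel_scale[OF _ c, of "\<lambda>z. \<gamma> z * indicator Q z"]) measurable
    finally show ?thesis .
  qed
  have slice: "(\<integral>\<^sup>+x\<in>Q. (\<integral>\<^sup>+y\<in>Q. \<gamma> (x + t *\<^sub>R (y - x)) \<partial>lborel) \<partial>lborel) \<le> ?C * emeasure lborel Q"
    if t: "t \<in> {0..1}" for t
  proof (cases "1 / 2 \<le> t")
    case True
    have "(\<integral>\<^sup>+x\<in>Q. (\<integral>\<^sup>+y\<in>Q. \<gamma> (x + t *\<^sub>R (y - x)) \<partial>lborel) \<partial>lborel) \<le> (\<integral>\<^sup>+x\<in>Q. ?C \<partial>lborel)"
    proof (rule nn_integral_mono)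
      fix x
      have "(\<integral>\<^sup>+y\<in>Q. \<gamma> ((1 - t) *\<^sub>R x + t *\<^sub>R y) \<partial>lborel) \<le> ?C" if "x \<in> Q"
        using t convexD[OF Q(2) that] by (intro far[OF True]) auto
      moreover have "(1 - t) *\<^sub>R x + t *\<^sub>R y = x + t *\<^sub>R (y - x)" for y by (simp add: algebra_simps)
      ultimately show "(\<integral>\<^sup>+y\<in>Q. \<gamma> (x + t *\<^sub>R (y - x)) \<partial>lborel) * indicator Q x \<le> ?C * indicator Q x"
        by (auto simp: indicator_def)
    qed
    then show ?thesis by (simp add: nn_integral_cmult)
  next
    case False
    have "(\<integral>\<^sup>+x\<in>Q. (\<integral>\<^sup>+y\<in>Q. \<gamma> (x + t *\<^sub>R (y - x)) \<partial>lborel) \<partial>lborel)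
      = (\<integral>\<^sup>+x. (\<integral>\<^sup>+y. \<gamma> (x + t *\<^sub>R (y - x)) * indicator Q y * indicator Q x \<partial>lborel) \<partial>lborel)"
      by (simp add: nn_integral_multc)
    also have "\<dots> = (\<integral>\<^sup>+y. (\<integral>\<^sup>+x. \<gamma> (x + t *\<^sub>R (y - x)) * indicator Q y * indicator Q x \<partial>lborel) \<partial>lborel)"
      by (rule lborel_pair.Fubini') measurable
    also have "\<dots> \<le> (\<integral>\<^sup>+y\<in>Q. ?C \<partial>lborel)"
    proof (rule nn_integral_mono)
      fix y
      have "(\<integral>\<^sup>+x\<in>Q. \<gamma> (t *\<^sub>R y + (1 - t) *\<^sub>R x) \<partial>lborel) \<le> ?C" if "y \<in> Q"
        using t False convexD[OF Q(2) that] by (intro far) auto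
      moreover have "t *\<^sub>R y + (1 - t) *\<^sub>R x = x + t *\<^sub>R (y - x)" for x by (simp add: algebra_simps)
      ultimately show "(\<integral>\<^sup>+x. \<gamma> (x + t *\<^sub>R (y - x)) * indicator Q y * indicator Q x \<partial>lborel) \<le> ?C * indicator Q y"
        by (auto simp: indicator_def)
    qed
    finally show ?thesis by (simp add: nn_integral_cmult)
  qed
  let ?g = "\<lambda>x y t. \<gamma> (x + t *\<^sub>R (y - x)) * indicator {0..1} t * indicator Q y * indicator Q x"
  have "(\<integral>\<^sup>+x\<in>Q. (\<integral>\<^sup>+y\<in>Q. (\<integral>\<^sup>+t\<in>{0..1}. \<gamma> (x + t *\<^sub>R (y - x)) \<partial>lborel) \<partial>lborel) \<partial>lborel)
    = (\<integral>\<^sup>+x. (\<integral>\<^sup>+y. (\<integral>\<^sup>+t. ?g x y t \<partial>lborel) \<partial>lborel) \<partial>lborel)"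
    by (simp add: nn_integral_multc)
  also have "\<dots> = (\<integral>\<^sup>+x. (\<integral>\<^sup>+t. (\<integral>\<^sup>+y. ?g x y t \<partial>lborel) \<partial>lborel) \<partial>lborel)"
    by (intro nn_integral_cong lborel_pair.Fubini'[symmetric]) measurable
  also have "\<dots> = (\<integral>\<^sup>+t. (\<integral>\<^sup>+x. (\<integral>\<^sup>+y. ?g x y t \<partial>lborel) \<partial>lborel) \<partial>lborel)"
    by (rule lborel_pair.Fubini') measurable
  also have "\<dots> = (\<integral>\<^sup>+t\<in>{0..1}. (\<integral>\<^sup>+x\<in>Q. (\<integral>\<^sup>+y\<in>Q. \<gamma> (x + t *\<^sub>R (y - x)) \<partial>lborel) \<partial>lborel) \<partial>lborel)"
    by (intro nn_integral_cong) (auto simp: indicator_def nn_integral_multc)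
  also have "\<dots> \<le> (\<integral>\<^sup>+t\<in>{0..1::real}. ?C * emeasure lborel Q \<partial>lborel)"
    using slice by (intro nn_integral_mono) (auto simp: indicator_def)
  also have "\<dots> = ?C * emeasure lborel Q" by (simp add: nn_integral_cmult)
  finally show ?thesis by (simp add: mult_ac)
qed

text \<open>The fundamental theorem of calculus on the segment from \<open>x\<close> to
  \<open>y\<close>, whose length is at most \<open>n * l\<close>, is averaged by
  \<open>nn_integral_segments_le\<close>. The outer function \<open>H\<close> is built in already
  here. The factor \<open>h (u z)\<close> is kept on the right because it localises the gradient to
  the values that a truncation sees.\<close>

lemma poincare_smooth:
  fixes u :: "real^'n \<Rightarrow> real" and G :: "'n \<Rightarrow> real^'n \<Rightarrow> real" and l :: real
  assumes du: "\<And>x v t. ((\<lambda>t. u (x + t *\<^sub>R v)) has_real_derivative (\<Sum>i\<in>UNIV. v $ i * G i (x + t *\<^sub>R v))) (at t)"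
    and cG: "\<And>i x v t. isCont (\<lambda>t. G i (x + t *\<^sub>R v)) t"
    and [measurable]: "u \<in> borel_measurable borel" "\<And>i. G i \<in> borel_measurable borel"
    and H: "\<And>s. (H has_real_derivative h s) (at s)" "continuous_on UNIV h" and l: "0 < l"
  shows "(\<integral>\<^sup>+x\<in>cbox a (a + vec l). (\<integral>\<^sup>+y\<in>cbox a (a + vec l). ennreal \<bar>H (u y) - H (u x)\<bar> \<partial>lborel) \<partial>lborel)
    \<le> ennreal (2 ^ CARD('n) * CARD('n) * l * l ^ CARD('n))
      * (\<integral>\<^sup>+z\<in>cbox a (a + vec l). ennreal (\<bar>h (u z)\<bar> * norm (\<chi> i. G i z)) \<partial>lborel)"
proof -
  let ?Q = "cbox a (a + vec l)" and ?n = "CARD('n)"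
  have [measurable]: "h \<in> borel_measurable borel" by (rule borel_measurable_continuous_onI[OF H(2)])
  have [measurable]: "(\<lambda>z. norm (\<chi> i. G i z)) \<in> borel_measurable borel"
    unfolding norm_vec_def L2_set_def vec_lambda_beta by measurable
  define \<gamma> where "\<gamma> z = ennreal (\<bar>h (u z)\<bar> * norm (\<chi> i. G i z))" for z
  have [measurable]: "\<gamma> \<in> borel_measurable borel" unfolding \<gamma>_def by measurable
  have seg: "ennreal \<bar>H (u y) - H (u x)\<bar> \<le> ennreal (?n * l) * (\<integral>\<^sup>+t\<in>{0..1}. \<gamma> (x + t *\<^sub>R (y - x)) \<partial>lborel)"
    if xy: "x \<in> ?Q" "y \<in> ?Q" for x y
  proof -
    define v where "v = y - x"
    have v: "norm v \<le> ?n * l"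
    proof -
      have "norm v \<le> (\<Sum>i\<in>UNIV. \<bar>v $ i\<bar>)" by (rule norm_le_l1_cart)
      also have "\<dots> \<le> (\<Sum>i\<in>(UNIV::'n set). l)"
      proof (rule sum_mono)
        fix i
        have "a $ i \<le> x $ i" "x $ i \<le> a $ i + l" "a $ i \<le> y $ i" "y $ i \<le> a $ i + l"
          using xy by (auto simp: mem_box_cart)
        then show "\<bar>v $ i\<bar> \<le> l" by (simp add: v_def abs_le_iff)
      qed
      finally show ?thesis by simp
    qed
    let ?d = "\<lambda>t. h (u (x + t *\<^sub>R v)) * (\<Sum>i\<in>UNIV. v $ i * G i (x + t *\<^sub>R v))"
    have d: "((\<lambda>t. H (u (x + t *\<^sub>R v))) has_real_derivative ?d t) (at t)" for t
      by (rule DERIV_chain2[OF H(1) du])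
    have cd: "isCont ?d t" for t
    proof -
      have "isCont (\<lambda>t. h (u (x + t *\<^sub>R v))) t"
        using DERIV_isCont[OF du] H(2)
        by (intro isCont_o2[of t "\<lambda>t. u (x + t *\<^sub>R v)" h]) (auto simp: continuous_on_eq_continuous_at)
      then show ?thesis by (intro continuous_intros cG)
    qed
    have hb: "has_bochner_integral lborel (\<lambda>t. ?d t * indicator {0..1} t) (H (u (x + 1 *\<^sub>R v)) - H (u (x + 0 *\<^sub>R v)))"
      by (rule has_bochner_integral_FTC_Icc_real) (use d cd in auto)
    then have "ennreal \<bar>H (u y) - H (u x)\<bar> = ennreal (norm (LINT t|lborel. ?d t * indicator {0..1} t))"
      by (simp add: has_bochner_integral_integral_eq v_def)
    also have "\<dots> \<le> (\<integral>\<^sup>+t. ennreal (norm (?d t * indicator {0..1} t)) \<partial>lborel)"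
      using hb by (intro integral_norm_bound_ennreal) (auto simp: has_bochner_integral_iff)
    also have "\<dots> \<le> (\<integral>\<^sup>+t. ennreal (?n * l) * (\<gamma> (x + t *\<^sub>R v) * indicator {0..1} t) \<partial>lborel)"
    proof (rule nn_integral_mono)
      fix t :: real
      let ?g = "\<chi> i. G i (x + t *\<^sub>R v)"
      have "\<bar>\<Sum>i\<in>UNIV. v $ i * G i (x + t *\<^sub>R v)\<bar> = \<bar>v \<bullet> ?g\<bar>" by (simp add: inner_vec_def)
      also have "\<dots> \<le> norm v * norm ?g" by (rule Cauchy_Schwarz_ineq2)
      also have "\<dots> \<le> ?n * l * norm ?g" by (intro mult_right_mono v) simp
      finally have "\<bar>h (u (x + t *\<^sub>R v))\<bar> * \<bar>\<Sum>i\<in>UNIV. v $ i * G i (x + t *\<^sub>R v)\<bar>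
          \<le> \<bar>h (u (x + t *\<^sub>R v))\<bar> * (?n * l * norm ?g)" by (rule mult_left_mono) simp
      then have "ennreal (norm (?d t)) \<le> ennreal ((?n * l) * (\<bar>h (u (x + t *\<^sub>R v))\<bar> * norm ?g))"
        by (intro ennreal_leI) (simp add: abs_mult mult_ac)
      also have "\<dots> = ennreal (?n * l) * \<gamma> (x + t *\<^sub>R v)"
        unfolding \<gamma>_def using l by (subst ennreal_mult) auto
      finally show "ennreal (norm (?d t * indicator {0..1} t)) \<le> ennreal (?n * l) * (\<gamma> (x + t *\<^sub>R v) * indicator {0..1} t)"
        by (auto simp: indicator_def)
    qed
    also have "\<dots> = ennreal (?n * l) * (\<integral>\<^sup>+t\<in>{0..1}. \<gamma> (x + t *\<^sub>R v) \<partial>lborel)"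
      by (rule nn_integral_cmult) measurable
    finally show ?thesis by (simp add: v_def)
  qed
  have "(\<integral>\<^sup>+x\<in>?Q. (\<integral>\<^sup>+y\<in>?Q. ennreal \<bar>H (u y) - H (u x)\<bar> \<partial>lborel) \<partial>lborel)
    \<le> (\<integral>\<^sup>+x\<in>?Q. (\<integral>\<^sup>+y\<in>?Q. ennreal (?n * l) * (\<integral>\<^sup>+t\<in>{0..1}. \<gamma> (x + t *\<^sub>R (y - x)) \<partial>lborel) \<partial>lborel) \<partial>lborel)"
    using seg by (intro nn_integral_mono) (auto simp: indicator_def intro!: nn_integral_mono)
  also have "\<dots> = ennreal (?n * l) * (\<integral>\<^sup>+x\<in>?Q. (\<integral>\<^sup>+y\<in>?Q. (\<integral>\<^sup>+t\<in>{0..1}. \<gamma> (x + t *\<^sub>R (y - x)) \<partial>lborel) \<partial>lborel) \<partial>lborel)"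
    by (simp add: nn_integral_cmult mult.assoc)
  also have "\<dots> \<le> ennreal (?n * l) * (2 ^ ?n * emeasure lborel ?Q * (\<integral>\<^sup>+z\<in>?Q. \<gamma> z \<partial>lborel))"
    by (intro mult_left_mono nn_integral_segments_le) auto
  also have "\<dots> = ennreal (2 ^ ?n * ?n * l * l ^ ?n) * (\<integral>\<^sup>+z\<in>?Q. \<gamma> z \<partial>lborel)"
  proof -
    have "ennreal (2 ^ ?n * ?n * l * l ^ ?n) = ennreal (?n * l) * (ennreal (2 ^ ?n) * ennreal (l ^ ?n))"
      using l by (simp add: ennreal_mult[symmetric] mult_ac)
    then show ?thesis
      using l by (simp add: emeasure_lborel_cbox_vec ennreal_power[symmetric] mult.assoc)
  qed
  finally show ?thesis unfolding \<gamma>_def .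
qed

lemma mollify_L1:
  fixes f :: "real^'n \<Rightarrow> real"
  assumes f: "locally_integrable_borel f" and r: "r \<longlonglongrightarrow> 0" "\<And>k. 0 < r k"
  shows "(\<lambda>k. \<integral>\<^sup>+x\<in>cbox a b. ennreal \<bar>mollify f (r k) x - f x\<bar> \<partial>lborel) \<longlonglongrightarrow> 0"
proof -
  have [measurable]: "f \<in> borel_measurable borel" using f by measurable
  let ?M = "ennreal ((2 * exp (16 / 3)) ^ CARD('n))"
  have "(\<lambda>k. ?M * (\<integral>\<^sup>+x\<in>cbox a b. mean_osc f (r k) x \<partial>lborel)) \<longlonglongrightarrow> ?M * 0"
    by (rule ennreal_tendsto_cmult[OF _ mean_osc_tendsto[OF f r]]) simp
  then have lim: "(\<lambda>k. ?M * (\<integral>\<^sup>+x\<in>cbox a b. mean_osc f (r k) x \<partial>lborel)) \<longlonglongrightarrow> 0" by simp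
  have "(\<integral>\<^sup>+x\<in>cbox a b. ennreal \<bar>mollify f (r k) x - f x\<bar> \<partial>lborel)
      \<le> ?M * (\<integral>\<^sup>+x\<in>cbox a b. mean_osc f (r k) x \<partial>lborel)" for k
  proof -
    have "(\<integral>\<^sup>+x\<in>cbox a b. ennreal \<bar>mollify f (r k) x - f x\<bar> \<partial>lborel)
      \<le> (\<integral>\<^sup>+x. ?M * (mean_osc f (r k) x * indicator (cbox a b) x) \<partial>lborel)"
      using mollify_diff_le[OF f r(2)] by (intro nn_integral_mono) (auto simp: indicator_def)
    also have "\<dots> = ?M * (\<integral>\<^sup>+x\<in>cbox a b. mean_osc f (r k) x \<partial>lborel)"
      by (rule nn_integral_cmult) measurable
    finally show ?thesis .
  qed
  then show ?thesis
    by (intro tendsto_sandwich[OF always_eventually always_eventually tendsto_const lim]) auto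
qed

text \<open>The left side passes to the limit because \<open>H\<close> is Lipschitz. On the right,
  \<open>h\<close> is only bounded and continuous: the mollified gradient is first replaced by
  \<open>g\<close>, at the cost \<open>Bh * \<eta> k\<close>, and then \<open>h (u k z)\<close>
  converges by domination. The latter needs almost everywhere convergence of \<open>u k\<close>,
  hence the subsequence.\<close>

lemma poincare_composed:
  fixes f :: "real^'n \<Rightarrow> real" and g :: "'n \<Rightarrow> real^'n \<Rightarrow> real" and l :: real
  assumes fg: "weak_gradient_borel f g"
    and H: "\<And>s. (H has_real_derivative h s) (at s)" "continuous_on UNIV h" and Bh: "\<And>s. \<bar>h s\<bar> \<le> Bh" and l: "0 < l"
  shows "(\<integral>\<^sup>+x\<in>cbox a (a + vec l). (\<integral>\<^sup>+y\<in>cbox a (a + vec l). ennreal \<bar>H (f y) - H (f x)\<bar> \<partial>lborel) \<partial>lborel)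
    \<le> ennreal (2 ^ CARD('n) * CARD('n) * l * l ^ CARD('n))
      * (\<integral>\<^sup>+z\<in>cbox a (a + vec l). ennreal (\<bar>h (f z)\<bar> * norm (\<chi> i. g i z)) \<partial>lborel)"
proof -
  let ?Q = "cbox a (a + vec l)" and ?n = "CARD('n)"
  let ?C = "ennreal (2 ^ ?n * ?n * l * l ^ ?n)"
  have f: "locally_integrable_borel f" and g: "\<And>i. locally_integrable_borel (g i)"
    using fg by (auto simp: weak_gradient_borel_def)
  have [measurable]: "f \<in> borel_measurable borel" "\<And>i. g i \<in> borel_measurable borel"
    using f g by (auto dest: locally_integrable_borel_measurable)
  have [measurable]: "h \<in> borel_measurable borel" by (rule borel_measurable_continuous_onI[OF H(2)])
  have [measurable]: "H \<in> borel_measurable borel"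
    by (intro borel_measurable_continuous_onI continuous_at_imp_continuous_on ballI DERIV_isCont[OF H(1)])
  have Bh0: "0 \<le> Bh" using Bh[of 0] by linarith
  have Hlip: "\<bar>H s - H s'\<bar> \<le> Bh * \<bar>s - s'\<bar>" for s s'
    using field_differentiable_bound[of UNIV H h Bh s s'] H(1) Bh by auto
  define r where "r k = 1 / real (Suc k)" for k
  have r: "r \<longlonglongrightarrow> 0" "\<And>k. 0 < r k"
    unfolding r_def using LIMSEQ_inverse_real_of_nat by (auto simp: inverse_eq_divide)
  obtain s :: "nat \<Rightarrow> nat" where s: "strict_mono s"
    "AE x in lborel. x \<in> ?Q \<longrightarrow> (\<lambda>k. mean_osc f (r (s k)) x) \<longlonglongrightarrow> 0"
    by (rule mean_osc_AE_subseq[OF f r])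
  define u where "u k = mollify f (r (s k))" for k
  define G where "G k i = mollify (g i) (r (s k))" for k i
  have [measurable]: "u k \<in> borel_measurable borel" "G k i \<in> borel_measurable borel" for k i
    unfolding u_def G_def by measurable
  have norm_meas: "(\<lambda>z. norm (\<chi> i. F i z)) \<in> borel_measurable borel"
    if "\<And>i. F i \<in> borel_measurable borel" for F :: "'n \<Rightarrow> real^'n \<Rightarrow> real"
    using that unfolding norm_vec_def L2_set_def vec_lambda_beta by measurable
  note norm_meas[of g, measurable] norm_meas[of "G _", measurable]
  have rs: "(\<lambda>k. r (s k)) \<longlonglongrightarrow> 0" "\<And>k. 0 < r (s k)"
    using LIMSEQ_subseq_LIMSEQ[OF r(1) s(1)] r(2) by (auto simp: comp_def)
  define \<epsilon> where "\<epsilon> k = (\<integral>\<^sup>+x\<in>?Q. ennreal \<bar>u k x - f x\<bar> \<partial>lborel)" for k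
  define \<eta> where "\<eta> k = (\<Sum>i\<in>UNIV. \<integral>\<^sup>+x\<in>?Q. ennreal \<bar>G k i x - g i x\<bar> \<partial>lborel)" for k
  define X where "X k = (\<integral>\<^sup>+z\<in>?Q. ennreal (\<bar>h (u k z)\<bar> * norm (\<chi> i. g i z)) \<partial>lborel)" for k
  define Y where "Y = (\<integral>\<^sup>+z\<in>?Q. ennreal (\<bar>h (f z)\<bar> * norm (\<chi> i. g i z)) \<partial>lborel)"
  have \<epsilon>: "\<epsilon> \<longlonglongrightarrow> 0" unfolding \<epsilon>_def u_def by (rule mollify_L1[OF f rs])
  have "(\<lambda>k. \<Sum>i\<in>UNIV. \<integral>\<^sup>+x\<in>?Q. ennreal \<bar>G k i x - g i x\<bar> \<partial>lborel) \<longlonglongrightarrow> (\<Sum>i\<in>(UNIV::'n set). 0)"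
    unfolding G_def by (intro tendsto_sum mollify_L1[OF g rs])
  then have \<eta>: "\<eta> \<longlonglongrightarrow> 0" unfolding \<eta>_def by simp
  have ae: "AE x in lborel. x \<in> ?Q \<longrightarrow> (\<lambda>k. u k x) \<longlonglongrightarrow> f x"
    using s(2)
  proof eventually_elim
    case (elim x)
    let ?M = "ennreal ((2 * exp (16 / 3)) ^ ?n)"
    show ?case
    proof
      assume "x \<in> ?Q"
      with elim have "(\<lambda>k. ?M * mean_osc f (r (s k)) x) \<longlonglongrightarrow> ?M * 0"
        by (intro ennreal_tendsto_cmult) auto
      then have lim: "(\<lambda>k. ?M * mean_osc f (r (s k)) x) \<longlonglongrightarrow> 0" by simp
      show "(\<lambda>k. u k x) \<longlonglongrightarrow> f x"
      proof (rule tendstoI)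
        fix e :: real assume e: "0 < e"
        then have "\<forall>\<^sub>F k in sequentially. ?M * mean_osc f (r (s k)) x < ennreal e"
          by (intro order_tendstoD(2)[OF lim]) simp
        then show "\<forall>\<^sub>F k in sequentially. dist (u k x) (f x) < e"
        proof eventually_elim
          case (elim k)
          have "ennreal \<bar>u k x - f x\<bar> < ennreal e"
            using mollify_diff_le[OF f rs(2), of k x] elim unfolding u_def by (rule le_less_trans)
          then show ?case by (simp add: ennreal_less_iff dist_real_def)
        qed
      qed
    qed
  qed
  have gint: "(\<integral>\<^sup>+z\<in>?Q. ennreal (norm (\<chi> i. g i z)) \<partial>lborel) < \<infinity>"
  proof -
    have "(\<integral>\<^sup>+z\<in>?Q. ennreal (norm (\<chi> i. g i z)) \<partial>lborel)
      \<le> (\<integral>\<^sup>+z. (\<Sum>i\<in>UNIV. ennreal (norm (indicator ?Q z *\<^sub>R g i z))) \<partial>lborel)"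
    proof (rule nn_integral_mono)
      fix z
      have "ennreal (norm (\<chi> i. g i z)) \<le> ennreal (\<Sum>i\<in>UNIV. \<bar>g i z\<bar>)"
        using norm_le_l1_cart[of "\<chi> i. g i z"] by (intro ennreal_leI) simp
      then show "ennreal (norm (\<chi> i. g i z)) * indicator ?Q z \<le> (\<Sum>i\<in>UNIV. ennreal (norm (indicator ?Q z *\<^sub>R g i z)))"
        by (simp add: indicator_def)
    qed
    also have "\<dots> = (\<Sum>i\<in>UNIV. \<integral>\<^sup>+z. ennreal (norm (indicator ?Q z *\<^sub>R g i z)) \<partial>lborel)"
      by (rule nn_integral_sum) measurable
    also have "\<dots> < \<infinity>"
      using g unfolding locally_integrable_borel_def set_integrable_def integrable_iff_bounded
      by (auto simp: less_top)
    finally show ?thesis .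
  qed
  have X: "X \<longlonglongrightarrow> Y"
    unfolding X_def Y_def
  proof (rule nn_integral_dominated_convergence[where w="\<lambda>z. ennreal Bh * (ennreal (norm (\<chi> i. g i z)) * indicator ?Q z)"])
    show "(\<integral>\<^sup>+z. ennreal Bh * (ennreal (norm (\<chi> i. g i z)) * indicator ?Q z) \<partial>lborel) < \<infinity>"
      using gint by (simp add: nn_integral_cmult ennreal_mult_less_top)
    show "AE z in lborel. ennreal (\<bar>h (u k z)\<bar> * norm (\<chi> i. g i z)) * indicator ?Q z
        \<le> ennreal Bh * (ennreal (norm (\<chi> i. g i z)) * indicator ?Q z)" for k
    proof (rule AE_I2)
      fix z
      have "ennreal (\<bar>h (u k z)\<bar> * norm (\<chi> i. g i z)) \<le> ennreal (Bh * norm (\<chi> i. g i z))"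
        by (intro ennreal_leI mult_right_mono Bh) simp
      then show "ennreal (\<bar>h (u k z)\<bar> * norm (\<chi> i. g i z)) * indicator ?Q z
        \<le> ennreal Bh * (ennreal (norm (\<chi> i. g i z)) * indicator ?Q z)"
        using Bh0 by (simp add: indicator_def ennreal_mult)
    qed
    show "AE z in lborel. (\<lambda>k. ennreal (\<bar>h (u k z)\<bar> * norm (\<chi> i. g i z)) * indicator ?Q z)
        \<longlonglongrightarrow> ennreal (\<bar>h (f z)\<bar> * norm (\<chi> i. g i z)) * indicator ?Q z"
      using ae
    proof eventually_elim
      case (elim z)
      show ?case
      proof (cases "z \<in> ?Q")
        case True
        have "isCont h (f z)" using H(2) by (simp add: continuous_on_eq_continuous_at)
        then have "(\<lambda>k. h (u k z)) \<longlonglongrightarrow> h (f z)"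
          by (rule isCont_tendsto_compose) (use elim True in simp)
        then have "(\<lambda>k. ennreal (\<bar>h (u k z)\<bar> * norm (\<chi> i. g i z))) \<longlonglongrightarrow> ennreal (\<bar>h (f z)\<bar> * norm (\<chi> i. g i z))"
          by (intro tendsto_ennrealI tendsto_mult_right tendsto_rabs)
        with True show ?thesis by simp
      qed simp
    qed
  qed measurable
  let ?L = "\<lambda>u. (\<integral>\<^sup>+x\<in>?Q. (\<integral>\<^sup>+y\<in>?Q. ennreal \<bar>H (u y) - H (u x)\<bar> \<partial>lborel) \<partial>lborel)"
  let ?V = "ennreal (l ^ ?n)"
  have V: "emeasure lborel ?Q = ?V" using l by (simp add: emeasure_lborel_cbox_vec)
  \<comment> \<open>Replacing \<open>f\<close> by \<open>u k\<close> costs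
    \<open>Bh * \<epsilon> k\<close> in the variable \<open>x\<close> and again in \<open>y\<close>,
    each time multiplied by the volume from the other variable; the term with
    \<open>\<eta> k\<close> is the error of the gradients.\<close>
  have bound: "?L f \<le> ?C * (ennreal Bh * \<eta> k + X k) + (ennreal Bh * \<epsilon> k * ?V + ?V * (ennreal Bh * \<epsilon> k))" for k
  proof -
    let ?A = "\<lambda>x. ennreal \<bar>u k x - f x\<bar> * indicator ?Q x"
    have "?L f \<le> (\<integral>\<^sup>+x. (\<integral>\<^sup>+y. (ennreal \<bar>H (u k y) - H (u k x)\<bar> * indicator ?Q y * indicator ?Q x
        + (ennreal Bh * ?A x * indicator ?Q y + indicator ?Q x * (ennreal Bh * ?A y))) \<partial>lborel) \<partial>lborel)"
    proof -
      have "ennreal \<bar>H (f y) - H (f x)\<bar> * indicator ?Q y * indicator ?Q x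
        \<le> ennreal \<bar>H (u k y) - H (u k x)\<bar> * indicator ?Q y * indicator ?Q x
        + (ennreal Bh * ?A x * indicator ?Q y + indicator ?Q x * (ennreal Bh * ?A y))" for x y
      proof -
        have "\<bar>H (f y) - H (f x)\<bar> \<le> \<bar>H (u k y) - H (u k x)\<bar> + (Bh * \<bar>u k x - f x\<bar> + Bh * \<bar>u k y - f y\<bar>)"
          using Hlip[of "u k x" "f x"] Hlip[of "u k y" "f y"] by linarith
        then have "ennreal \<bar>H (f y) - H (f x)\<bar> \<le> ennreal (\<bar>H (u k y) - H (u k x)\<bar> + (Bh * \<bar>u k x - f x\<bar> + Bh * \<bar>u k y - f y\<bar>))"
          by (rule ennreal_leI)
        also have "\<dots> = ennreal \<bar>H (u k y) - H (u k x)\<bar> + (ennreal Bh * ennreal \<bar>u k x - f x\<bar> + ennreal Bh * ennreal \<bar>u k y - f y\<bar>)"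
          using Bh0 by (simp add: ennreal_plus ennreal_mult)
        finally show ?thesis by (simp add: indicator_def)
      qed
      then show ?thesis
        by (subst nn_integral_multc[symmetric]) (auto intro!: nn_integral_mono)
    qed
    also have "\<dots> = (\<integral>\<^sup>+x. ((\<integral>\<^sup>+y\<in>?Q. ennreal \<bar>H (u k y) - H (u k x)\<bar> \<partial>lborel) * indicator ?Q x
        + (ennreal Bh * ?A x * ?V + indicator ?Q x * (ennreal Bh * \<epsilon> k))) \<partial>lborel)"
      by (simp add: nn_integral_add nn_integral_cmult nn_integral_multc V \<epsilon>_def)
    also have "\<dots> = ?L (u k) + (ennreal Bh * \<epsilon> k * ?V + ?V * (ennreal Bh * \<epsilon> k))"
      by (simp add: nn_integral_add nn_integral_cmult nn_integral_multc V \<epsilon>_def)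
    also have "?L (u k) \<le> ?C * (\<integral>\<^sup>+z\<in>?Q. ennreal (\<bar>h (u k z)\<bar> * norm (\<chi> i. G k i z)) \<partial>lborel)"
      by (rule poincare_smooth)
         (use mollify_line_deriv[OF fg rs(2)] mollify_line_continuous[OF g rs(2)] H l in \<open>auto simp: u_def G_def\<close>)
    also have "(\<integral>\<^sup>+z\<in>?Q. ennreal (\<bar>h (u k z)\<bar> * norm (\<chi> i. G k i z)) \<partial>lborel) \<le> ennreal Bh * \<eta> k + X k"
    proof -
      have "(\<integral>\<^sup>+z\<in>?Q. ennreal (\<bar>h (u k z)\<bar> * norm (\<chi> i. G k i z)) \<partial>lborel)
        \<le> (\<integral>\<^sup>+z. (ennreal Bh * (\<Sum>i\<in>UNIV. ennreal \<bar>G k i z - g i z\<bar> * indicator ?Q z)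
            + ennreal (\<bar>h (u k z)\<bar> * norm (\<chi> i. g i z)) * indicator ?Q z) \<partial>lborel)"
      proof (rule nn_integral_mono)
        fix z
        have "norm (\<chi> i. G k i z) \<le> norm ((\<chi> i. G k i z) - (\<chi> i. g i z)) + norm (\<chi> i. g i z)"
          by (metis diff_add_cancel norm_triangle_ineq)
        moreover have "norm ((\<chi> i. G k i z) - (\<chi> i. g i z)) \<le> (\<Sum>i\<in>UNIV. \<bar>G k i z - g i z\<bar>)"
          using norm_le_l1_cart[of "(\<chi> i. G k i z) - (\<chi> i. g i z)"] by simp
        ultimately have "norm (\<chi> i. G k i z) \<le> (\<Sum>i\<in>UNIV. \<bar>G k i z - g i z\<bar>) + norm (\<chi> i. g i z)" by linarith
        then have "\<bar>h (u k z)\<bar> * norm (\<chi> i. G k i z) \<le> \<bar>h (u k z)\<bar> * ((\<Sum>i\<in>UNIV. \<bar>G k i z - g i z\<bar>) + norm (\<chi> i. g i z))"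
          by (rule mult_left_mono) simp
        also have "\<dots> \<le> Bh * (\<Sum>i\<in>UNIV. \<bar>G k i z - g i z\<bar>) + \<bar>h (u k z)\<bar> * norm (\<chi> i. g i z)"
          unfolding distrib_left by (intro add_right_mono mult_right_mono Bh sum_nonneg) simp
        finally have "ennreal (\<bar>h (u k z)\<bar> * norm (\<chi> i. G k i z))
          \<le> ennreal (Bh * (\<Sum>i\<in>UNIV. \<bar>G k i z - g i z\<bar>) + \<bar>h (u k z)\<bar> * norm (\<chi> i. g i z))" by (rule ennreal_leI)
        also have "\<dots> = ennreal Bh * (\<Sum>i\<in>UNIV. ennreal \<bar>G k i z - g i z\<bar>) + ennreal (\<bar>h (u k z)\<bar> * norm (\<chi> i. g i z))"
          using Bh0 by (simp add: ennreal_plus ennreal_mult sum_nonneg)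
        finally show "ennreal (\<bar>h (u k z)\<bar> * norm (\<chi> i. G k i z)) * indicator ?Q z
            \<le> ennreal Bh * (\<Sum>i\<in>UNIV. ennreal \<bar>G k i z - g i z\<bar> * indicator ?Q z)
            + ennreal (\<bar>h (u k z)\<bar> * norm (\<chi> i. g i z)) * indicator ?Q z"
          by (simp add: indicator_def)
      qed
      also have "\<dots> = (\<integral>\<^sup>+z. ennreal Bh * (\<Sum>i\<in>UNIV. ennreal \<bar>G k i z - g i z\<bar> * indicator ?Q z) \<partial>lborel) + X k"
        unfolding X_def by (rule nn_integral_add) measurable
      also have "(\<integral>\<^sup>+z. ennreal Bh * (\<Sum>i\<in>UNIV. ennreal \<bar>G k i z - g i z\<bar> * indicator ?Q z) \<partial>lborel) = ennreal Bh * (\<integral>\<^sup>+z. (\<Sum>i\<in>UNIV. ennreal \<bar>G k i z - g i z\<bar> * indicator ?Q z) \<partial>lborel)"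
        by (rule nn_integral_cmult) measurable
      also have "(\<integral>\<^sup>+z. (\<Sum>i\<in>UNIV. ennreal \<bar>G k i z - g i z\<bar> * indicator ?Q z) \<partial>lborel) = \<eta> k"
        unfolding \<eta>_def by (rule nn_integral_sum) measurable
      finally show ?thesis .
    qed
    finally show ?thesis by (simp add: add_right_mono mult_left_mono)
  qed
  have cc: "ennreal Bh * e * ?V + ?V * (ennreal Bh * e) = (ennreal Bh * ?V) * e + (ennreal Bh * ?V) * e" for e
    by (simp add: mult_ac)
  have "(\<lambda>k. ?C * (ennreal Bh * \<eta> k + X k) + (ennreal Bh * \<epsilon> k * ?V + ?V * (ennreal Bh * \<epsilon> k)))
      \<longlonglongrightarrow> ?C * (ennreal Bh * 0 + Y) + (ennreal Bh * 0 * ?V + ?V * (ennreal Bh * 0))"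
    unfolding cc by (intro tendsto_add ennreal_tendsto_cmult tendsto_const \<eta> \<epsilon> X) (auto simp: ennreal_mult_less_top)
  then have "(\<lambda>k. ?C * (ennreal Bh * \<eta> k + X k) + (ennreal Bh * \<epsilon> k * ?V + ?V * (ennreal Bh * \<epsilon> k))) \<longlonglongrightarrow> ?C * Y"
    by simp
  then have "?L f \<le> ?C * Y" by (rule LIMSEQ_le_const) (use bound in blast)
  then show ?thesis by (simp add: Y_def)
qed

subsection \<open>Dyadic cubes\<close>

text \<open>Half-open, so that the children of a cube are disjoint and cover it exactly. The closed
  cubes of the statement differ from these by null sets.\<close>

definition hcube :: "real^'n \<Rightarrow> real \<Rightarrow> (real^'n) set" where
  "hcube a l = {x. \<forall>i. a $ i \<le> x $ i \<and> x $ i < a $ i + l}"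

text \<open>The \<open>2 ^ n\<close> children are indexed by the set \<open>B\<close> of coordinates
  in which the upper half is taken, so sums over children are sums over the type of coordinate
  sets.\<close>

definition subcorner :: "real^'n \<Rightarrow> real \<Rightarrow> 'n set \<Rightarrow> real^'n" where
  "subcorner a l B = a + (\<chi> i. if i \<in> B then l / 2 else 0)"

definition upper_half :: "real^'n \<Rightarrow> real \<Rightarrow> real^'n \<Rightarrow> 'n set" where
  "upper_half a l x = {i. a $ i + l / 2 \<le> x $ i}"

lemma hcube_measurable[measurable]: "hcube a l \<in> sets borel"
proof -
  have "hcube a l = (\<Inter>i\<in>UNIV. {x. a $ i \<le> x $ i} \<inter> {x. x $ i < a $ i + l})"
    by (auto simp: hcube_def)
  also have "\<dots> \<in> sets borel"
    by (intro sets.finite_INT sets.Int borel_closed borel_open closed_Collect_le open_Collect_less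
        continuous_intros) auto
  finally show ?thesis .
qed

lemma hcube_subcorner_iff:
  assumes "0 < l"
  shows "x \<in> hcube (subcorner a l B) (l / 2) \<longleftrightarrow> x \<in> hcube a l \<and> upper_half a l x = B"
proof -
  have "(\<forall>i. subcorner a l B $ i \<le> x $ i \<and> x $ i < subcorner a l B $ i + l / 2) \<longleftrightarrow>
    (\<forall>i. (a $ i \<le> x $ i \<and> x $ i < a $ i + l) \<and> (a $ i + l / 2 \<le> x $ i \<longleftrightarrow> i \<in> B))"
    using assms by (intro all_cong1) (auto simp: subcorner_def)
  then show ?thesis by (auto simp: hcube_def upper_half_def)
qed

lemma hcube_subcorner_subset: "0 < l \<Longrightarrow> hcube (subcorner a l B) (l / 2) \<subseteq> hcube a l"
  by (simp add: subset_iff hcube_subcorner_iff)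

lemma hcube_subset_cbox: "hcube a l \<subseteq> cbox a (a + vec l)"
  by (auto simp: hcube_def mem_box_cart less_imp_le)

lemma AE_hcube_iff_cbox:
  fixes a :: "real^'n"
  assumes "0 < l"
  shows "AE x in lborel. x \<in> hcube a l \<longleftrightarrow> x \<in> cbox a (a + vec l)"
proof -
  let ?c = "cbox a (a + vec l)" and ?b = "box a (a + vec l)"
  have "emeasure lborel (?c - ?b) = emeasure lborel ?c - emeasure lborel ?b"
    by (intro emeasure_Diff) (auto simp: emeasure_lborel_box_eq box_subset_cbox)
  also have "\<dots> = 0" by (auto simp: emeasure_lborel_cbox_eq emeasure_lborel_box_eq)
  finally have "?c - ?b \<in> null_sets lborel" by (auto simp: null_sets_def)
  then have "AE x in lborel. x \<notin> ?c - ?b" by (rule AE_not_in)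
  moreover have "?b \<subseteq> hcube a l" by (auto simp: hcube_def mem_box_cart less_imp_le)
  ultimately show ?thesis
    using hcube_subset_cbox[of a l] by (auto elim!: eventually_mono)
qed

lemma emeasure_hcube:
  fixes a :: "real^'n"
  assumes "0 < l"
  shows "emeasure lborel (hcube a l) = ennreal (l ^ CARD('n))"
proof -
  have "emeasure lborel (hcube a l) = emeasure lborel (cbox a (a + vec l))"
    by (rule emeasure_eq_AE[OF AE_hcube_iff_cbox[OF assms]]) auto
  then show ?thesis using assms by (simp add: emeasure_lborel_cbox_vec)
qed

lemma measure_hcube:
  fixes a :: "real^'n"
  shows "0 < l \<Longrightarrow> measure lborel (hcube a l) = l ^ CARD('n)"
  by (simp add: measure_def emeasure_hcube)

lemma indicator_hcube_split:
  assumes "0 < l"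
  shows "indicator (hcube a l) x
    = (\<Sum>B\<in>UNIV. indicator (hcube (subcorner a l B) (l / 2)) x :: 'a::semiring_1)"
proof -
  have "(\<Sum>B\<in>UNIV. indicator (hcube (subcorner a l B) (l / 2)) x)
    = (\<Sum>B\<in>UNIV. if B = upper_half a l x then indicator (hcube a l) x else (0::'a))"
    using hcube_subcorner_iff[OF assms, of x a] by (intro sum.cong) (auto simp: indicator_def)
  then show ?thesis by simp
qed

lemma nn_integral_hcube_split:
  fixes F :: "real^'n \<Rightarrow> ennreal"
  assumes [measurable]: "F \<in> borel_measurable borel" and l: "0 < l"
  shows "(\<integral>\<^sup>+x\<in>hcube a l. F x \<partial>lborel) = (\<Sum>B\<in>UNIV. \<integral>\<^sup>+x\<in>hcube (subcorner a l B) (l / 2). F x \<partial>lborel)"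
proof -
  have "(\<integral>\<^sup>+x\<in>hcube a l. F x \<partial>lborel)
    = (\<integral>\<^sup>+x. (\<Sum>B\<in>UNIV. F x * indicator (hcube (subcorner a l B) (l / 2)) x) \<partial>lborel)"
    by (simp only: indicator_hcube_split[OF l, of a] sum_distrib_left)
  also have "\<dots> = (\<Sum>B\<in>UNIV. \<integral>\<^sup>+x\<in>hcube (subcorner a l B) (l / 2). F x \<partial>lborel)"
    by (rule nn_integral_sum) measurable
  finally show ?thesis .
qed

text \<open>Lower corner of the generation \<open>k\<close> dyadic descendant that contains
  \<open>x\<close>, found by following \<open>x\<close> downwards. This reading is valid for
  \<open>x\<close> in \<open>hcube a l\<close>, which is why integrals and sums of it carry the
  indicator of that cube.\<close>

primrec dcorner :: "nat \<Rightarrow> real^'n \<Rightarrow> real \<Rightarrow> real^'n \<Rightarrow> real^'n" where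
  "dcorner 0 a l x = a"
| "dcorner (Suc k) a l x =
    subcorner (dcorner k a l x) (l / 2 ^ k) (upper_half (dcorner k a l x) (l / 2 ^ k) x)"

text \<open>The recursion in the definition subdivides at the smallest scale. Inductions that
  descend from a cube to its children need the first subdivision to be taken at the top
  instead.\<close>

lemma dcorner_Suc_shift:
  "dcorner (Suc k) a l x = dcorner k (subcorner a l (upper_half a l x)) (l / 2) x"
proof (induction k)
  case (Suc k)
  have "l / 2 ^ Suc k = l / 2 / 2 ^ k" by simp
  then show ?case using Suc by (simp only: dcorner.simps)
qed simp

lemma dcorner_child:
  assumes "0 < l" "x \<in> hcube (subcorner a l B) (l / 2)"
  shows "dcorner (Suc k) a l x = dcorner k (subcorner a l B) (l / 2) x"
  using assms unfolding dcorner_Suc_shift by (simp add: hcube_subcorner_iff)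

lemma mem_hcube_dcorner:
  assumes "0 < l" "x \<in> hcube a l"
  shows "x \<in> hcube (dcorner k a l x) (l / 2 ^ k)"
proof (induction k)
  case (Suc k)
  have "l / 2 ^ Suc k = l / 2 ^ k / 2" by simp
  then show ?case using Suc assms hcube_subcorner_iff[of "l / 2 ^ k" x] by (simp only: dcorner.simps) simp
qed (use assms in simp)

lemma hcube_dcorner_subset:
  assumes "0 < l"
  shows "hcube (dcorner k a l x) (l / 2 ^ k) \<subseteq> hcube a l"
proof (induction k)
  case (Suc k)
  have "l / 2 ^ Suc k = l / 2 ^ k / 2" by simp
  then have "hcube (dcorner (Suc k) a l x) (l / 2 ^ Suc k) \<subseteq> hcube (dcorner k a l x) (l / 2 ^ k)"
    using hcube_subcorner_subset[of "l / 2 ^ k"] assms by (simp only: dcorner.simps) simp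
  with Suc show ?case by blast
qed simp

lemma dcorner_Suc_split:
  fixes F :: "real^'n \<Rightarrow> ennreal"
  assumes l: "0 < l"
  shows "F (dcorner (Suc k) a l x) * indicator (hcube a l) x
    = (\<Sum>B\<in>UNIV. F (dcorner k (subcorner a l B) (l / 2) x) * indicator (hcube (subcorner a l B) (l / 2)) x)"
  unfolding indicator_hcube_split[OF l, of a] sum_distrib_left
proof (rule sum.cong[OF refl])
  fix B
  show "F (dcorner (Suc k) a l x) * indicator (hcube (subcorner a l B) (l / 2)) x
    = F (dcorner k (subcorner a l B) (l / 2) x) * indicator (hcube (subcorner a l B) (l / 2)) x"
    using dcorner_child[OF l, of x a B k] by (cases "x \<in> hcube (subcorner a l B) (l / 2)") simp_all
qed

lemma dcorner_measurable[measurable]: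
  fixes F :: "real^'n \<Rightarrow> ennreal"
  assumes "0 < l"
  shows "(\<lambda>x. F (dcorner k a l x) * indicator (hcube a l) x) \<in> borel_measurable borel"
  using assms
proof (induction k arbitrary: a l)
  case (Suc k)
  then show ?case
    unfolding dcorner_Suc_split[OF Suc.prems] by (intro borel_measurable_sum Suc.IH) auto
qed simp

lemma nn_integral_dcorner_Suc:
  fixes F :: "real^'n \<Rightarrow> ennreal"
  assumes l: "0 < l"
  shows "(\<integral>\<^sup>+x\<in>hcube a l. F (dcorner (Suc k) a l x) \<partial>lborel)
    = (\<Sum>B\<in>UNIV. \<integral>\<^sup>+x\<in>hcube (subcorner a l B) (l / 2). F (dcorner k (subcorner a l B) (l / 2) x) \<partial>lborel)"
proof -
  have [measurable]: "(\<lambda>x. F (dcorner k (subcorner a l B) (l / 2) x) * indicator (hcube (subcorner a l B) (l / 2)) x)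
    \<in> borel_measurable borel" for B
    using l by (intro dcorner_measurable) simp
  show ?thesis
    unfolding dcorner_Suc_split[OF l] by (subst nn_integral_sum) auto
qed

text \<open>The union of the descendants of generation at most \<open>N\<close> that satisfy the
  stopping condition \<open>P\<close>. The bound \<open>N\<close> permits induction on the depth;
  the full union is recovered by monotone convergence.\<close>

definition dbad :: "(real^'n \<Rightarrow> real \<Rightarrow> bool) \<Rightarrow> nat \<Rightarrow> real^'n \<Rightarrow> real \<Rightarrow> (real^'n) set" where
  "dbad P N a l = {x \<in> hcube a l. \<exists>k\<le>N. P (dcorner k a l x) (l / 2 ^ k)}"

lemma dbad_0: "dbad P 0 a l = (if P a l then hcube a l else {})"
  unfolding dbad_def by simp

lemma dbad_Suc:
  assumes l: "0 < l"
  shows "dbad P (Suc N) a l = (if P a l then hcube a l else (\<Union>B. dbad P N (subcorner a l B) (l / 2)))"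
proof -
  have h: "P (dcorner (Suc k) a l x) (l / 2 ^ Suc k) \<longleftrightarrow> P (dcorner k (subcorner a l B) (l / 2) x) (l / 2 / 2 ^ k)"
    if "x \<in> hcube (subcorner a l B) (l / 2)" for x B k
    using dcorner_child[OF l that] by (simp del: dcorner.simps)
  have ex: "(\<exists>k\<le>Suc N. Q k) \<longleftrightarrow> Q 0 \<or> (\<exists>k\<le>N. Q (Suc k))" for Q :: "nat \<Rightarrow> bool"
    by (metis (no_types) Suc_le_mono le0 not0_implies_Suc)
  show ?thesis
  proof (cases "P a l")
    case True
    then show ?thesis unfolding dbad_def ex by auto
  next
    case False
    have "x \<in> dbad P (Suc N) a l \<longleftrightarrow> (\<exists>B. x \<in> dbad P N (subcorner a l B) (l / 2))" for x
    proof
      assume "x \<in> dbad P (Suc N) a l"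
      then obtain k where k: "x \<in> hcube a l" "k \<le> N" "P (dcorner (Suc k) a l x) (l / 2 ^ Suc k)"
        using False unfolding dbad_def ex by auto
      then have "x \<in> hcube (subcorner a l (upper_half a l x)) (l / 2)"
        using l by (simp add: hcube_subcorner_iff)
      with k h[OF this] show "\<exists>B. x \<in> dbad P N (subcorner a l B) (l / 2)"
        unfolding dbad_def by blast
    next
      assume "\<exists>B. x \<in> dbad P N (subcorner a l B) (l / 2)"
      then obtain B k where "x \<in> hcube (subcorner a l B) (l / 2)" "k \<le> N"
          "P (dcorner k (subcorner a l B) (l / 2) x) (l / 2 / 2 ^ k)"
        unfolding dbad_def by blast
      with h l hcube_subcorner_subset show "x \<in> dbad P (Suc N) a l"
        unfolding dbad_def ex by blast
    qed
    with False show ?thesis by auto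
  qed
qed

lemma dbad_measurable: "0 < l \<Longrightarrow> dbad P N a l \<in> sets borel"
proof (induction N arbitrary: a l)
  case (Suc N)
  then show ?case unfolding dbad_Suc[OF Suc.prems] by (auto intro!: sets.finite_UN)
qed (simp add: dbad_0)

text \<open>The recursion mirrors the choice of maximal stopping cubes: either \<open>P\<close>
  holds for the cube itself and the hypothesis applies, or the estimate is summed over the children.
  Since these are disjoint, the constant is 1 whatever the weight.\<close>

lemma dyadic_maximal_weak_type_finite:
  fixes w F :: "real^'n \<Rightarrow> ennreal"
  assumes [measurable]: "w \<in> borel_measurable borel" "F \<in> borel_measurable borel" and l: "0 < l"
    and P: "\<And>a l. 0 < l \<Longrightarrow> P a l \<Longrightarrow> A * (\<integral>\<^sup>+x\<in>hcube a l. w x \<partial>lborel) \<le> (\<integral>\<^sup>+x\<in>hcube a l. F x \<partial>lborel)"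
  shows "A * (\<integral>\<^sup>+x\<in>dbad P N a l. w x \<partial>lborel) \<le> (\<integral>\<^sup>+x\<in>hcube a l. F x \<partial>lborel)"
  using l
proof (induction N arbitrary: a l)
  case 0
  then show ?case using P by (simp add: dbad_0)
next
  case (Suc N)
  show ?case
  proof (cases "P a l")
    case True
    then show ?thesis using P Suc.prems by (simp add: dbad_Suc)
  next
    case False
    have [measurable]: "dbad P N (subcorner a l B) (l / 2) \<in> sets borel" for B
      using Suc.prems by (intro dbad_measurable) simp
    have "w x * indicator (dbad P (Suc N) a l) x
        \<le> (\<Sum>B\<in>UNIV. w x * indicator (dbad P N (subcorner a l B) (l / 2)) x)" for x
    proof (cases "x \<in> dbad P (Suc N) a l")
      case True
      with False Suc.prems obtain B where "x \<in> dbad P N (subcorner a l B) (l / 2)"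
        by (auto simp: dbad_Suc)
      then have "w x * indicator (dbad P (Suc N) a l) x \<le> w x * indicator (dbad P N (subcorner a l B) (l / 2)) x"
        by (auto simp: indicator_def)
      also have "\<dots> \<le> (\<Sum>B\<in>UNIV. w x * indicator (dbad P N (subcorner a l B) (l / 2)) x)"
        by (rule member_le_sum) auto
      finally show ?thesis .
    qed simp
    then have "(\<integral>\<^sup>+x\<in>dbad P (Suc N) a l. w x \<partial>lborel)
        \<le> (\<integral>\<^sup>+x. (\<Sum>B\<in>UNIV. w x * indicator (dbad P N (subcorner a l B) (l / 2)) x) \<partial>lborel)"
      by (intro nn_integral_mono)
    also have "\<dots> = (\<Sum>B\<in>UNIV. \<integral>\<^sup>+x\<in>dbad P N (subcorner a l B) (l / 2). w x \<partial>lborel)"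
      by (rule nn_integral_sum) measurable
    finally have "A * (\<integral>\<^sup>+x\<in>dbad P (Suc N) a l. w x \<partial>lborel)
        \<le> A * (\<Sum>B\<in>UNIV. \<integral>\<^sup>+x\<in>dbad P N (subcorner a l B) (l / 2). w x \<partial>lborel)"
      by (rule mult_left_mono) simp
    also have "\<dots> \<le> (\<Sum>B\<in>UNIV. \<integral>\<^sup>+x\<in>hcube (subcorner a l B) (l / 2). F x \<partial>lborel)"
      unfolding sum_distrib_left using Suc by (intro sum_mono Suc.IH) simp
    finally show ?thesis using Suc.prems by (simp add: nn_integral_hcube_split)
  qed
qed

lemma dyadic_maximal_weak_type:
  fixes w F :: "real^'n \<Rightarrow> ennreal"
  assumes [measurable]: "w \<in> borel_measurable borel" "F \<in> borel_measurable borel" and l: "0 < l"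
    and P: "\<And>a l. 0 < l \<Longrightarrow> P a l \<Longrightarrow> A * (\<integral>\<^sup>+x\<in>hcube a l. w x \<partial>lborel) \<le> (\<integral>\<^sup>+x\<in>hcube a l. F x \<partial>lborel)"
  shows "A * (\<integral>\<^sup>+x\<in>(\<Union>N. dbad P N a l). w x \<partial>lborel) \<le> (\<integral>\<^sup>+x\<in>hcube a l. F x \<partial>lborel)"
proof -
  have [measurable]: "dbad P N a l \<in> sets borel" for N
    using l by (intro dbad_measurable) simp
  have inc: "incseq (\<lambda>N x. w x * indicator (dbad P N a l) x)"
    by (auto simp: incseq_def le_fun_def indicator_def dbad_def)
  have "w x * indicator (\<Union>N. dbad P N a l) x = (SUP N. w x * indicator (dbad P N a l) x)" for x
  proof (cases "\<exists>N. x \<in> dbad P N a l")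
    case True
    then obtain N where "x \<in> dbad P N a l" by blast
    then show ?thesis
      by (intro antisym SUP_least SUP_upper2[of N]) (auto simp: indicator_def)
  qed auto
  then have "(\<integral>\<^sup>+x\<in>(\<Union>N. dbad P N a l). w x \<partial>lborel) = (\<integral>\<^sup>+x. (SUP N. w x * indicator (dbad P N a l) x) \<partial>lborel)"
    by simp
  also have "\<dots> = (SUP N. \<integral>\<^sup>+x\<in>dbad P N a l. w x \<partial>lborel)"
    using inc by (intro nn_integral_monotone_convergence_SUP) auto
  finally show ?thesis
    using dyadic_maximal_weak_type_finite[of w F l P A _ a, OF _ _ l P]
    by (auto simp: SUP_mult_left_ennreal intro!: SUP_least)
qed

section \<open>Means over dyadic cubes\<close>

definition hmean :: "(real^'n \<Rightarrow> real) \<Rightarrow> real^'n \<Rightarrow> real \<Rightarrow> real" where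
  "hmean f a l = (LINT x:hcube a l|lborel. f x) / l ^ CARD('n)"

lemma locally_integrable_borel_hcube:
  assumes "locally_integrable_borel f"
  shows "set_integrable lborel (hcube a l) f"
  using assms unfolding locally_integrable_borel_def
  by (metis hcube_measurable hcube_subset_cbox set_integrable_subset sets_lborel)

text \<open>A cube of side \<open>m\<close> that contains \<open>x\<close> lies in the box of radius
  \<open>m\<close> around \<open>x\<close>. As \<open>mean_osc\<close> is normalised by
  \<open>m ^ n\<close>, the volume of the cube, and not by that of the box, no constant
  appears.\<close>

lemma hmean_diff_le_mean_osc:
  fixes f :: "real^'n \<Rightarrow> real"
  assumes f: "locally_integrable_borel f" and m: "0 < m" and x: "x \<in> hcube c m"
  shows "ennreal \<bar>hmean f c m - f x\<bar> \<le> mean_osc f m x"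
proof -
  have [measurable]: "f \<in> borel_measurable borel" using f by measurable
  let ?n = "CARD('n)"
  have si: "set_integrable lborel (hcube c m) f" using f by (rule locally_integrable_borel_hcube)
  have sc: "set_integrable lborel (hcube c m) (\<lambda>_. f x)"
    unfolding set_integrable_def using m by (simp add: emeasure_hcube)
  have fxi: "f x = (LINT y:hcube c m|lborel. f x) / m ^ ?n"
    using m by (simp add: set_lebesgue_integral_def measure_hcube)
  have "hmean f c m - f x = (LINT y:hcube c m|lborel. f y - f x) / m ^ ?n"
    unfolding hmean_def by (subst fxi) (simp add: set_integral_diff[OF si sc] diff_divide_distrib)
  then have "ennreal \<bar>hmean f c m - f x\<bar> = ennreal (norm (LINT y:hcube c m|lborel. f y - f x)) / ennreal (m ^ ?n)"
    using m by (simp add: divide_ennreal)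
  also have "\<dots> \<le> (\<integral>\<^sup>+y. ennreal (norm (indicator (hcube c m) y *\<^sub>R (f y - f x))) \<partial>lborel) / ennreal (m ^ ?n)"
    unfolding set_lebesgue_integral_def
    using set_integral_diff(1)[OF si sc] unfolding set_integrable_def
    by (rule divide_right_mono_ennreal[OF integral_norm_bound_ennreal])
  also have "(\<integral>\<^sup>+y. ennreal (norm (indicator (hcube c m) y *\<^sub>R (f y - f x))) \<partial>lborel)
      = (\<integral>\<^sup>+z. ennreal (norm (indicator (hcube c m) (z + x) *\<^sub>R (f (z + x) - f x))) \<partial>lborel)"
    by (rule nn_integral_lborel_shift[symmetric]) measurable
  also have "\<dots> \<le> (\<integral>\<^sup>+z\<in>cbox (- vec m) (vec m). ennreal \<bar>f (x + z) - f x\<bar> \<partial>lborel)"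
  proof (rule nn_integral_mono)
    fix z
    have "z \<in> cbox (- vec m) (vec m)" if zx: "z + x \<in> hcube c m"
    proof -
      have "- m \<le> z $ i" "z $ i \<le> m" for i
        using zx x unfolding hcube_def by (auto dest!: spec[of _ i])
      then show ?thesis by (simp add: mem_box_cart)
    qed
    then show "ennreal (norm (indicator (hcube c m) (z + x) *\<^sub>R (f (z + x) - f x)))
        \<le> ennreal \<bar>f (x + z) - f x\<bar> * indicator (cbox (- vec m) (vec m)) z"
      by (auto simp: indicator_def add.commute)
  qed
  finally show ?thesis unfolding mean_osc_def by (simp add: divide_right_mono_ennreal)
qed

lemma tendsto_of_ennreal_bound:
  fixes g :: "nat \<Rightarrow> real"
  assumes "\<And>k. ennreal \<bar>g k - c\<bar> \<le> h k" and lim: "h \<longlonglongrightarrow> 0"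
  shows "g \<longlonglongrightarrow> c"
proof (rule tendstoI)
  fix e :: real assume e: "0 < e"
  then have "\<forall>\<^sub>F k in sequentially. h k < ennreal e" by (intro order_tendstoD(2)[OF lim]) simp
  then show "\<forall>\<^sub>F k in sequentially. dist (g k) c < e"
  proof eventually_elim
    case (elim k)
    then have "ennreal \<bar>g k - c\<bar> < ennreal e" using assms(1) le_less_trans by blast
    then show ?case by (simp add: ennreal_less_iff dist_real_def)
  qed
qed

lemma dyadic_mean_AE_subseq:
  fixes f :: "real^'n \<Rightarrow> real"
  assumes f: "locally_integrable_borel f" and l: "0 < l"
  obtains s :: "nat \<Rightarrow> nat" where "strict_mono s"
    "AE x in lborel. x \<in> hcube a l \<longrightarrow> (\<lambda>k. hmean f (dcorner (s k) a l x) (l / 2 ^ s k)) \<longlonglongrightarrow> f x"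
proof -
  have r: "(\<lambda>k. l / 2 ^ k) \<longlonglongrightarrow> 0"
    unfolding divide_inverse by (rule tendsto_mult_right_zero[OF LIMSEQ_inverse_realpow_zero]) simp
  obtain s where s: "strict_mono s"
    "AE x in lborel. x \<in> cbox a (a + vec l) \<longrightarrow> (\<lambda>k. mean_osc f (l / 2 ^ s k) x) \<longlonglongrightarrow> 0"
    by (rule mean_osc_AE_subseq[OF f r, of a "a + vec l"]) (use l in simp)
  have "AE x in lborel. x \<in> hcube a l \<longrightarrow> (\<lambda>k. hmean f (dcorner (s k) a l x) (l / 2 ^ s k)) \<longlonglongrightarrow> f x"
    using s(2)
  proof eventually_elim
    case (elim x)
    show ?case
    proof
      assume x: "x \<in> hcube a l"
      then have lim: "(\<lambda>k. mean_osc f (l / 2 ^ s k) x) \<longlonglongrightarrow> 0" using elim hcube_subset_cbox by blast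
      have bound: "ennreal \<bar>hmean f (dcorner (s k) a l x) (l / 2 ^ s k) - f x\<bar> \<le> mean_osc f (l / 2 ^ s k) x" for k
        using l by (intro hmean_diff_le_mean_osc f mem_hcube_dcorner x) auto
      show "(\<lambda>k. hmean f (dcorner (s k) a l x) (l / 2 ^ s k)) \<longlonglongrightarrow> f x"
        by (rule tendsto_of_ennreal_bound[OF bound lim])
    qed
  qed
  with s(1) that show ?thesis by blast
qed

subsection \<open>Weights of small mean oscillation\<close>

lemma ennreal_set_integral_le:
  fixes g :: "'a::euclidean_space \<Rightarrow> real"
  assumes "set_integrable lborel S g"
  shows "ennreal (LINT x:S|lborel. g x) \<le> (\<integral>\<^sup>+x\<in>S. ennreal (g x) \<partial>lborel)"
proof -
  let ?h = "\<lambda>x. indicator S x *\<^sub>R g x"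
  have int: "integrable lborel ?h" using assms by (simp add: set_integrable_def)
  then have fin: "(\<integral>\<^sup>+x. ennreal (?h x) \<partial>lborel) \<noteq> \<infinity>"
    unfolding real_integrable_def by simp
  have "(LINT x:S|lborel. g x) \<le> enn2real (\<integral>\<^sup>+x. ennreal (?h x) \<partial>lborel)"
    unfolding set_lebesgue_integral_def using real_lebesgue_integral_def[OF int] by simp
  then have "ennreal (LINT x:S|lborel. g x) \<le> (\<integral>\<^sup>+x. ennreal (?h x) \<partial>lborel)"
    using fin by (metis ennreal_enn2real ennreal_leI infinity_ennreal_def top.not_eq_extremum)
  also have "\<dots> = (\<integral>\<^sup>+x\<in>S. ennreal (g x) \<partial>lborel)"
    by (intro nn_integral_cong) (simp add: indicator_def)
  finally show ?thesis .
qed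

lemma nn_integral_hcube_eq:
  fixes f :: "real^'n \<Rightarrow> real"
  assumes f: "locally_integrable_borel f" "\<And>x. 0 \<le> f x" and l: "0 < l"
  shows "(\<integral>\<^sup>+x\<in>hcube a l. ennreal (f x) \<partial>lborel) = ennreal (hmean f a l * l ^ CARD('n))"
proof -
  have "set_integrable lborel (hcube a l) f" using f by (intro locally_integrable_borel_hcube)
  then have "(\<integral>\<^sup>+x. ennreal (indicator (hcube a l) x *\<^sub>R f x) \<partial>lborel) = ennreal (LINT x:hcube a l|lborel. f x)"
    unfolding set_integrable_def set_lebesgue_integral_def by (rule nn_integral_eq_integral) (simp add: f)
  moreover have "(\<integral>\<^sup>+x\<in>hcube a l. ennreal (f x) \<partial>lborel) = (\<integral>\<^sup>+x. ennreal (indicator (hcube a l) x *\<^sub>R f x) \<partial>lborel)"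
    by (intro nn_integral_cong) (simp add: indicator_def)
  ultimately show ?thesis using l by (simp add: hmean_def)
qed

lemma hmean_pos:
  fixes f :: "real^'n \<Rightarrow> real"
  assumes f: "locally_integrable_borel f" "\<And>x. 0 < f x" and l: "0 < l"
  shows "0 < hmean f a l"
proof (rule ccontr)
  have [measurable]: "f \<in> borel_measurable borel" using f by measurable
  assume "\<not> ?thesis"
  then have "hmean f a l * l ^ CARD('n) \<le> 0" using l by (simp add: mult_nonpos_nonneg)
  then have "(\<integral>\<^sup>+x\<in>hcube a l. ennreal (f x) \<partial>lborel) = 0"
    using nn_integral_hcube_eq[OF f(1) less_imp_le[OF f(2)] l] by (simp add: ennreal_neg)
  then have "AE x in lborel. ennreal (f x) * indicator (hcube a l) x = 0"
    by (subst (asm) nn_integral_0_iff_AE) auto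
  then have "AE x in lborel. x \<notin> hcube a l"
  proof eventually_elim
    case (elim x)
    then show ?case using f(2)[of x] by (auto simp: indicator_def ennreal_eq_0_iff split: if_splits)
  qed
  then have "emeasure lborel (hcube a l) = 0"
    by (subst (asm) AE_iff_measurable[of "hcube a l"]) auto
  with l show False by (simp add: emeasure_hcube)
qed

text \<open>The Gurov--Reshetnyak type condition that replaces the Fujii--Wilson constant.\<close>

definition almost_constant :: "real \<Rightarrow> (real^'n \<Rightarrow> real) \<Rightarrow> bool" where
  "almost_constant \<delta> w \<longleftrightarrow> locally_integrable_borel w \<and> (\<forall>x. 0 < w x) \<and>
    (\<forall>a l. 0 < l \<longrightarrow> (\<integral>\<^sup>+x\<in>hcube a l. ennreal (hmean w a l - w x) \<partial>lborel)
       \<le> ennreal (\<delta> * (hmean w a l * l ^ CARD('n))))"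

lemma set_integral_const_hcube:
  fixes a :: "real^'n"
  assumes "S \<in> sets borel" "S \<subseteq> hcube a l" "0 < l"
  shows "set_integrable lborel S (\<lambda>_. c::real)" "(LINT x:S|lborel. c) = c * measure lborel S"
proof -
  have "emeasure lborel S \<le> emeasure lborel (hcube a l)" using assms by (intro emeasure_mono) auto
  then have fin: "emeasure lborel S < \<infinity>" using assms by (simp add: emeasure_hcube le_less_trans)
  then show "set_integrable lborel S (\<lambda>_. c::real)"
    using assms unfolding set_integrable_def by simp
  show "(LINT x:S|lborel. c) = c * measure lborel S"
    using assms fin by (simp add: set_lebesgue_integral_def)
qed

text \<open>On any subset the deficit \<open>hmean w a l - w\<close> integrates to at most its
  positive part over the whole cube. Both estimates for children are instances, one for the child
  and one for its complement.\<close>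

lemma almost_constant_subset:
  fixes w :: "real^'n \<Rightarrow> real"
  assumes w: "almost_constant \<delta> w" and d: "0 \<le> \<delta>" and l: "0 < l" and S: "S \<in> sets borel" "S \<subseteq> hcube a l"
  shows "hmean w a l * measure lborel S - \<delta> * (hmean w a l * l ^ CARD('n)) \<le> (LINT x:S|lborel. w x)"
proof -
  have lw: "locally_integrable_borel w" and wp: "\<And>x. 0 < w x" using w by (auto simp: almost_constant_def)
  have [measurable]: "w \<in> borel_measurable borel" using lw by measurable
  let ?m = "hmean w a l"
  have m: "0 < ?m" by (rule hmean_pos[OF lw wp l])
  have si: "set_integrable lborel S w"
    using locally_integrable_borel_hcube[OF lw, of a l] S by (metis set_integrable_subset sets_lborel)
  have sc: "set_integrable lborel S (\<lambda>_. ?m)" by (rule set_integral_const_hcube[OF S l])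
  have "ennreal (?m * measure lborel S - (LINT x:S|lborel. w x)) = ennreal (LINT x:S|lborel. ?m - w x)"
    using set_integral_diff(2)[OF sc si] set_integral_const_hcube(2)[OF S l, of ?m] by simp
  also have "\<dots> \<le> (\<integral>\<^sup>+x\<in>S. ennreal (?m - w x) \<partial>lborel)"
    by (rule ennreal_set_integral_le[OF set_integral_diff(1)[OF sc si]])
  also have "\<dots> \<le> (\<integral>\<^sup>+x\<in>hcube a l. ennreal (?m - w x) \<partial>lborel)"
    using S by (intro nn_integral_mono) (auto simp: indicator_def)
  also have "\<dots> \<le> ennreal (\<delta> * (?m * l ^ CARD('n)))"
    using w l by (auto simp: almost_constant_def)
  finally have "?m * measure lborel S - (LINT x:S|lborel. w x) \<le> \<delta> * (?m * l ^ CARD('n))"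
    using d m l by (subst (asm) ennreal_le_iff) auto
  then show ?thesis by simp
qed

lemma almost_constant_child_lower:
  fixes w :: "real^'n \<Rightarrow> real"
  assumes w: "almost_constant \<delta> w" and d: "0 \<le> \<delta>" and l: "0 < l"
  shows "(1 - 2 ^ CARD('n) * \<delta>) * hmean w a l \<le> hmean w (subcorner a l B) (l / 2)"
proof -
  let ?S = "hcube (subcorner a l B) (l / 2)" and ?n = "CARD('n)"
  have "hmean w a l * measure lborel ?S - \<delta> * (hmean w a l * l ^ ?n) \<le> (LINT x:?S|lborel. w x)"
    by (rule almost_constant_subset[OF w d l]) (auto simp: hcube_subcorner_subset[OF l, THEN subsetD])
  moreover have "measure lborel ?S = (l / 2) ^ ?n" using l by (simp add: measure_hcube)
  ultimately have "hmean w a l * (l / 2) ^ ?n - \<delta> * (hmean w a l * l ^ ?n) \<le> hmean w (subcorner a l B) (l / 2) * (l / 2) ^ ?n"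
    using l by (simp add: hmean_def[of w "subcorner a l B"])
  moreover have "\<delta> * (hmean w a l * l ^ ?n) = 2 ^ ?n * \<delta> * hmean w a l * (l / 2) ^ ?n"
    by (simp add: power_divide)
  moreover have "(1 - 2 ^ ?n * \<delta>) * hmean w a l * (l / 2) ^ ?n
      = hmean w a l * (l / 2) ^ ?n - 2 ^ ?n * \<delta> * hmean w a l * (l / 2) ^ ?n"
    by (simp only: left_diff_distrib mult_1_left)
  ultimately have "(1 - 2 ^ ?n * \<delta>) * hmean w a l * (l / 2) ^ ?n \<le> hmean w (subcorner a l B) (l / 2) * (l / 2) ^ ?n"
    by linarith
  then show ?thesis using l by (simp add: mult_le_cancel_right)
qed

text \<open>The bound for subsets is one-sided; applied to the complement of the child it becomes an
  upper bound for the mass of the child. Here \<open>\<delta>\<close> appears without a factor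
  \<open>2 ^ n\<close> because masses are compared rather than means.\<close>

lemma almost_constant_child_upper:
  fixes w :: "real^'n \<Rightarrow> real"
  assumes w: "almost_constant \<delta> w" and d: "0 \<le> \<delta>" and l: "0 < l"
  shows "hmean w (subcorner a l B) (l / 2) * (l / 2) ^ CARD('n)
    \<le> (1 / 2 ^ CARD('n) + \<delta>) * (hmean w a l * l ^ CARD('n))"
proof -
  let ?n = "CARD('n)" and ?Q = "hcube a l" and ?R = "hcube (subcorner a l B) (l / 2)"
  let ?S = "?Q - ?R"
  have lw: "locally_integrable_borel w" using w by (auto simp: almost_constant_def)
  have RQ: "?R \<subseteq> ?Q" by (rule hcube_subcorner_subset[OF l])
  have si: "set_integrable lborel ?S w"
    using locally_integrable_borel_hcube[OF lw, of a l]
    by (rule set_integrable_subset) auto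
  have "measure lborel ?S = measure lborel ?Q - measure lborel ?R"
    using RQ l by (intro measure_Diff) (auto simp: emeasure_hcube)
  also have "\<dots> = l ^ ?n - (l / 2) ^ ?n" using l by (simp add: measure_hcube)
  finally have mS: "measure lborel ?S = l ^ ?n - (l / 2) ^ ?n" .
  have "hmean w a l * measure lborel ?S - \<delta> * (hmean w a l * l ^ ?n) \<le> (LINT x:?S|lborel. w x)"
    by (rule almost_constant_subset[OF w d l]) auto
  moreover have un: "?S \<union> ?R = ?Q" using RQ by auto
  have "(LINT x:(?S \<union> ?R)|lborel. w x) = (LINT x:?S|lborel. w x) + (LINT x:?R|lborel. w x)"
    by (rule set_integral_Un) (use si locally_integrable_borel_hcube[OF lw] in auto)
  note this[unfolded un]
  moreover have "(LINT x:?Q|lborel. w x) = hmean w a l * l ^ ?n" using l by (simp add: hmean_def)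
  moreover have "(LINT x:?R|lborel. w x) = hmean w (subcorner a l B) (l / 2) * (l / 2) ^ ?n"
    using l by (simp add: hmean_def)
  moreover have "(1 / 2 ^ ?n + \<delta>) * (hmean w a l * l ^ ?n) = hmean w a l * (l / 2) ^ ?n + \<delta> * (hmean w a l * l ^ ?n)"
    by (simp add: power_divide distrib_right)
  ultimately show ?thesis unfolding mS right_diff_distrib by linarith
qed

section \<open>Negative moments of an almost constant weight\<close>

lemma sum_children_const:
  fixes m :: real
  assumes "0 \<le> c" "0 \<le> m"
  shows "(\<Sum>B\<in>(UNIV::'n::finite set set). ennreal (c * (m / 2) ^ CARD('n))) = ennreal (c * m ^ CARD('n))"
proof -
  have card: "card (UNIV::'n set set) = 2 ^ CARD('n)"
    using card_Pow[of "UNIV::'n set"] by simp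
  have "(\<Sum>B\<in>(UNIV::'n set set). ennreal (c * (m / 2) ^ CARD('n)))
    = ennreal (\<Sum>B\<in>(UNIV::'n set set). c * (m / 2) ^ CARD('n))"
    using assms by (intro sum_ennreal) auto
  also have "(\<Sum>B\<in>(UNIV::'n set set). c * (m / 2) ^ CARD('n)) = c * m ^ CARD('n)"
    by (simp add: card power_divide)
  finally show ?thesis .
qed

text \<open>Stopping-time argument in inductive form: descend from a cube of mean at least \<open>\<mu>\<close> until the mean drops
  below \<open>\<mu>\<close>. It is then still at least \<open>\<mu> / 2\<close>, the induction hypothesis applies, and the volume of the
  stopped cubes is controlled by the last integral.\<close>

lemma dyadic_negative_moment_step:
  fixes w :: "real^'n \<Rightarrow> real"
  assumes w: "almost_constant \<delta> w" and d: "0 \<le> \<delta>" "2 ^ CARD('n) * \<delta> \<le> 1 / 2" and s: "0 < s" and lam: "0 < \<mu>"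
    and IH: "\<And>j c m. j < N \<Longrightarrow> 0 < m \<Longrightarrow>
      (\<integral>\<^sup>+x\<in>hcube c m. ennreal (hmean w (dcorner j c m x) (m / 2 ^ j) powr - s) \<partial>lborel)
        \<le> ennreal (K * hmean w c m powr - s * m ^ CARD('n))"
    and K: "0 \<le> K"
  shows "M \<le> N \<Longrightarrow> 0 < m \<Longrightarrow> \<mu> \<le> hmean w c m \<Longrightarrow>
    (\<integral>\<^sup>+x\<in>hcube c m. ennreal (hmean w (dcorner M c m x) (m / 2 ^ M) powr - s) \<partial>lborel)
      \<le> ennreal (\<mu> powr - s * m ^ CARD('n))
        + ennreal (K * (\<mu> / 2) powr - s / \<mu>) * (\<integral>\<^sup>+x\<in>hcube c m. ennreal (2 * \<mu> - w x) \<partial>lborel)"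
proof (induction M arbitrary: c m)
  case 0
  have "hmean w c m powr - s \<le> \<mu> powr - s" using 0 lam s by (intro powr_mono2') auto
  then have "ennreal (hmean w c m powr - s * m ^ CARD('n)) \<le> ennreal (\<mu> powr - s * m ^ CARD('n))"
    using 0 by (intro ennreal_leI mult_right_mono) auto
  then show ?case using 0
    by (simp add: nn_integral_cmult emeasure_hcube add_increasing2 flip: ennreal_mult)
next
  case (Suc M)
  have lw: "locally_integrable_borel w" and wp: "\<And>x. 0 < w x" using w by (auto simp: almost_constant_def)
  have [measurable]: "w \<in> borel_measurable borel" using lw by measurable
  let ?n = "CARD('n)"
  let ?\<kappa> = "K * (\<mu> / 2) powr - s / \<mu>"
  let ?I = "\<lambda>B. \<integral>\<^sup>+x\<in>hcube (subcorner c m B) (m / 2). ennreal (2 * \<mu> - w x) \<partial>lborel"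
  have m2: "0 < m / 2" using Suc.prems by simp
  have child: "(\<integral>\<^sup>+x\<in>hcube (subcorner c m B) (m / 2).
      ennreal (hmean w (dcorner M (subcorner c m B) (m / 2) x) (m / 2 / 2 ^ M) powr - s) \<partial>lborel)
      \<le> ennreal (\<mu> powr - s * (m / 2) ^ ?n) + ennreal ?\<kappa> * ?I B" for B
  proof (cases "\<mu> \<le> hmean w (subcorner c m B) (m / 2)")
    case True
    then show ?thesis using Suc.IH[OF _ m2 True] Suc.prems(1) by simp
  next
    case False
    let ?h = "hmean w (subcorner c m B) (m / 2)" and ?R = "hcube (subcorner c m B) (m / 2)"
    have "(1 - 2 ^ ?n * \<delta>) * hmean w c m \<le> ?h"
      by (rule almost_constant_child_lower[OF w d(1) Suc.prems(2)])
    moreover have "1 / 2 * hmean w c m \<le> (1 - 2 ^ ?n * \<delta>) * hmean w c m"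
      using d Suc.prems lam by (intro mult_right_mono) auto
    ultimately have h: "\<mu> / 2 \<le> ?h" using Suc.prems by simp
    \<comment> \<open>The threshold is doubled in the integrand so that a stopped child, whose mean
      lies below \<open>\<mu>\<close>, contributes at least \<open>\<mu>\<close> times its
      volume.\<close>
    have "(LINT x:?R|lborel. 2 * \<mu> - w x) = 2 * \<mu> * (m / 2) ^ ?n - ?h * (m / 2) ^ ?n"
      using set_integral_diff(2)[OF set_integral_const_hcube(1)[of ?R "subcorner c m B" "m / 2" "2 * \<mu>"] locally_integrable_borel_hcube[OF lw]]
        set_integral_const_hcube(2)[of ?R "subcorner c m B" "m / 2" "2 * \<mu>"] m2
      by (simp add: measure_hcube hmean_def)
    moreover have "?h * (m / 2) ^ ?n \<le> \<mu> * (m / 2) ^ ?n" using False m2 by (intro mult_right_mono) auto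
    ultimately have "\<mu> * (m / 2) ^ ?n \<le> (LINT x:?R|lborel. 2 * \<mu> - w x)" by simp
    then have "ennreal (\<mu> * (m / 2) ^ ?n) \<le> ennreal (LINT x:?R|lborel. 2 * \<mu> - w x)" by (rule ennreal_leI)
    also have "\<dots> \<le> ?I B"
      using set_integral_diff(1)[OF set_integral_const_hcube(1)[of ?R "subcorner c m B" "m / 2" "2 * \<mu>"] locally_integrable_borel_hcube[OF lw]] m2
      by (intro ennreal_set_integral_le) auto
    finally have I: "ennreal (\<mu> * (m / 2) ^ ?n) \<le> ?I B" .
    have "(\<integral>\<^sup>+x\<in>?R. ennreal (hmean w (dcorner M (subcorner c m B) (m / 2) x) (m / 2 / 2 ^ M) powr - s) \<partial>lborel)
      \<le> ennreal (K * ?h powr - s * (m / 2) ^ ?n)"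
      using IH[OF _ m2, of M] Suc.prems(1) by simp
    also have "\<dots> \<le> ennreal (K * (\<mu> / 2) powr - s * (m / 2) ^ ?n)"
      using h lam s K m2 by (intro ennreal_leI mult_right_mono mult_left_mono powr_mono2') auto
    also have "\<dots> = ennreal ?\<kappa> * ennreal (\<mu> * (m / 2) ^ ?n)"
      using lam K m2 by (subst ennreal_mult[symmetric]) auto
    also have "\<dots> \<le> ennreal ?\<kappa> * ?I B" using I by (rule mult_left_mono) simp
    finally show ?thesis by (rule order_trans) simp
  qed
  have "(\<integral>\<^sup>+x\<in>hcube c m. ennreal (hmean w (dcorner (Suc M) c m x) (m / 2 ^ Suc M) powr - s) \<partial>lborel)
    = (\<Sum>B\<in>UNIV. \<integral>\<^sup>+x\<in>hcube (subcorner c m B) (m / 2).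
      ennreal (hmean w (dcorner M (subcorner c m B) (m / 2) x) (m / 2 ^ Suc M) powr - s) \<partial>lborel)"
    by (rule nn_integral_dcorner_Suc[OF Suc.prems(2)])
  also have "\<dots> \<le> (\<Sum>B\<in>UNIV. ennreal (\<mu> powr - s * (m / 2) ^ ?n) + ennreal ?\<kappa> * ?I B)"
    using child by (intro sum_mono) simp
  also have "\<dots> = ennreal (\<mu> powr - s * m ^ ?n) + ennreal ?\<kappa> * (\<Sum>B\<in>UNIV. ?I B)"
    using Suc.prems sum_children_const[of "\<mu> powr - s" m, where 'n='n] by (simp add: sum.distrib sum_distrib_left)
  also have "(\<Sum>B\<in>UNIV. ?I B) = (\<integral>\<^sup>+x\<in>hcube c m. ennreal (2 * \<mu> - w x) \<partial>lborel)"
    by (rule nn_integral_hcube_split[symmetric]) (use Suc.prems in auto)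
  finally show ?case .
qed

lemma ennreal_plus_times:
  "0 \<le> a \<Longrightarrow> 0 \<le> b \<Longrightarrow> 0 \<le> c \<Longrightarrow> ennreal a + ennreal b * ennreal c = ennreal (a + b * c)"
  by (simp add: ennreal_mult ennreal_plus)

text \<open>The threshold is half the mean, so \<open>2 * \<mu> - w\<close> is the deficit that
  \<open>almost_constant\<close> controls. Relative to \<open>hmean w a l powr - s\<close> and the
  volume, the first term contributes \<open>2 powr s\<close>, which is half of
  \<open>K = 2 powr (s + 1)\<close>, and the stopped cubes contribute
  \<open>K * 2 * \<delta> * 4 powr s\<close>, at most \<open>K / 2\<close> by smallness. Thus
  \<open>K\<close> reproduces itself at every depth.\<close>

lemma dyadic_negative_moment:
  fixes w :: "real^'n \<Rightarrow> real"
  assumes w: "almost_constant \<delta> w" and d: "0 \<le> \<delta>" "2 ^ CARD('n) * \<delta> \<le> 1 / 2" and s: "0 < s"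
    and small: "4 * \<delta> * 4 powr s \<le> 1" and l: "0 < l"
  shows "(\<integral>\<^sup>+x\<in>hcube a l. ennreal (hmean w (dcorner N a l x) (l / 2 ^ N) powr - s) \<partial>lborel)
      \<le> ennreal (2 powr (s + 1) * hmean w a l powr - s * l ^ CARD('n))"
  using l
proof (induction N arbitrary: a l rule: less_induct)
  case (less N)
  have lw: "locally_integrable_borel w" and wp: "\<And>x. 0 < w x" using w by (auto simp: almost_constant_def)
  let ?n = "CARD('n)" and ?m = "hmean w a l"
  define V where "V = l ^ ?n"
  have V: "0 < V" using less.prems by (simp add: V_def)
  define K where "K = 2 powr (s + 1)"
  have m: "0 < ?m" by (rule hmean_pos[OF lw wp less.prems])
  have K: "0 \<le> K" by (simp add: K_def)
  have "(\<integral>\<^sup>+x\<in>hcube a l. ennreal (hmean w (dcorner N a l x) (l / 2 ^ N) powr - s) \<partial>lborel)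
      \<le> ennreal ((?m / 2) powr - s * l ^ CARD('n))
        + ennreal (K * (?m / 2 / 2) powr - s / (?m / 2)) * (\<integral>\<^sup>+x\<in>hcube a l. ennreal (2 * (?m / 2) - w x) \<partial>lborel)"
    by (rule dyadic_negative_moment_step[OF w d s _ _ K, of "?m / 2" N N l a])
       (use less m in \<open>auto simp: K_def\<close>)
  also have "\<dots> \<le> ennreal ((?m / 2) powr - s * V)
        + ennreal (K * (?m / 2 / 2) powr - s / (?m / 2)) * ennreal (\<delta> * (?m * V))"
    using w less.prems unfolding V_def by (intro add_left_mono mult_left_mono) (auto simp: almost_constant_def)
  also have "\<dots> = ennreal ((?m / 2) powr - s * V + (K * (?m / 2 / 2) powr - s / (?m / 2)) * (\<delta> * (?m * V)))"
    using m d V K by (intro ennreal_plus_times) auto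
  also have "\<dots> \<le> ennreal (K * ?m powr - s * V)"
  proof (rule ennreal_leI)
    have e1: "(?m / 2) powr - s = 2 powr s * ?m powr - s"
      using m by (simp add: powr_divide powr_minus divide_simps)
    have e2: "(?m / 2 / 2) powr - s = 4 powr s * ?m powr - s"
      using m by (simp add: powr_divide powr_minus divide_simps)
    have "(?m / 2) powr - s * V + (K * (?m / 2 / 2) powr - s / (?m / 2)) * (\<delta> * (?m * V))
      = (2 powr s + K * (2 * \<delta> * 4 powr s)) * (?m powr - s * V)"
      unfolding e1 e2 using m by (simp add: field_simps)
    also have "\<dots> \<le> (K / 2 + K * (1 / 2)) * (?m powr - s * V)"
      using V small K by (intro mult_right_mono add_mono mult_left_mono) (auto simp: K_def powr_add)
    finally show "(?m / 2) powr - s * V + (K * (?m / 2 / 2) powr - s / (?m / 2)) * (\<delta> * (?m * V)) \<le> K * ?m powr - s * V"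
      by simp
  qed
  finally show ?case unfolding V_def K_def .
qed

text \<open>The dyadic bound is uniform in the depth, and the dyadic means converge to the weight
  almost everywhere along a subsequence; Fatou's lemma does the rest.\<close>

lemma negative_moment:
  fixes w :: "real^'n \<Rightarrow> real"
  assumes w: "almost_constant \<delta> w" and d: "0 \<le> \<delta>" "2 ^ CARD('n) * \<delta> \<le> 1 / 2" and s: "0 < s"
    and small: "4 * \<delta> * 4 powr s \<le> 1" and l: "0 < l"
  shows "(\<integral>\<^sup>+x\<in>hcube a l. ennreal (w x powr - s) \<partial>lborel)
      \<le> ennreal (2 powr (s + 1) * hmean w a l powr - s * l ^ CARD('n))" (is "_ \<le> ?C")
proof -
  have lw: "locally_integrable_borel w" and wp: "\<And>x. 0 < w x" using w by (auto simp: almost_constant_def)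
  obtain r :: "nat \<Rightarrow> nat" where r:
    "AE x in lborel. x \<in> hcube a l \<longrightarrow> (\<lambda>k. hmean w (dcorner (r k) a l x) (l / 2 ^ r k)) \<longlonglongrightarrow> w x"
    by (rule dyadic_mean_AE_subseq[OF lw l])
  let ?F = "\<lambda>k x. ennreal (hmean w (dcorner (r k) a l x) (l / 2 ^ r k) powr - s) * indicator (hcube a l) x"
  have "AE x in lborel. ennreal (w x powr - s) * indicator (hcube a l) x = liminf (\<lambda>k. ?F k x)"
    using r
  proof eventually_elim
    case (elim x)
    show ?case
    proof (cases "x \<in> hcube a l")
      case True
      then have "(\<lambda>k. hmean w (dcorner (r k) a l x) (l / 2 ^ r k) powr - s) \<longlonglongrightarrow> w x powr - s"
        using elim wp[of x] by (intro tendsto_powr) auto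
      then have "(\<lambda>k. ?F k x) \<longlonglongrightarrow> ennreal (w x powr - s) * indicator (hcube a l) x"
        using True by simp
      then show ?thesis by (simp add: lim_imp_Liminf)
    qed (simp add: Liminf_const)
  qed
  then have "(\<integral>\<^sup>+x\<in>hcube a l. ennreal (w x powr - s) \<partial>lborel) = (\<integral>\<^sup>+x. liminf (\<lambda>k. ?F k x) \<partial>lborel)"
    by (rule nn_integral_cong_AE)
  also have "\<dots> \<le> liminf (\<lambda>k. \<integral>\<^sup>+x. ?F k x \<partial>lborel)"
    by (rule nn_integral_liminf) (use dcorner_measurable[OF l] in simp)
  also have "\<dots> \<le> liminf (\<lambda>k. ?C)"
    by (intro Liminf_mono always_eventually allI dyadic_negative_moment[OF w d s small l])
  finally show ?thesis by (simp add: Liminf_const)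
qed

text \<open>The Holder argument behind the \<open>A_p\<close> condition, in additive form:
  \<open>F\<close> is split pointwise into a multiple of its weighted \<open>p\<close>-th power and
  a multiple of \<open>w powr - s\<close>, and the multiplier \<open>L\<close> balances the two
  integrals. The constant 6 does not depend on \<open>p\<close>.\<close>

lemma mean_le_weighted_mean:
  fixes w F :: "real^'n \<Rightarrow> real"
  assumes w: "almost_constant \<delta> w" and d: "0 \<le> \<delta>" "2 ^ CARD('n) * \<delta> \<le> 1 / 2" and p: "1 < p"
    and small: "4 * \<delta> * 4 powr (1 / (p - 1)) \<le> 1" and l: "0 < l"
    and F: "F \<in> borel_measurable borel" "\<And>x. 0 \<le> F x" and T: "0 < T"
    and le: "(\<integral>\<^sup>+x\<in>hcube a l. ennreal (F x powr p * w x) \<partial>lborel) \<le> ennreal (T * (hmean w a l * l ^ CARD('n)))"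
  shows "(\<integral>\<^sup>+x\<in>hcube a l. ennreal (F x) \<partial>lborel) \<le> ennreal (6 * T powr (1 / p) * l ^ CARD('n))"
proof -
  have lw: "locally_integrable_borel w" and wp: "\<And>x. 0 < w x" using w by (auto simp: almost_constant_def)
  have [measurable]: "w \<in> borel_measurable borel" "F \<in> borel_measurable borel" using lw F by measurable
  define V where "V = l ^ CARD('n)"
  have V: "0 < V" using l by (simp add: V_def)
  define s where "s = 1 / (p - 1)"
  have s: "0 < s" using p by (simp add: s_def)
  define m where "m = hmean w a l"
  have m: "0 < m" unfolding m_def by (rule hmean_pos[OF lw wp l])
  \<comment> \<open>The powers of \<open>T\<close> and \<open>m\<close> give both terms the size
    \<open>T powr (1 / p) * V\<close>. The 4 yields \<open>4 powr - s\<close>, which outweighs the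
    factor \<open>2 powr (s + 1)\<close> of the moment bound; without it the constant would blow up
    as \<open>p\<close> tends to 1. The terms become at most 4 and 2 times that size.\<close>
  define L where "L = 4 * T powr (1 / p - 1) / m"
  have L: "0 < L" using T m by (simp add: L_def)
  \<comment> \<open>Either \<open>F x\<close> is below the second term, or
    \<open>F x powr (p - 1)\<close> exceeds \<open>1 / (L * w x)\<close> and multiplication by
    \<open>F x\<close> gives the first.\<close>
  have pt: "F x \<le> L * (F x powr p * w x) + L powr - s * w x powr - s" for x
  proof (cases "F x \<le> (L * w x) powr - s")
    case True
    then show ?thesis using L wp[of x] F(2)[of x] by (simp add: powr_mult add_increasing)
  next
    case False
    have Lw: "0 < L * w x" using L wp[of x] by simp
    then have Fp: "0 < F x" using False by (smt (verit) powr_gt_zero)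
    have "((L * w x) powr - s) powr (p - 1) \<le> F x powr (p - 1)"
      using False p by (intro powr_mono2) auto
    moreover have "((L * w x) powr - s) powr (p - 1) = 1 / (L * w x)"
    proof -
      have e: "- s * (p - 1) = - 1" using p by (simp add: s_def)
      show ?thesis unfolding powr_powr e using Lw by (simp add: powr_minus_divide)
    qed
    ultimately have "1 \<le> F x powr (p - 1) * (L * w x)" using Lw by (simp add: divide_le_eq)
    then have "F x * 1 \<le> F x * (F x powr (p - 1) * (L * w x))" using Fp by (intro mult_left_mono) auto
    also have "F x * F x powr (p - 1) = F x powr p" using Fp by (simp add: powr_mult_base)
    then have "F x * (F x powr (p - 1) * (L * w x)) = L * (F x powr p * w x)" by (simp add: algebra_simps)
    finally show ?thesis by (simp add: add_increasing2)
  qed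
  have "(\<integral>\<^sup>+x\<in>hcube a l. ennreal (F x) \<partial>lborel)
      \<le> (\<integral>\<^sup>+x. ennreal L * (ennreal (F x powr p * w x) * indicator (hcube a l) x)
          + ennreal (L powr - s) * (ennreal (w x powr - s) * indicator (hcube a l) x) \<partial>lborel)"
  proof (rule nn_integral_mono)
    fix x
    have "ennreal (F x) \<le> ennreal (L * (F x powr p * w x) + L powr - s * w x powr - s)"
      by (rule ennreal_leI[OF pt])
    also have "\<dots> = ennreal L * ennreal (F x powr p * w x) + ennreal (L powr - s) * ennreal (w x powr - s)"
      using L wp[of x] by (simp add: ennreal_mult ennreal_plus less_imp_le)
    finally show "ennreal (F x) * indicator (hcube a l) x \<le>
        ennreal L * (ennreal (F x powr p * w x) * indicator (hcube a l) x)
          + ennreal (L powr - s) * (ennreal (w x powr - s) * indicator (hcube a l) x)"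
      by (simp add: indicator_def)
  qed
  also have "\<dots> = ennreal L * (\<integral>\<^sup>+x\<in>hcube a l. ennreal (F x powr p * w x) \<partial>lborel)
      + ennreal (L powr - s) * (\<integral>\<^sup>+x\<in>hcube a l. ennreal (w x powr - s) \<partial>lborel)"
    by (simp add: nn_integral_add nn_integral_cmult)
  also have "\<dots> \<le> ennreal L * ennreal (T * (m * V)) + ennreal (L powr - s) * ennreal (2 powr (s + 1) * m powr - s * V)"
    using le negative_moment[OF w d s small[folded s_def] l] unfolding m_def V_def
    by (intro add_mono mult_left_mono) auto
  also have "\<dots> = ennreal (L * (T * (m * V)) + L powr - s * (2 powr (s + 1) * m powr - s * V))"
    using L T m V by (simp add: ennreal_mult ennreal_plus)
  also have "\<dots> \<le> ennreal (6 * T powr (1 / p) * V)"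
  proof (rule ennreal_leI)
    have T1: "T powr (1 / p - 1) * T = T powr (1 / p)"
      using T powr_add[of T "1/p - 1" 1] by simp
    have "L * (T * (m * V)) = 4 * T powr (1 / p) * V"
      using m by (simp add: L_def T1[symmetric])
    moreover have "L powr - s * (2 powr (s + 1) * m powr - s * V) \<le> 2 * T powr (1 / p) * V"
    proof -
      have "(1 / p - 1) * s = - (1 / p)" using p by (simp add: s_def field_simps)
      then have "L powr - s = 4 powr - s * T powr (1 / p) * m powr s"
        using m T by (simp add: L_def powr_divide powr_mult powr_powr powr_minus_divide)
      then have "L powr - s * (2 powr (s + 1) * m powr - s * V) = (4 powr - s * 2 powr (s + 1)) * T powr (1 / p) * V * (m powr s * m powr - s)"
        by (simp add: mult_ac)
      also have "m powr s * m powr - s = 1" using m by (simp add: powr_minus)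
      also have "(4::real) powr - s * 2 powr (s + 1) = 2 * 2 powr - s"
      proof -
        have "(4::real) = 2 powr 2" by simp
        then have "(4::real) powr - s * 2 powr (s + 1) = 2 powr (2 * - s + (s + 1))" by (metis powr_add powr_powr)
        also have "2 * - s + (s + 1) = 1 + - s" by simp
        finally show ?thesis by (simp only: powr_add powr_one_eq_one) simp
      qed
      also have "2 * 2 powr - s * T powr (1 / p) * V * 1 \<le> 2 * 1 * T powr (1 / p) * V * 1"
        using s V powr_mono[of "- s" 0 "2::real"] by (intro mult_right_mono mult_left_mono) auto
      finally show ?thesis by simp
    qed
    ultimately show "L * (T * (m * V)) + L powr - s * (2 powr (s + 1) * m powr - s * V) \<le> 6 * T powr (1 / p) * V"
      by linarith
  qed
  finally show ?thesis by (simp add: V_def)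
qed

subsection \<open>The weak-type estimate\<close>

text \<open>Weighted arithmetic-geometric mean inequality for 1/2 and 1. This chord bound is
  responsible both for the factor linear in \<open>r\<close> in the geometric series and, through
  \<open>doubling_exponent\<close>, for the value of \<open>\<tau>\<close>.\<close>

lemma half_powr_le:
  fixes y :: real
  assumes "0 \<le> y" "y \<le> 1"
  shows "(1 / 2) powr y \<le> 1 - y / 2"
  using Youngs_inequality_0[of y "1 - y" "1 / 2" 1] assms by simp

text \<open>From one term to the next the growth factor is at least \<open>2 powr (1 / r)\<close>,
  so the last term dominates; \<open>1 - 2 powr - (1 / r)\<close> is at least
  \<open>1 / (2 * r)\<close> by the chord bound.\<close>

lemma geometric_negative_powers:
  fixes \<omega> :: "nat \<Rightarrow> real"
  assumes pos: "\<And>k. 0 < \<omega> k" and half: "\<And>k. \<omega> (Suc k) \<le> \<omega> k / 2" and r: "1 \<le> r"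
  shows "(\<Sum>k\<le>N. \<omega> k powr - (1 / r)) \<le> 2 * r * \<omega> N powr - (1 / r)"
proof (induction N)
  case 0
  then show ?case using r by (simp add: mult_le_cancel_right1)
next
  case (Suc N)
  let ?y = "1 / r"
  have "2 * \<omega> (Suc N) \<le> \<omega> N" using half[of N] by simp
  then have "\<omega> N powr - ?y \<le> (2 * \<omega> (Suc N)) powr - ?y"
    using pos r by (intro powr_mono2') auto
  also have "\<dots> = (1 / 2) powr ?y * \<omega> (Suc N) powr - ?y"
    using pos[of "Suc N"] by (simp add: powr_mult powr_minus_divide powr_divide)
  also have "\<dots> \<le> (1 - ?y / 2) * \<omega> (Suc N) powr - ?y"
    using r by (intro mult_right_mono half_powr_le) auto
  finally have "\<omega> N powr - ?y \<le> (1 - ?y / 2) * \<omega> (Suc N) powr - ?y" .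
  then have "2 * r * \<omega> N powr - ?y \<le> 2 * r * ((1 - ?y / 2) * \<omega> (Suc N) powr - ?y)"
    using r by (intro mult_left_mono) auto
  also have "\<dots> = 2 * r * \<omega> (Suc N) powr - ?y - \<omega> (Suc N) powr - ?y"
    using r by (simp add: field_simps)
  finally show ?case using Suc by simp
qed

lemma sum_half_powers_le:
  fixes S :: "nat set"
  assumes "finite S" "\<And>k. k \<in> S \<Longrightarrow> k0 \<le> k"
  shows "(\<Sum>k\<in>S. (1 / 2 :: real) ^ k) \<le> 2 * (1 / 2) ^ k0"
proof -
  have g: "(\<Sum>k<N. (1 / 2 :: real) ^ (k0 + k)) \<le> 2 * (1 / 2) ^ k0" for N
  proof -
    have "(\<Sum>k<N. (1 / 2 :: real) ^ k) \<le> 2"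
      by (simp add: sum_gp_strict)
    then have "(1 / 2) ^ k0 * (\<Sum>k<N. (1 / 2 :: real) ^ k) \<le> (1 / 2) ^ k0 * 2"
      by (intro mult_left_mono) auto
    then show ?thesis by (simp add: power_add sum_distrib_left mult.commute)
  qed
  obtain N where N: "\<And>k. k \<in> S \<Longrightarrow> k < N" using assms(1) finite_nat_set_iff_bounded by auto
  have "(\<Sum>k\<in>S. (1 / 2 :: real) ^ k) \<le> (\<Sum>k\<in>(+) k0 ` {..<N}. (1 / 2) ^ k)"
  proof (rule sum_mono2)
    show "S \<subseteq> (+) k0 ` {..<N}"
    proof
      fix k assume "k \<in> S"
      then have "k0 \<le> k" "k < N" using assms N by auto
      then show "k \<in> (+) k0 ` {..<N}" by (intro image_eqI[of _ _ "k - k0"]) auto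
    qed
  qed auto
  also have "\<dots> = (\<Sum>k<N. (1 / 2) ^ (k0 + k))" by (subst sum.reindex) auto
  also note g
  finally show ?thesis .
qed

text \<open>The sum is split at \<open>\<omega> k = G / A\<close>; the part with large \<open>\<omega> k\<close> is a geometric series and is responsible
  for the factor \<open>r\<close>.\<close>

lemma hedberg_sum:
  fixes \<omega> :: "nat \<Rightarrow> real"
  assumes pos: "\<And>k. 0 < \<omega> k" and half: "\<And>k. \<omega> (Suc k) \<le> \<omega> k / 2"
    and low: "\<And>k. (1 / 2) ^ k \<le> \<omega> k powr \<theta>" and \<theta>: "\<theta> = 1 / p - 1 / r" "0 < \<theta>"
    and p: "1 \<le> p" and r: "1 \<le> r" and A: "0 < A" and G: "0 < G"
  shows "(\<Sum>k<N. (1 / 2) ^ k * min A (G / \<omega> k) powr (1 / p)) \<le> (2 + 2 * r) * (G powr \<theta> * A powr (1 / r))"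
proof -
  define \<rho> where "\<rho> = G / A"
  have \<rho>: "0 < \<rho>" using A G by (simp add: \<rho>_def)
  define S1 where "S1 = {k\<in>{..<N}. \<omega> k \<le> \<rho>}"
  define S2 where "S2 = {k\<in>{..<N}. \<not> \<omega> k \<le> \<rho>}"
  have "(\<Sum>k\<in>S1. (1 / 2) ^ k * min A (G / \<omega> k) powr (1 / p)) \<le> (\<Sum>k\<in>S1. (1 / 2) ^ k * A powr (1 / p))"
    using pos A G p by (intro sum_mono mult_left_mono powr_mono2) (auto simp: less_imp_le)
  also have "\<dots> = (\<Sum>k\<in>S1. (1 / 2) ^ k) * A powr (1 / p)" by (simp add: sum_distrib_right)
  also have "(\<Sum>k\<in>S1. (1 / 2 :: real) ^ k) \<le> 2 * \<rho> powr \<theta>"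
  proof (cases "S1 = {}")
    case False
    have fin: "finite S1" by (simp add: S1_def)
    have "(\<Sum>k\<in>S1. (1 / 2 :: real) ^ k) \<le> 2 * (1 / 2) ^ Min S1"
      using fin by (intro sum_half_powers_le) auto
    also have "\<dots> \<le> 2 * \<omega> (Min S1) powr \<theta>" using low by simp
    also have "\<dots> \<le> 2 * \<rho> powr \<theta>"
      using Min_in[OF fin False] pos[of "Min S1"] \<theta>(2)
      by (intro mult_left_mono powr_mono2) (auto simp: S1_def less_imp_le)
    finally show ?thesis .
  qed simp
  then have "(\<Sum>k\<in>S1. (1 / 2) ^ k) * A powr (1 / p) \<le> 2 * \<rho> powr \<theta> * A powr (1 / p)"
    by (intro mult_right_mono) auto
  also have "\<dots> = 2 * (G powr \<theta> * A powr (1 / r))"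
  proof -
    have "A powr (1 / p) = A powr \<theta> * A powr (1 / r)"
      by (simp add: \<theta>(1) flip: powr_add)
    then show ?thesis using A G by (simp add: \<rho>_def powr_divide)
  qed
  finally have 1: "(\<Sum>k\<in>S1. (1 / 2) ^ k * min A (G / \<omega> k) powr (1 / p)) \<le> 2 * (G powr \<theta> * A powr (1 / r))" .
  \<comment> \<open>Here the bound \<open>G / \<omega> k\<close> of the minimum is used. The gain
    \<open>\<omega> k powr \<theta>\<close> leaves the power
    \<open>\<theta> - 1 / p = - 1 / r\<close>, which is what the geometric series sums.\<close>
  have "(\<Sum>k\<in>S2. (1 / 2) ^ k * min A (G / \<omega> k) powr (1 / p)) \<le> (\<Sum>k\<in>S2. G powr (1 / p) * \<omega> k powr - (1 / r))"
  proof (rule sum_mono)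
    fix k
    have "min A (G / \<omega> k) powr (1 / p) \<le> (G / \<omega> k) powr (1 / p)"
      using pos[of k] A G p by (intro powr_mono2) auto
    then have "(1 / 2) ^ k * min A (G / \<omega> k) powr (1 / p) \<le> \<omega> k powr \<theta> * (G / \<omega> k) powr (1 / p)"
      using low by (intro mult_mono) auto
    also have "\<dots> = G powr (1 / p) * (\<omega> k powr \<theta> * \<omega> k powr - (1 / p))"
      using pos[of k] G by (simp add: powr_divide powr_minus_divide)
    also have "\<omega> k powr \<theta> * \<omega> k powr - (1 / p) = \<omega> k powr - (1 / r)"
      by (simp add: \<theta>(1) flip: powr_add)
    finally show "(1 / 2) ^ k * min A (G / \<omega> k) powr (1 / p) \<le> G powr (1 / p) * \<omega> k powr - (1 / r)" .
  qed
  also have "\<dots> = G powr (1 / p) * (\<Sum>k\<in>S2. \<omega> k powr - (1 / r))" by (simp add: sum_distrib_left)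
  also have "(\<Sum>k\<in>S2. \<omega> k powr - (1 / r)) \<le> 2 * r * \<rho> powr - (1 / r)"
  proof (cases "S2 = {}")
    case False
    have fin: "finite S2" by (simp add: S2_def)
    have "(\<Sum>k\<in>S2. \<omega> k powr - (1 / r)) \<le> (\<Sum>k\<le>Max S2. \<omega> k powr - (1 / r))"
      using fin by (intro sum_mono2) auto
    also have "\<dots> \<le> 2 * r * \<omega> (Max S2) powr - (1 / r)"
      by (rule geometric_negative_powers[where \<omega>=\<omega>]) (use pos half r in auto)
    also have "\<dots> \<le> 2 * r * \<rho> powr - (1 / r)"
      using Max_in[OF fin False] r \<rho> by (intro mult_left_mono powr_mono2') (auto simp: S2_def)
    finally show ?thesis .
  qed (use r in simp)
  then have "G powr (1 / p) * (\<Sum>k\<in>S2. \<omega> k powr - (1 / r)) \<le> G powr (1 / p) * (2 * r * \<rho> powr - (1 / r))"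
    by (intro mult_left_mono) auto
  also have "\<dots> = 2 * r * (G powr \<theta> * A powr (1 / r))"
  proof -
    have "G powr (1 / p) * G powr - (1 / r) = G powr \<theta>"
      by (simp add: \<theta>(1) flip: powr_add)
    moreover have "\<rho> powr - (1 / r) = G powr - (1 / r) * A powr (1 / r)"
      using A G by (simp add: \<rho>_def powr_divide powr_minus_divide)
    ultimately show ?thesis by simp
  qed
  finally have 2: "(\<Sum>k\<in>S2. (1 / 2) ^ k * min A (G / \<omega> k) powr (1 / p)) \<le> 2 * r * (G powr \<theta> * A powr (1 / r))" .
  have un: "{..<N} = S1 \<union> S2" by (auto simp: S1_def S2_def)
  have "(\<Sum>k<N. (1 / 2) ^ k * min A (G / \<omega> k) powr (1 / p))
    = (\<Sum>k\<in>S1. (1 / 2) ^ k * min A (G / \<omega> k) powr (1 / p)) + (\<Sum>k\<in>S2. (1 / 2) ^ k * min A (G / \<omega> k) powr (1 / p))"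
    unfolding un by (rule sum.union_disjoint) (auto simp: S1_def S2_def)
  with 1 2 show ?thesis by (simp add: distrib_right)
qed

text \<open>\<open>\<omega> k\<close> is the share of the mass of the cube in its generation
  \<open>k\<close> descendant around \<open>x\<close>. The upper bound for children gives halving;
  the lower bound gives a factor of at least \<open>2 powr - (1 / \<theta>)\<close> per generation,
  so the side ratio \<open>(1 / 2) ^ k\<close> is dominated by a power of the mass ratio.\<close>

lemma dyadic_masses:
  fixes w :: "real^'n \<Rightarrow> real"
  assumes w: "almost_constant \<delta> w" and n: "2 \<le> CARD('n)" and d: "0 \<le> \<delta>" "\<delta> \<le> 1 / 4" "2 ^ CARD('n) * \<delta> \<le> 1 / 2"
    and \<theta>: "0 < \<theta>" "2 powr - (1 / \<theta>) \<le> (1 - 2 ^ CARD('n) * \<delta>) / 2 ^ CARD('n)" and l: "0 < l"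
    and \<omega>_def: "\<And>k. \<omega> k = hmean w (dcorner k a l x) (l / 2 ^ k) * (l / 2 ^ k) ^ CARD('n) / (hmean w a l * l ^ CARD('n))"
  shows "0 < \<omega> k" "\<omega> (Suc k) \<le> \<omega> k / 2" "(1 / 2) ^ k \<le> \<omega> k powr \<theta>"
proof -
  let ?n = "CARD('n)"
  have lw: "locally_integrable_borel w" and wp: "\<And>x. 0 < w x" using w by (auto simp: almost_constant_def)
  define W where "W k = hmean w (dcorner k a l x) (l / 2 ^ k) * (l / 2 ^ k) ^ ?n" for k
  have W: "0 < W k" for k
    unfolding W_def using l by (intro mult_pos_pos hmean_pos[OF lw wp]) auto
  have W0: "W 0 = hmean w a l * l ^ ?n" by (simp add: W_def)
  have \<omega>: "\<omega> k = W k / W 0" for k by (simp add: \<omega>_def W_def)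
  show pos: "0 < \<omega> k" for k unfolding \<omega> using W by simp
  have lk: "0 < l / 2 ^ k" for k using l by simp
  have half: "l / 2 ^ k / 2 = l / 2 ^ Suc k" for k by simp
  have up: "W (Suc k) \<le> W k / 2" for k
  proof -
    have "W (Suc k) \<le> (1 / 2 ^ ?n + \<delta>) * W k"
      using almost_constant_child_upper[OF w d(1) lk[of k], unfolded half] unfolding W_def by simp
    \<comment> \<open>The dimension enters here: for \<open>n\<close> at least 2 a child has volume
      share at most 1/4, which leaves 1/4 for \<open>\<delta>\<close>.\<close>
    moreover have "1 / 2 ^ ?n + \<delta> \<le> 1 / 2"
    proof -
      have "1 / 2 ^ ?n \<le> (1 / 2 ^ 2 :: real)"
        using n by (intro divide_left_mono power_increasing) auto
      also have "\<dots> = 1 / 4" by simp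
      finally show ?thesis using d(2) by linarith
    qed
    then have "(1 / 2 ^ ?n + \<delta>) * W k \<le> 1 / 2 * W k"
      using W[of k] by (intro mult_right_mono) auto
    ultimately show ?thesis by linarith
  qed
  then show "\<omega> (Suc k) \<le> \<omega> k / 2" for k unfolding \<omega> using W[of 0] up[of k] by (simp add: divide_simps)
  have down: "(1 - 2 ^ ?n * \<delta>) / 2 ^ ?n * W k \<le> W (Suc k)" for k
  proof -
    have "(1 - 2 ^ ?n * \<delta>) * hmean w (dcorner k a l x) (l / 2 ^ k) * (l / 2 ^ Suc k) ^ ?n \<le> W (Suc k)"
      unfolding W_def dcorner.simps using almost_constant_child_lower[OF w d(1) lk[of k], unfolded half] l
      by (intro mult_right_mono) auto
    moreover have "(l / 2 ^ Suc k) ^ ?n = (l / 2 ^ k) ^ ?n / 2 ^ ?n"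
      by (simp add: power_divide power_mult_distrib mult.commute)
    ultimately show ?thesis unfolding W_def by simp
  qed
  have "(2 powr - (1 / \<theta>)) ^ k \<le> W k / W 0"
  proof (induction k)
    case 0
    then show ?case using W[of 0] by simp
  next
    case (Suc k)
    have "(2 powr - (1 / \<theta>)) ^ Suc k \<le> 2 powr - (1 / \<theta>) * (W k / W 0)"
      unfolding power_Suc by (rule mult_left_mono[OF Suc]) simp
    also have "\<dots> \<le> (1 - 2 ^ ?n * \<delta>) / 2 ^ ?n * (W k / W 0)"
      using \<theta> W[of k] W[of 0] by (intro mult_right_mono) (auto intro!: divide_nonneg_pos simp: less_imp_le)
    also have "\<dots> \<le> W (Suc k) / W 0"
      using down[of k] W[of 0] by (simp add: divide_le_cancel divide_simps)
    finally show ?case .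
  qed
  then have "((2 powr - (1 / \<theta>)) ^ k) powr \<theta> \<le> \<omega> k powr \<theta>"
    unfolding \<omega> using \<theta> by (intro powr_mono2) auto
  moreover have "((2 powr - (1 / \<theta>)) ^ k) powr \<theta> = (1 / 2 :: real) ^ k"
  proof -
    have "((2 powr - (1 / \<theta>)) ^ k) powr \<theta> = (2::real) powr (- (1 / \<theta>) * real k * \<theta>)"
      by (simp add: powr_powr flip: powr_realpow)
    also have "- (1 / \<theta>) * real k * \<theta> = - real k" using \<theta> by simp
    also have "(2::real) powr - real k = (1 / 2) ^ k"
      by (simp add: powr_minus_divide powr_realpow power_one_over)
    finally show ?thesis .
  qed
  ultimately show "(1 / 2) ^ k \<le> \<omega> k powr \<theta>" by simp
qed

text \<open>Off the set where the dyadic maximal function of \<open>F powr p\<close> with respect to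
  \<open>w\<close> reaches the level \<open>A\<close>, telescoping and \<open>hedberg_sum\<close>
  bound the deviation of every dyadic mean by \<open>t\<close>. By Lebesgue points the set on the
  left is therefore contained, up to a null set, in the bad set, whose mass is at most
  \<open>G / A\<close> times the mass of the cube.\<close>

lemma weak_type_estimate:
  fixes w u F :: "real^'n \<Rightarrow> real"
  assumes w: "almost_constant \<delta> w" and n: "2 \<le> CARD('n)" and d: "0 \<le> \<delta>" "\<delta> \<le> 1 / 4" "2 ^ CARD('n) * \<delta> \<le> 1 / 2"
    and \<theta>: "0 < \<theta>" "2 powr - (1 / \<theta>) \<le> (1 - 2 ^ CARD('n) * \<delta>) / 2 ^ CARD('n)"
    and p: "1 < p" and small: "4 * \<delta> * 4 powr (1 / (p - 1)) \<le> 1"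
    and r: "1 \<le> r" "\<theta> = 1 / p - 1 / r"
    and u: "locally_integrable_borel u"
    and F: "F \<in> borel_measurable borel" "\<And>x. 0 \<le> F x"
    and C: "0 < C"
    and poincare: "\<And>c m B. 0 < m \<Longrightarrow> ennreal (\<bar>hmean u (subcorner c m B) (m / 2) - hmean u c m\<bar> * m ^ CARD('n))
        \<le> ennreal (C * m) * (\<integral>\<^sup>+x\<in>hcube c m. ennreal (F x) \<partial>lborel)"
    and l: "0 < l" and G: "0 < G"
    and le: "(\<integral>\<^sup>+x\<in>hcube a l. ennreal (F x powr p * w x) \<partial>lborel) \<le> ennreal (G * (hmean w a l * l ^ CARD('n)))"
    and t: "0 < t"
  shows "(\<integral>\<^sup>+x\<in>{x \<in> hcube a l. t < \<bar>u x - hmean u a l\<bar>}. ennreal (w x) \<partial>lborel)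
    \<le> ennreal ((6 * C * l * (2 + 2 * r) * G powr (1 / p) / t) powr r * (hmean w a l * l ^ CARD('n)))"
proof -
  let ?n = "CARD('n)"
  have lw: "locally_integrable_borel w" and wp: "\<And>x. 0 < w x" using w by (auto simp: almost_constant_def)
  have [measurable]: "w \<in> borel_measurable borel" "F \<in> borel_measurable borel" "u \<in> borel_measurable borel"
    using lw u F by measurable
  define W where "W c m = hmean w c m * m ^ ?n" for c m
  have Wpos: "0 < W c m" if "0 < m" for c m
    unfolding W_def using that by (intro mult_pos_pos hmean_pos[OF lw wp]) auto
  have Wint: "(\<integral>\<^sup>+x\<in>hcube c m. ennreal (w x) \<partial>lborel) = ennreal (W c m)" if "0 < m" for c m
    unfolding W_def by (rule nn_integral_hcube_eq[OF lw less_imp_le[OF wp] that])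
  define D where "D = 6 * C * l * (2 + 2 * r)"
  have D: "0 < D" using C l r by (simp add: D_def)
  \<comment> \<open>The level at which the bound from \<open>hedberg_sum\<close>, multiplied by
    \<open>6 * C * l\<close>, is exactly \<open>t\<close>.\<close>
  define A where "A = (t / (D * G powr \<theta>)) powr r"
  have A: "0 < A" using t D G by (simp add: A_def)
  have tA: "D * (G powr \<theta> * A powr (1 / r)) = t"
    using t D G r by (simp add: A_def powr_powr)
  define P where "P c m \<longleftrightarrow> ennreal A * (\<integral>\<^sup>+x\<in>hcube c m. ennreal (w x) \<partial>lborel)
    \<le> (\<integral>\<^sup>+x\<in>hcube c m. ennreal (F x powr p * w x) \<partial>lborel)" for c m
  have weak: "ennreal A * (\<integral>\<^sup>+x\<in>(\<Union>N. dbad P N a l). ennreal (w x) \<partial>lborel)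
      \<le> (\<integral>\<^sup>+x\<in>hcube a l. ennreal (F x powr p * w x) \<partial>lborel)"
    by (rule dyadic_maximal_weak_type[OF _ _ l]) (auto simp: P_def)
  have good: "\<bar>hmean u (dcorner N a l x) (l / 2 ^ N) - hmean u a l\<bar> \<le> t"
    if x: "x \<in> hcube a l" and nb: "x \<notin> (\<Union>N. dbad P N a l)" for x N
  proof -
    define \<omega> where "\<omega> k = W (dcorner k a l x) (l / 2 ^ k) / W a l" for k
    have \<omega>: "0 < \<omega> k" "\<omega> (Suc k) \<le> \<omega> k / 2" "(1 / 2) ^ k \<le> \<omega> k powr \<theta>" for k
      by (rule dyadic_masses[OF w n d \<theta> l, of \<omega> a x], simp add: \<omega>_def W_def)+
    \<comment> \<open>Two bounds for the weighted mean of \<open>F powr p\<close> on the generation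
      \<open>k\<close> cube: \<open>A\<close>, since that cube is not bad, and
      \<open>G / \<omega> k\<close>, by enlarging the domain of integration to the whole
      cube.\<close>
    define T where "T k = min A (G / \<omega> k)" for k
    have T: "0 < T k" for k using A G \<omega>(1) by (simp add: T_def)
    have step: "\<bar>hmean u (dcorner (Suc k) a l x) (l / 2 ^ Suc k) - hmean u (dcorner k a l x) (l / 2 ^ k)\<bar>
        \<le> 6 * C * l * ((1 / 2) ^ k * T k powr (1 / p))" for k
    proof -
      let ?c = "dcorner k a l x" and ?m = "l / 2 ^ k"
      have m: "0 < ?m" using l by simp
      have "\<not> P ?c ?m" using x nb by (auto simp: dbad_def)
      then have 1: "(\<integral>\<^sup>+x\<in>hcube ?c ?m. ennreal (F x powr p * w x) \<partial>lborel) \<le> ennreal (A * W ?c ?m)"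
        unfolding P_def Wint[OF m] using A Wpos[OF m, of ?c] by (simp add: ennreal_mult not_le less_imp_le)
      have "(\<integral>\<^sup>+x\<in>hcube ?c ?m. ennreal (F x powr p * w x) \<partial>lborel) \<le> (\<integral>\<^sup>+x\<in>hcube a l. ennreal (F x powr p * w x) \<partial>lborel)"
        using hcube_dcorner_subset[OF l, of k a x] by (intro nn_integral_mono) (auto simp: indicator_def)
      also have "\<dots> \<le> ennreal (G * W a l)" using le by (simp add: W_def)
      also have "G * W a l = G / \<omega> k * W ?c ?m"
        using Wpos[OF l, of a] Wpos[OF m, of ?c] by (simp add: \<omega>_def)
      finally have 2: "(\<integral>\<^sup>+x\<in>hcube ?c ?m. ennreal (F x powr p * w x) \<partial>lborel) \<le> ennreal (G / \<omega> k * W ?c ?m)" .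
      have "(\<integral>\<^sup>+x\<in>hcube ?c ?m. ennreal (F x powr p * w x) \<partial>lborel) \<le> ennreal (T k * (hmean w ?c ?m * ?m ^ ?n))"
        using 1 2 unfolding T_def W_def[symmetric] by (simp add: min_def)
      from mean_le_weighted_mean[OF w d(1,3) p small m F T this]
      have 3: "(\<integral>\<^sup>+x\<in>hcube ?c ?m. ennreal (F x) \<partial>lborel) \<le> ennreal (6 * T k powr (1 / p) * ?m ^ ?n)" .
      let ?B = "upper_half ?c ?m x"
      have "ennreal (\<bar>hmean u (subcorner ?c ?m ?B) (?m / 2) - hmean u ?c ?m\<bar> * ?m ^ ?n)
          \<le> ennreal (C * ?m) * ennreal (6 * T k powr (1 / p) * ?m ^ ?n)"
        by (rule order_trans[OF poincare[OF m] mult_left_mono[OF 3]]) simp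
      also have "\<dots> = ennreal (C * ?m * (6 * T k powr (1 / p)) * ?m ^ ?n)"
        using C l by (subst ennreal_mult[symmetric]) (auto simp: mult_ac)
      finally have "\<bar>hmean u (subcorner ?c ?m ?B) (?m / 2) - hmean u ?c ?m\<bar> * ?m ^ ?n \<le> C * ?m * (6 * T k powr (1 / p)) * ?m ^ ?n"
        using C l by (subst (asm) ennreal_le_iff) auto
      then have "\<bar>hmean u (subcorner ?c ?m ?B) (?m / 2) - hmean u ?c ?m\<bar> \<le> C * ?m * (6 * T k powr (1 / p))"
        using m by (rule mult_right_le_imp_le[OF _ zero_less_power])
      moreover have "?m / 2 = l / 2 ^ Suc k" by simp
      moreover have "C * ?m * (6 * T k powr (1 / p)) = 6 * C * l * ((1 / 2) ^ k * T k powr (1 / p))"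
        by (simp add: power_one_over)
      ultimately show ?thesis by (simp only: dcorner.simps)
    qed
    have "\<bar>hmean u (dcorner N a l x) (l / 2 ^ N) - hmean u a l\<bar> \<le> (\<Sum>k<N. 6 * C * l * ((1 / 2) ^ k * T k powr (1 / p)))"
    proof (induction N)
      case (Suc N)
      then show ?case using step[of N] unfolding sum.lessThan_Suc by linarith
    qed simp
    also have "\<dots> = 6 * C * l * (\<Sum>k<N. (1 / 2) ^ k * T k powr (1 / p))" by (simp add: sum_distrib_left)
    also have "\<dots> \<le> 6 * C * l * ((2 + 2 * r) * (G powr \<theta> * A powr (1 / r)))"
      unfolding T_def using \<omega> C l p r \<theta> A G by (intro mult_left_mono hedberg_sum) auto
    also have "\<dots> = t" using tA by (simp add: D_def)
    finally show ?thesis .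
  qed
  obtain s :: "nat \<Rightarrow> nat" where s:
    "AE x in lborel. x \<in> hcube a l \<longrightarrow> (\<lambda>k. hmean u (dcorner (s k) a l x) (l / 2 ^ s k)) \<longlonglongrightarrow> u x"
    by (rule dyadic_mean_AE_subseq[OF u l])
  have "AE x in lborel. x \<in> {x \<in> hcube a l. t < \<bar>u x - hmean u a l\<bar>} \<longrightarrow> x \<in> (\<Union>N. dbad P N a l)"
    using s
  proof eventually_elim
    case (elim x)
    show ?case
    proof (rule impI, rule ccontr)
      assume x: "x \<in> {x \<in> hcube a l. t < \<bar>u x - hmean u a l\<bar>}" and nb: "x \<notin> (\<Union>N. dbad P N a l)"
      then have lim: "(\<lambda>k. \<bar>hmean u (dcorner (s k) a l x) (l / 2 ^ s k) - hmean u a l\<bar>) \<longlonglongrightarrow> \<bar>u x - hmean u a l\<bar>"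
        using elim by (intro tendsto_rabs tendsto_diff tendsto_const) auto
      have "\<bar>u x - hmean u a l\<bar> \<le> t"
        by (rule LIMSEQ_le_const2[OF lim]) (use good[OF _ nb] x in auto)
      with x show False by simp
    qed
  qed
  then have "(\<integral>\<^sup>+x\<in>{x \<in> hcube a l. t < \<bar>u x - hmean u a l\<bar>}. ennreal (w x) \<partial>lborel)
      \<le> (\<integral>\<^sup>+x\<in>(\<Union>N. dbad P N a l). ennreal (w x) \<partial>lborel)" (is "?L \<le> ?R")
    by (intro nn_integral_mono_AE) (auto simp: indicator_def)
  moreover have "?R = ennreal (1 / A) * (ennreal A * ?R)"
    using A by (simp add: mult.assoc[symmetric] flip: ennreal_mult)
  ultimately have "?L \<le> ennreal (1 / A) * (ennreal A * ?R)" by simp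
  also have "\<dots> \<le> ennreal (1 / A) * ennreal (G * W a l)"
    using weak le by (intro mult_left_mono) (auto simp: W_def intro: order_trans)
  also have "\<dots> = ennreal (G / A * W a l)"
    using A G Wpos[OF l, of a] by (subst ennreal_mult[symmetric]) auto
  \<comment> \<open>With \<open>G\<close> written as an \<open>r\<close>-th power, the exponents
    \<open>1 / r\<close> and \<open>\<theta>\<close> of \<open>G\<close> add up to
    \<open>1 / p\<close>.\<close>
  also have "G / A = (D * G powr (1 / p) / t) powr r"
  proof -
    have "G = G powr (1 / r * r)" using r G by simp
    then have G1: "G = (G powr (1 / r)) powr r" by (simp only: powr_powr)
    have "G / A = (G powr (1 / r) * (D * G powr \<theta> / t)) powr r"
      using G D t by (subst G1) (simp add: A_def powr_divide powr_mult)
    also have "G powr (1 / r) * (D * G powr \<theta> / t) = D * G powr (1 / p) / t"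
      by (simp add: r(2) flip: powr_add)
    finally show ?thesis .
  qed
  finally show ?thesis by (simp add: D_def W_def)
qed

subsection \<open>Truncation\<close>

lemma nn_integral_cbox_eq_hcube:
  fixes a :: "real^'n"
  assumes "0 < l"
  shows "(\<integral>\<^sup>+x\<in>cbox a (a + vec l). F x \<partial>lborel) = (\<integral>\<^sup>+x\<in>hcube a l. F x \<partial>lborel)"
  by (rule nn_integral_cong_AE, rule eventually_mono[OF AE_hcube_iff_cbox[OF assms, of a]]) (simp add: indicator_def)

lemma hmean_minus_const_le:
  fixes u :: "real^'n \<Rightarrow> real"
  assumes u: "locally_integrable_borel u" and m: "0 < m"
  shows "ennreal (\<bar>hmean u c m - k\<bar> * m ^ CARD('n)) \<le> (\<integral>\<^sup>+x\<in>hcube c m. ennreal \<bar>u x - k\<bar> \<partial>lborel)"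
proof -
  let ?n = "CARD('n)"
  have si: "set_integrable lborel (hcube c m) u" by (rule locally_integrable_borel_hcube[OF u])
  note ck = set_integral_const_hcube[of "hcube c m" c m k, OF _ order_refl m]
  have "(hmean u c m - k) * m ^ ?n = (LINT x:hcube c m|lborel. u x - k)"
    using m set_integral_diff(2)[OF si ck(1)] ck(2)
    by (simp add: measure_hcube hmean_def left_diff_distrib)
  then have "ennreal (\<bar>hmean u c m - k\<bar> * m ^ ?n) = ennreal (norm (LINT x:hcube c m|lborel. u x - k))"
    using m by (metis abs_mult abs_of_pos real_norm_def zero_less_power)
  also have "\<dots> \<le> (\<integral>\<^sup>+x. ennreal (norm (indicator (hcube c m) x *\<^sub>R (u x - k))) \<partial>lborel)"
    unfolding set_lebesgue_integral_def using set_integral_diff(1)[OF si ck(1)]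
    by (intro integral_norm_bound_ennreal) (auto simp: set_integrable_def)
  also have "\<dots> = (\<integral>\<^sup>+x\<in>hcube c m. ennreal \<bar>u x - k\<bar> \<partial>lborel)"
    by (intro nn_integral_cong) (simp add: indicator_def)
  finally show ?thesis .
qed

text \<open>The mean is compared with \<open>u x\<close> by averaging over \<open>y\<close> in the
  cube. Letting \<open>S\<close> be any subset makes the same double integral serve the cube and
  each of its children.\<close>

lemma mean_deviation_le_double_integral:
  fixes u :: "real^'n \<Rightarrow> real"
  assumes u: "locally_integrable_borel u" and m: "0 < m" and S: "S \<subseteq> hcube c m"
  shows "ennreal (m ^ CARD('n)) * (\<integral>\<^sup>+x\<in>S. ennreal \<bar>u x - hmean u c m\<bar> \<partial>lborel)
    \<le> (\<integral>\<^sup>+x\<in>hcube c m. (\<integral>\<^sup>+y\<in>hcube c m. ennreal \<bar>u y - u x\<bar> \<partial>lborel) \<partial>lborel)"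
proof -
  have [measurable]: "u \<in> borel_measurable borel" using u by measurable
  have "ennreal (m ^ CARD('n)) * (\<integral>\<^sup>+x\<in>S. ennreal \<bar>u x - hmean u c m\<bar> \<partial>lborel)
    \<le> ennreal (m ^ CARD('n)) * (\<integral>\<^sup>+x\<in>hcube c m. ennreal \<bar>u x - hmean u c m\<bar> \<partial>lborel)"
    using S by (intro mult_left_mono nn_integral_mono) (auto simp: indicator_def)
  also have "\<dots> = (\<integral>\<^sup>+x. ennreal (m ^ CARD('n)) * (ennreal \<bar>u x - hmean u c m\<bar> * indicator (hcube c m) x) \<partial>lborel)"
    by (rule nn_integral_cmult[symmetric]) measurable
  also have "\<dots> \<le> (\<integral>\<^sup>+x\<in>hcube c m. (\<integral>\<^sup>+y\<in>hcube c m. ennreal \<bar>u y - u x\<bar> \<partial>lborel) \<partial>lborel)"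
  proof (rule nn_integral_mono)
    fix x
    have "ennreal (m ^ CARD('n)) * ennreal \<bar>u x - hmean u c m\<bar> = ennreal (\<bar>hmean u c m - u x\<bar> * m ^ CARD('n))"
      using m by (simp add: ennreal_mult[symmetric] mult.commute abs_minus_commute)
    also have "\<dots> \<le> (\<integral>\<^sup>+y\<in>hcube c m. ennreal \<bar>u y - u x\<bar> \<partial>lborel)"
      by (rule hmean_minus_const_le[OF u m])
    finally show "ennreal (m ^ CARD('n)) * (ennreal \<bar>u x - hmean u c m\<bar> * indicator (hcube c m) x)
       \<le> (\<integral>\<^sup>+y\<in>hcube c m. ennreal \<bar>u y - u x\<bar> \<partial>lborel) * indicator (hcube c m) x"
      by (simp add: indicator_def)
  qed
  finally show ?thesis .
qed

lemma ennreal_cancel_factor: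
  assumes "0 < v" "0 \<le> K" "ennreal v * X \<le> ennreal (K * v) * Y"
  shows "X \<le> ennreal K * Y"
proof -
  have "ennreal (1 / v) * (ennreal v * X) \<le> ennreal (1 / v) * (ennreal (K * v) * Y)"
    using assms(3) by (rule mult_left_mono) simp
  moreover have "ennreal (1 / v) * (ennreal v * X) = X"
    using assms(1) by (simp add: mult.assoc[symmetric] flip: ennreal_mult)
  moreover have "ennreal (1 / v) * (ennreal (K * v) * Y) = ennreal K * Y"
    using assms by (simp add: mult.assoc[symmetric] flip: ennreal_mult)
  ultimately show ?thesis by simp
qed

text \<open>The first estimate drives the telescoping, the second controls the distance from the
  mean in \<open>L^1\<close>. The constant grows from \<open>2 ^ n\<close> to \<open>4 ^ n\<close>
  because the deviation over a child is divided by the volume of the child.\<close>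

lemma poincare_child:
  fixes f :: "real^'n \<Rightarrow> real" and g :: "'n \<Rightarrow> real^'n \<Rightarrow> real" and m :: real
  assumes fg: "weak_gradient_borel f g"
    and H: "\<And>s. (H has_real_derivative h s) (at s)" "continuous_on UNIV h" and Bh: "\<And>s. \<bar>h s\<bar> \<le> Bh"
    and u: "locally_integrable_borel (\<lambda>x. H (f x))" and m: "0 < m"
  shows "ennreal (\<bar>hmean (\<lambda>x. H (f x)) (subcorner c m B) (m / 2) - hmean (\<lambda>x. H (f x)) c m\<bar> * m ^ CARD('n))
    \<le> ennreal (4 ^ CARD('n) * real CARD('n) * m) * (\<integral>\<^sup>+z\<in>hcube c m. ennreal (\<bar>h (f z)\<bar> * norm (\<chi> i. g i z)) \<partial>lborel)"
    (is "?l \<le> _")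
    and "(\<integral>\<^sup>+x\<in>hcube c m. ennreal \<bar>H (f x) - hmean (\<lambda>x. H (f x)) c m\<bar> \<partial>lborel)
    \<le> ennreal (2 ^ CARD('n) * real CARD('n) * m) * (\<integral>\<^sup>+z\<in>hcube c m. ennreal (\<bar>h (f z)\<bar> * norm (\<chi> i. g i z)) \<partial>lborel)"
proof -
  let ?n = "CARD('n)" and ?u = "\<lambda>x. H (f x)" and ?R = "hcube (subcorner c m B) (m / 2)"
  let ?I = "\<integral>\<^sup>+z\<in>hcube c m. ennreal (\<bar>h (f z)\<bar> * norm (\<chi> i. g i z)) \<partial>lborel"
  define K where "K = 2 ^ ?n * real ?n * m"
  have K: "0 \<le> K" using m by (simp add: K_def)
  have V: "0 < m ^ ?n" using m by simp
  have e: "2 ^ ?n * real ?n * m * m ^ ?n = K * m ^ ?n" by (simp add: K_def)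
  have D: "(\<integral>\<^sup>+x\<in>hcube c m. (\<integral>\<^sup>+y\<in>hcube c m. ennreal \<bar>?u y - ?u x\<bar> \<partial>lborel) \<partial>lborel)
      \<le> ennreal (K * m ^ ?n) * ?I"
    using poincare_composed[where H=H and h=h, OF fg H Bh m, of c]
    by (simp only: nn_integral_cbox_eq_hcube[OF m] of_nat_mult of_nat_power of_nat_numeral e)
  have "(\<integral>\<^sup>+x\<in>hcube c m. ennreal \<bar>?u x - hmean ?u c m\<bar> \<partial>lborel) \<le> ennreal K * ?I"
    by (rule ennreal_cancel_factor[OF V K order_trans[OF mean_deviation_le_double_integral[OF u m order_refl] D]])
  then show "(\<integral>\<^sup>+x\<in>hcube c m. ennreal \<bar>?u x - hmean ?u c m\<bar> \<partial>lborel)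
      \<le> ennreal (2 ^ ?n * real ?n * m) * ?I" by (simp only: K_def)
  have m2: "0 < m / 2" using m by simp
  have "ennreal (m ^ ?n) * ennreal (\<bar>hmean ?u (subcorner c m B) (m / 2) - hmean ?u c m\<bar> * (m / 2) ^ ?n)
      \<le> ennreal (m ^ ?n) * (\<integral>\<^sup>+x\<in>?R. ennreal \<bar>?u x - hmean ?u c m\<bar> \<partial>lborel)"
    by (rule mult_left_mono[OF hmean_minus_const_le[OF u m2]]) simp
  also have "\<dots> \<le> ennreal (K * m ^ ?n) * ?I"
    by (rule order_trans[OF mean_deviation_le_double_integral[OF u m hcube_subcorner_subset[OF m]] D])
  finally have 1: "ennreal (\<bar>hmean ?u (subcorner c m B) (m / 2) - hmean ?u c m\<bar> * (m / 2) ^ ?n) \<le> ennreal K * ?I"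
    by (rule ennreal_cancel_factor[OF V K])
  define X where "X = \<bar>hmean ?u (subcorner c m B) (m / 2) - hmean ?u c m\<bar>"
  have "X * m ^ ?n = 2 ^ ?n * (X * (m / 2) ^ ?n)" by (simp add: power_divide)
  then have "ennreal (X * m ^ ?n) = ennreal (2 ^ ?n) * ennreal (X * (m / 2) ^ ?n)"
    using m by (simp only:) (intro ennreal_mult, auto simp: X_def)
  also have "\<dots> \<le> ennreal (2 ^ ?n) * (ennreal K * ?I)"
    unfolding X_def by (rule mult_left_mono[OF 1]) simp
  also have "\<dots> = ennreal (2 ^ ?n * K) * ?I"
    using K by (simp only: ennreal_mult mult.assoc zero_le_power zero_le_numeral)
  also have "2 ^ ?n * K = 4 ^ ?n * real ?n * m"
    using power_mult_distrib[of "2::real" 2 ?n] by (simp add: K_def)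
  finally show "?l \<le> ennreal (4 ^ ?n * real ?n * m) * ?I" unfolding X_def .
qed

text \<open>A quadratic spline that rises from 0 to 1 on the unit interval; \<open>tent\<close> is
  its derivative, with peak value 2 at the midpoint. It is continuously differentiable, as
  \<open>poincare_composed\<close> requires, which a piecewise linear truncation is not.\<close>

definition step_spline :: "real \<Rightarrow> real" where
  "step_spline x = 2 * ((max 0 x)\<^sup>2 - 2 * (max 0 (x - 1 / 2))\<^sup>2 + (max 0 (x - 1))\<^sup>2)"

definition tent :: "real \<Rightarrow> real" where
  "tent x = 4 * (max 0 x - 2 * max 0 (x - 1 / 2) + max 0 (x - 1))"

lemma pos_part_square_has_derivative:
  "((\<lambda>x. (max 0 x)\<^sup>2) has_real_derivative 2 * max 0 x) (at (x::real))"
proof (cases "x = 0")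
  case True
  have "((\<lambda>h. ((max 0 (0 + h))\<^sup>2 - (max 0 0)\<^sup>2) / h) \<longlongrightarrow> 0) (at (0::real))"
  proof (rule Lim_transform_eventually)
    have "((\<lambda>h. max 0 h) \<longlongrightarrow> max 0 0) (at (0::real))" by (intro tendsto_intros)
    then show "((\<lambda>h. max 0 h) \<longlongrightarrow> 0) (at (0::real))" by simp
    show "\<forall>\<^sub>F h in at (0::real). max 0 h = ((max 0 (0 + h))\<^sup>2 - (max 0 0)\<^sup>2) / h"
      by (auto simp: eventually_at_filter max_def power2_eq_square)
  qed
  then show ?thesis using True by (simp add: DERIV_def)
next
  case False
  show ?thesis
  proof (cases "0 < x")
    case True
    have "((\<lambda>x. x\<^sup>2) has_real_derivative 2 * max 0 x) (at x)"
      using True by (auto intro!: derivative_eq_intros)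
    then show ?thesis
      by (rule has_field_derivative_transform_within_open[of _ _ _ "{0<..}"]) (use True in auto)
  next
    case False
    have "((\<lambda>x. 0) has_real_derivative 2 * max 0 x) (at x)" using False by simp
    then show ?thesis
      by (rule has_field_derivative_transform_within_open[of _ _ _ "{..<0}"]) (use False \<open>x \<noteq> 0\<close> in auto)
  qed
qed

lemma step_spline_has_derivative: "(step_spline has_real_derivative tent x) (at x)"
proof -
  have s: "((\<lambda>x. (max 0 (x - c))\<^sup>2) has_real_derivative 2 * max 0 (x - c)) (at x)" for c
  proof -
    have "((\<lambda>x. x - c) has_real_derivative 1) (at x)" by (auto intro!: derivative_eq_intros)
    from DERIV_chain2[where f="\<lambda>x. (max 0 x)\<^sup>2", OF pos_part_square_has_derivative this]
    show ?thesis by simp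
  qed
  have "(step_spline has_real_derivative 2 * (2 * max 0 x - 2 * (2 * max 0 (x - 1 / 2)) + 2 * max 0 (x - 1))) (at x)"
    unfolding step_spline_def
    by (intro DERIV_cmult DERIV_add DERIV_diff s pos_part_square_has_derivative)
  then show ?thesis by (simp add: tent_def algebra_simps)
qed

lemma tent_continuous: "continuous_on UNIV tent"
  unfolding tent_def by (intro continuous_intros)

lemma tent_bounds: "0 \<le> tent x" "tent x \<le> 2"
  by (auto simp: tent_def max_def)

lemma tent_support: "tent x \<noteq> 0 \<Longrightarrow> 0 < x \<and> x < 1"
  by (auto simp: tent_def max_def split: if_splits)

lemma step_spline_nonpos: "x \<le> 0 \<Longrightarrow> step_spline x = 0"
  by (simp add: step_spline_def max_def)

lemma step_spline_ge_1: "1 \<le> x \<Longrightarrow> step_spline x = 1"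
  by (simp add: step_spline_def max_def power2_eq_square algebra_simps)

lemma step_spline_mono: "x \<le> y \<Longrightarrow> step_spline x \<le> step_spline y"
  by (rule DERIV_nonneg_imp_nondecreasing) (use step_spline_has_derivative tent_bounds in blast)+

lemma step_spline_bounds: "0 \<le> step_spline x" "step_spline x \<le> 1"
  using step_spline_mono[of "min x 0" x] step_spline_nonpos[of "min x 0"]
    step_spline_mono[of x "max x 1"] step_spline_ge_1[of "max x 1"] by auto

text \<open>A smoothed form of \<open>min a (max 0 (\<bar>s - c\<bar> - a))\<close>: zero up to
  distance \<open>a\<close> from \<open>c\<close>, equal to \<open>a\<close> from distance
  \<open>2 * a\<close> on. The two summands treat the two sides of \<open>c\<close>, and at most one
  of them is nonzero.\<close>

definition trunc :: "real \<Rightarrow> real \<Rightarrow> real \<Rightarrow> real" where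
  "trunc a c s = a * step_spline ((s - c - a) / a) + a * step_spline ((c - s - a) / a)"

definition trunc_deriv :: "real \<Rightarrow> real \<Rightarrow> real \<Rightarrow> real" where
  "trunc_deriv a c s = tent ((s - c - a) / a) - tent ((c - s - a) / a)"

context
  fixes a :: real
  assumes a: "0 < a"
begin

lemma trunc_has_derivative: "(trunc a c has_real_derivative trunc_deriv a c s) (at s)"
proof -
  have "((\<lambda>s. (s - c - a) / a) has_real_derivative 1 / a) (at s)" "((\<lambda>s. (c - s - a) / a) has_real_derivative - 1 / a) (at s)"
    using a by (auto intro!: derivative_eq_intros)
  from this[THEN DERIV_chain2[OF step_spline_has_derivative]]
  have "(trunc a c has_real_derivative a * (tent ((s - c - a) / a) * (1 / a)) + a * (tent ((c - s - a) / a) * (- 1 / a))) (at s)"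
    unfolding trunc_def by (intro DERIV_add DERIV_cmult)
  then show ?thesis using a by (simp add: trunc_deriv_def)
qed

lemma trunc_deriv_continuous: "continuous_on UNIV (trunc_deriv a c)"
  unfolding trunc_deriv_def using a
  by (intro continuous_intros continuous_on_compose2[OF tent_continuous]) auto

lemma trunc_deriv_bound: "\<bar>trunc_deriv a c s\<bar> \<le> 2"
  using tent_bounds[of "(s - c - a) / a"] tent_bounds[of "(c - s - a) / a"] by (simp add: trunc_deriv_def abs_le_iff)

lemma trunc_deriv_support: "trunc_deriv a c s \<noteq> 0 \<Longrightarrow> a < \<bar>s - c\<bar> \<and> \<bar>s - c\<bar> < 2 * a"
proof -
  assume "trunc_deriv a c s \<noteq> 0"
  then have "tent ((s - c - a) / a) \<noteq> 0 \<or> tent ((c - s - a) / a) \<noteq> 0" by (auto simp: trunc_deriv_def)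
  then have "(0 < (s - c - a) / a \<and> (s - c - a) / a < 1) \<or> (0 < (c - s - a) / a \<and> (c - s - a) / a < 1)"
    using tent_support by blast
  then show ?thesis using a by (auto simp: divide_simps split: if_splits)
qed

lemma trunc_nonneg: "0 \<le> trunc a c s"
  using a step_spline_bounds by (simp add: trunc_def)

lemma trunc_le: "trunc a c s \<le> a" "trunc a c s \<le> \<bar>s - c\<bar>"
proof -
  consider "\<bar>s - c\<bar> \<le> a" | "a < s - c" | "a < c - s" by linarith
  then have "trunc a c s \<le> a \<and> trunc a c s \<le> \<bar>s - c\<bar>"
  proof cases
    case 1
    then have "(s - c - a) / a \<le> 0" "(c - s - a) / a \<le> 0" using a by (auto simp: divide_le_0_iff)
    then show ?thesis using a by (simp add: trunc_def step_spline_nonpos)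
  next
    case 2
    then have "(c - s - a) / a \<le> 0" using a by (auto simp: divide_le_0_iff)
    then have "trunc a c s = a * step_spline ((s - c - a) / a)" by (simp add: trunc_def step_spline_nonpos)
    also have "\<dots> \<le> a * 1" using a step_spline_bounds by (intro mult_left_mono) auto
    finally show ?thesis using 2 a by simp
  next
    case 3
    then have "(s - c - a) / a \<le> 0" using a by (auto simp: divide_le_0_iff)
    then have "trunc a c s = a * step_spline ((c - s - a) / a)" by (simp add: trunc_def step_spline_nonpos)
    also have "\<dots> \<le> a * 1" using a step_spline_bounds by (intro mult_left_mono) auto
    finally show ?thesis using 3 a by simp
  qed
  then show "trunc a c s \<le> a" "trunc a c s \<le> \<bar>s - c\<bar>" by auto
qed

lemma trunc_eq: "2 * a \<le> \<bar>s - c\<bar> \<Longrightarrow> trunc a c s = a"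
proof -
  assume h: "2 * a \<le> \<bar>s - c\<bar>"
  consider "2 * a \<le> s - c" | "2 * a \<le> c - s" using h by linarith
  then show ?thesis
  proof cases
    case 1
    then have "(c - s - a) / a \<le> 0" "1 \<le> (s - c - a) / a" using a by (auto simp: divide_le_0_iff le_divide_eq)
    then show ?thesis by (simp add: trunc_def step_spline_nonpos step_spline_ge_1)
  next
    case 2
    then have "(s - c - a) / a \<le> 0" "1 \<le> (c - s - a) / a" using a by (auto simp: divide_le_0_iff le_divide_eq)
    then show ?thesis by (simp add: trunc_def step_spline_nonpos step_spline_ge_1)
  qed
qed

end

lemma locally_integrable_borel_bounded:
  fixes u :: "real^'n \<Rightarrow> real"
  assumes "u \<in> borel_measurable borel" "\<And>x. \<bar>u x\<bar> \<le> B"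
  shows "locally_integrable_borel u"
  unfolding locally_integrable_borel_def set_integrable_def
proof (intro conjI allI)
  fix a b :: "real^'n"
  have [measurable]: "u \<in> borel_measurable borel" by fact
  have "integrable lborel (\<lambda>x. indicator (cbox a b) x *\<^sub>R B)"
    using const_locally_integrable_borel[of B] unfolding locally_integrable_borel_def set_integrable_def by blast
  then show "integrable lborel (\<lambda>x. indicator (cbox a b) x *\<^sub>R u x)"
  proof (rule Bochner_Integration.integrable_bound)
    show "AE x in lborel. norm (indicator (cbox a b) x *\<^sub>R u x) \<le> norm (indicator (cbox a b) x *\<^sub>R B)"
    proof (rule AE_I2)
      fix x
      have "\<bar>u x\<bar> \<le> \<bar>B\<bar>" using assms(2)[of x] by linarith
      then show "norm (indicator (cbox a b) x *\<^sub>R u x) \<le> norm (indicator (cbox a b) x *\<^sub>R B)"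
        by (simp add: indicator_def)
    qed
  qed measurable
qed (rule assms)

lemma le_mult_epsilon:
  fixes x K e :: real
  assumes "0 < K" "\<And>\<epsilon>. 0 < \<epsilon> \<Longrightarrow> x \<le> K * (e + \<epsilon>)"
  shows "x \<le> K * e"
proof (rule field_le_epsilon)
  fix \<epsilon> :: real assume "0 < \<epsilon>"
  then have "x \<le> K * (e + \<epsilon> / K)" using assms by simp
  then show "x \<le> K * e + \<epsilon>" using assms(1) by (simp add: distrib_left)
qed

subsection \<open>Lorentz and strong estimates\<close>

lemma nn_integral_powr_le:
  fixes v :: real
  assumes "0 \<le> u" "1 \<le> p" "0 < v"
  shows "(\<integral>\<^sup>+t\<in>{u<..v}. ennreal (t powr (p - 1)) \<partial>lborel) \<le> ennreal (v powr p)"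
proof -
  have "(\<integral>\<^sup>+t\<in>{u<..v}. ennreal (t powr (p - 1)) \<partial>lborel) \<le> (\<integral>\<^sup>+t. ennreal (v powr (p - 1)) * indicator {0<..v} t \<partial>lborel)"
    using assms by (intro nn_integral_mono) (auto simp: indicator_def intro!: ennreal_leI powr_mono2)
  also have "\<dots> = ennreal (v powr (p - 1)) * ennreal v"
    using assms by (subst nn_integral_cmult_indicator) auto
  also have "\<dots> = ennreal (v powr p)"
    using assms powr_add[of v "p - 1" 1] by (simp flip: ennreal_mult)
  finally show ?thesis .
qed

text \<open>The derivative of the \<open>k\<close>-th truncation lives where
  \<open>\<bar>s - c\<bar>\<close> is strictly between \<open>B * 2 ^ k\<close> and twice that.
  These ranges are disjoint, so at most one summand survives, and the energies of all truncations
  add up to no more than \<open>2 powr p\<close> times the full energy.\<close>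

lemma dyadic_annuli_sum_le:
  fixes G B c s :: real
  assumes B: "0 < B" and p: "1 \<le> p" and G: "0 \<le> G"
  shows "(\<Sum>k. ennreal ((\<bar>trunc_deriv (B * 2 ^ k) c s\<bar> * G) powr p)) \<le> ennreal (2 powr p * G powr p)"
proof (cases "\<exists>k. trunc_deriv (B * 2 ^ k) c s \<noteq> 0")
  case False
  then show ?thesis using p by simp
next
  case True
  then obtain k where k: "trunc_deriv (B * 2 ^ k) c s \<noteq> 0" by blast
  have pos: "0 < B * 2 ^ j" for j :: nat using B by simp
  have other: "trunc_deriv (B * 2 ^ j) c s = 0" if "j \<noteq> k" for j
  proof (rule ccontr)
    assume "trunc_deriv (B * 2 ^ j) c s \<noteq> 0"
    then have j: "B * 2 ^ j < \<bar>s - c\<bar>" "\<bar>s - c\<bar> < B * 2 ^ Suc j"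
      using trunc_deriv_support[OF pos[of j]] by (auto simp: mult.left_commute)
    have k': "B * 2 ^ k < \<bar>s - c\<bar>" "\<bar>s - c\<bar> < B * 2 ^ Suc k"
      using trunc_deriv_support[OF pos k] by (auto simp: mult.left_commute)
    have "B * 2 ^ j < B * 2 ^ Suc k" "B * 2 ^ k < B * 2 ^ Suc j" using j k' by linarith+
    then have "j < Suc k" "k < Suc j" using B by (auto simp del: power_Suc)
    with that show False by simp
  qed
  have "(\<Sum>k. ennreal ((\<bar>trunc_deriv (B * 2 ^ k) c s\<bar> * G) powr p))
    = (\<Sum>j\<in>{k}. ennreal ((\<bar>trunc_deriv (B * 2 ^ j) c s\<bar> * G) powr p))"
    by (rule suminf_finite) (use other p in auto)
  also have "\<dots> \<le> ennreal ((2 * G) powr p)"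
    using trunc_deriv_bound[OF pos[of k], of c s] G p by (auto intro!: ennreal_leI powr_mono2 mult_right_mono)
  also have "\<dots> = ennreal (2 powr p * G powr p)" using G by (simp add: powr_mult)
  finally show ?thesis .
qed

text \<open>The half-line is cut into \<open>(0, 2 * B]\<close> and successive doublings. On the
  first piece only \<open>\<mu> t \<le> 1\<close> is used, so the application has to choose
  \<open>B\<close> of the size of the right-hand side; on each of the others monotonicity replaces
  \<open>\<mu>\<close> by its value at the left end.\<close>

lemma lorentz_layer_sum:
  fixes \<mu> :: "real \<Rightarrow> real"
  assumes \<mu>: "\<And>t. 0 \<le> \<mu> t" "\<And>t. \<mu> t \<le> 1" "\<And>s t. s \<le> t \<Longrightarrow> \<mu> t \<le> \<mu> s" and B: "0 < B" and p: "1 \<le> p" and q: "0 < q"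
  shows "(\<integral>\<^sup>+t\<in>{0<..}. ennreal (t powr (p - 1)) * ennreal (\<mu> t powr q) \<partial>lborel)
    \<le> ennreal ((2 * B) powr p) + (\<Sum>k. ennreal ((B * 2 ^ k * 4) powr p * \<mu> (B * 2 ^ k * 2) powr q))"
proof -
  let ?b = "\<lambda>k. B * 2 ^ k * (2::real)"
  let ?I = "\<lambda>k t. ennreal (\<mu> (?b k) powr q) * (ennreal (t powr (p - 1)) * indicator {?b k <.. ?b k * 2} t)"
  have pt: "ennreal (t powr (p - 1)) * ennreal (\<mu> t powr q) * indicator {0<..} t
    \<le> ennreal (t powr (p - 1)) * indicator {0<..2 * B} t + (\<Sum>k. ?I k t)" for t
  proof (cases "t \<le> 2 * B")
    case True
    have "\<mu> t powr q \<le> 1" using \<mu> q by (intro powr_le1) auto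
    then have "ennreal (\<mu> t powr q) \<le> 1" by simp
    then have "ennreal (t powr (p - 1)) * ennreal (\<mu> t powr q) \<le> ennreal (t powr (p - 1)) * 1" by (rule mult_left_mono) simp
    then have "ennreal (t powr (p - 1)) * ennreal (\<mu> t powr q) * indicator {0<..} t \<le> ennreal (t powr (p - 1)) * indicator {0<..2 * B} t"
      using True by (simp add: indicator_def)
    then show ?thesis by (simp add: add_increasing2)
  next
    case False
    obtain K :: nat where K: "t / B < 2 ^ K" using real_arch_pow[of 2 "t / B"] by auto
    define k where "k = (LEAST k. t \<le> ?b k * 2)"
    have "t < B * 2 ^ K" "0 < B * 2 ^ K" using K B by (simp_all add: divide_less_eq mult.commute)
    then have ex: "t \<le> ?b K * 2" by linarith
    have k1: "t \<le> ?b k * 2" unfolding k_def by (rule LeastI[of _ K]) (rule ex)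
    have k2: "?b k < t"
    proof (cases k)
      case 0
      then show ?thesis using False by simp
    next
      case (Suc j)
      then have "\<not> t \<le> ?b j * 2" using not_less_Least[of j "\<lambda>k. t \<le> ?b k * 2"] by (simp add: k_def)
      then show ?thesis using Suc by simp
    qed
    have "\<mu> t powr q \<le> \<mu> (?b k) powr q" using k2 \<mu> q by (intro powr_mono2) auto
    then have "ennreal (\<mu> t powr q) \<le> ennreal (\<mu> (?b k) powr q)" by (rule ennreal_leI)
    then have "ennreal (t powr (p - 1)) * ennreal (\<mu> t powr q) \<le> ennreal (t powr (p - 1)) * ennreal (\<mu> (?b k) powr q)"
      by (rule mult_left_mono) simp
    also have "\<dots> = ?I k t" using k1 k2 by (simp add: mult.commute)
    also have "\<dots> \<le> (\<Sum>k. ?I k t)"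
      using sum_le_suminf[of "\<lambda>k. ?I k t" "{k}"] by simp
    finally show ?thesis using False B by (simp add: indicator_def)
  qed
  have "(\<integral>\<^sup>+t\<in>{0<..}. ennreal (t powr (p - 1)) * ennreal (\<mu> t powr q) \<partial>lborel)
    \<le> (\<integral>\<^sup>+t. (ennreal (t powr (p - 1)) * indicator {0<..2 * B} t + (\<Sum>k. ?I k t)) \<partial>lborel)"
    using pt by (intro nn_integral_mono) (simp add: mult_ac)
  also have "\<dots> = (\<integral>\<^sup>+t\<in>{0<..2 * B}. ennreal (t powr (p - 1)) \<partial>lborel) + (\<integral>\<^sup>+t. (\<Sum>k. ?I k t) \<partial>lborel)"
    by (rule nn_integral_add) measurable
  also have "(\<integral>\<^sup>+t. (\<Sum>k. ?I k t) \<partial>lborel) = (\<Sum>k. \<integral>\<^sup>+t. ?I k t \<partial>lborel)"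
    by (rule nn_integral_suminf) measurable
  also have "\<dots> = (\<Sum>k. ennreal (\<mu> (?b k) powr q) * (\<integral>\<^sup>+t\<in>{?b k <.. ?b k * 2}. ennreal (t powr (p - 1)) \<partial>lborel))"
    by (intro suminf_cong nn_integral_cmult) measurable
  also have "(\<integral>\<^sup>+t\<in>{0<..2 * B}. ennreal (t powr (p - 1)) \<partial>lborel)
      + (\<Sum>k. ennreal (\<mu> (?b k) powr q) * (\<integral>\<^sup>+t\<in>{?b k <.. ?b k * 2}. ennreal (t powr (p - 1)) \<partial>lborel))
    \<le> ennreal ((2 * B) powr p) + (\<Sum>k. ennreal ((B * 2 ^ k * 4) powr p * \<mu> (B * 2 ^ k * 2) powr q))"
  proof (intro add_mono suminf_le)
    show "(\<integral>\<^sup>+t\<in>{0<..2 * B}. ennreal (t powr (p - 1)) \<partial>lborel) \<le> ennreal ((2 * B) powr p)"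
      using B p by (intro nn_integral_powr_le) auto
    show "ennreal (\<mu> (?b k) powr q) * (\<integral>\<^sup>+t\<in>{?b k <.. ?b k * 2}. ennreal (t powr (p - 1)) \<partial>lborel)
        \<le> ennreal ((B * 2 ^ k * 4) powr p * \<mu> (B * 2 ^ k * 2) powr q)" for k
    proof -
      have "ennreal (\<mu> (?b k) powr q) * (\<integral>\<^sup>+t\<in>{?b k <.. ?b k * 2}. ennreal (t powr (p - 1)) \<partial>lborel)
        \<le> ennreal (\<mu> (?b k) powr q) * ennreal ((?b k * 2) powr p)"
        using B p by (intro mult_left_mono nn_integral_powr_le) auto
      also have "\<dots> = ennreal ((?b k * 2) powr p * \<mu> (?b k) powr q)"
        by (simp add: mult.commute flip: ennreal_mult)
      finally have h: "ennreal (\<mu> (?b k) powr q) * (\<integral>\<^sup>+t\<in>{?b k <.. ?b k * 2}. ennreal (t powr (p - 1)) \<partial>lborel)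
        \<le> ennreal ((?b k * 2) powr p * \<mu> (?b k) powr q)" .
      have e: "?b k * 2 = B * 2 ^ k * 4" by simp
      from h show ?thesis by (simp only: e)
    qed
  qed auto
  finally show ?thesis .
qed

lemma powr_add_le:
  fixes x y :: real
  assumes "0 \<le> x" "x \<le> y" "1 \<le> p"
  shows "x powr p + y powr p \<le> (2 * y) powr p"
proof -
  have "x powr p + y powr p \<le> 2 * y powr p" using assms powr_mono2[of p x y] by simp
  also have "\<dots> \<le> 2 powr p * y powr p"
    using assms powr_mono[of 1 p "2::real"] by (intro mult_right_mono) auto
  also have "\<dots> = (2 * y) powr p" using assms by (simp add: powr_mult)
  finally show ?thesis .
qed

text \<open>Each truncation at height \<open>b k\<close> satisfies the weak-type estimate with its
  own energy \<open>e k\<close>. At the single level \<open>b k / 2\<close> this bounds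
  \<open>\<mu> (2 * b k)\<close>, and the power \<open>p / r\<close> makes the bound linear in
  \<open>e k\<close>. The energies are summable because the annuli are disjoint, so a weak estimate
  for each truncation adds up to the Lorentz integral.\<close>

lemma weighted_lorentz_sobolev:
  fixes w f :: "real^'n \<Rightarrow> real" and g :: "'n \<Rightarrow> real^'n \<Rightarrow> real" and l :: real
  assumes w: "almost_constant \<delta> w" and n: "2 \<le> CARD('n)" and d: "0 \<le> \<delta>" "\<delta> \<le> 1 / 4" "2 ^ CARD('n) * \<delta> \<le> 1 / 2"
    and \<theta>: "0 < \<theta>" "2 powr - (1 / \<theta>) \<le> (1 - 2 ^ CARD('n) * \<delta>) / 2 ^ CARD('n)"
    and p: "1 < p" and small: "4 * \<delta> * 4 powr (1 / (p - 1)) \<le> 1"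
    and r: "1 \<le> r" "\<theta> = 1 / p - 1 / r"
    and fg: "weak_gradient_borel f g"
    and l: "0 < l" and G: "0 < G"
    and le: "(\<integral>\<^sup>+x\<in>hcube a l. ennreal (norm (\<chi> i. g i x) powr p * w x) \<partial>lborel) \<le> ennreal (G * (hmean w a l * l ^ CARD('n)))"
  defines "D \<equiv> 6 * (4 ^ CARD('n) * real CARD('n)) * l * (2 + 2 * r)"
  defines "\<mu> \<equiv> \<lambda>t. enn2real (\<integral>\<^sup>+x\<in>{x \<in> hcube a l. t < \<bar>f x - hmean f a l\<bar>}. ennreal (w x) \<partial>lborel) / (hmean w a l * l ^ CARD('n))"
  shows "(\<integral>\<^sup>+t\<in>{0<..}. ennreal (t powr (p - 1)) * ennreal (\<mu> t powr (p / r)) \<partial>lborel) \<le> ennreal ((32 * D) powr p * G)"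
proof -
  let ?n = "CARD('n)"
  have lw: "locally_integrable_borel w" and wp: "\<And>x. 0 < w x" using w by (auto simp: almost_constant_def)
  have f: "locally_integrable_borel f" and g: "\<And>i. locally_integrable_borel (g i)"
    using fg by (auto simp: weak_gradient_borel_def)
  have [measurable]: "f \<in> borel_measurable borel" "w \<in> borel_measurable borel" "\<And>i. g i \<in> borel_measurable borel"
    using f g lw by (auto dest: locally_integrable_borel_measurable)
  define N where "N z = norm (\<chi> i. g i z)" for z
  have [measurable]: "N \<in> borel_measurable borel"
    unfolding N_def norm_vec_def L2_set_def vec_lambda_beta by measurable
  have N0: "0 \<le> N z" for z by (simp add: N_def)
  define W where "W = hmean w a l * l ^ ?n"
  have W: "0 < W" unfolding W_def using l by (intro mult_pos_pos hmean_pos[OF lw wp l]) auto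
  have Wint: "(\<integral>\<^sup>+x\<in>hcube a l. ennreal (w x) \<partial>lborel) = ennreal W"
    unfolding W_def by (rule nn_integral_hcube_eq[OF lw less_imp_le[OF wp] l])
  define M where "M t = (\<integral>\<^sup>+x\<in>{x \<in> hcube a l. t < \<bar>f x - hmean f a l\<bar>}. ennreal (w x) \<partial>lborel)" for t
  have \<mu>: "\<mu> t = enn2real (M t) / W" for t by (simp add: \<mu>_def M_def W_def)
  have Mle: "M t \<le> ennreal W" for t
    unfolding M_def Wint[symmetric] by (intro nn_integral_mono) (auto simp: indicator_def)
  have Mfin: "M t < top" for t using Mle[of t] by (rule le_less_trans) simp
  have Mmono: "M t \<le> M s" if "s \<le> t" for s t
    unfolding M_def using that by (intro nn_integral_mono) (auto simp: indicator_def)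
  have \<mu>0: "0 \<le> \<mu> t" for t using W by (simp add: \<mu>)
  have \<mu>1: "\<mu> t \<le> 1" for t
    using W enn2real_mono[OF Mle[of t]] by (simp add: \<mu>)
  have \<mu>mono: "\<mu> t \<le> \<mu> s" if "s \<le> t" for s t
    unfolding \<mu> using W enn2real_mono[OF Mmono[OF that] Mfin] by (intro divide_right_mono) auto
  define c where "c = hmean f a l"
  have D: "0 < D" using l r by (simp add: D_def)
  \<comment> \<open>The bound for the unweighted mean of \<open>\<bar>f - c\<bar>\<close>: the
    constant \<open>2 ^ n * n * l\<close> of the Poincare inequality times the
    \<open>6 * G powr (1 / p)\<close> of \<open>mean_le_weighted_mean\<close>. By \<open>BD\<close>
    it is small enough for the levels up to \<open>8 * B\<close> to be estimated trivially.\<close>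
  define B where "B = 6 * (2 ^ ?n * real ?n) * l * G powr (1 / p)"
  have B: "0 < B" using l G by (simp add: B_def)
  have BD: "8 * B \<le> 16 * D * G powr (1 / p)"
  proof -
    have "B \<le> 6 * (4 ^ ?n * real ?n) * l * G powr (1 / p) * (2 + 2 * r)"
    proof -
      have "(2::real) ^ ?n \<le> 4 ^ ?n" by (intro power_mono) auto
      then have "B \<le> 6 * (4 ^ ?n * real ?n) * l * G powr (1 / p) * 1"
        unfolding B_def mult_1_right using l by (intro mult_right_mono mult_left_mono) auto
      also have "\<dots> \<le> 6 * (4 ^ ?n * real ?n) * l * G powr (1 / p) * (2 + 2 * r)"
        using l r by (intro mult_left_mono) auto
      finally show ?thesis .
    qed
    also have "\<dots> = D * G powr (1 / p)" by (simp add: D_def)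
    finally have "B \<le> D * G powr (1 / p)" .
    moreover have "0 \<le> D * G powr (1 / p)" using D by simp
    ultimately show ?thesis by linarith
  qed
  have dev: "(\<integral>\<^sup>+x\<in>hcube a l. ennreal \<bar>f x - c\<bar> \<partial>lborel) \<le> ennreal (B * l ^ ?n)"
  proof -
    have id: "((\<lambda>s. s) has_real_derivative (\<lambda>_. 1) s) (at s)" "continuous_on UNIV (\<lambda>_::real. 1::real)" for s :: real
      by (auto intro!: derivative_eq_intros)
    have "(\<integral>\<^sup>+x\<in>hcube a l. ennreal \<bar>f x - c\<bar> \<partial>lborel)
        \<le> ennreal (2 ^ ?n * real ?n * l) * (\<integral>\<^sup>+z\<in>hcube a l. ennreal (N z) \<partial>lborel)"
      using poincare_child(2)[where H="\<lambda>s. s" and h="\<lambda>_. 1" and Bh=1, OF fg id _ f l, of a] by (simp add: N_def c_def)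
    also have "\<dots> \<le> ennreal (2 ^ ?n * real ?n * l) * ennreal (6 * G powr (1 / p) * l ^ ?n)"
      by (intro mult_left_mono mean_le_weighted_mean[OF w d(1,3) p small l _ _ G]) (use le N0 in \<open>auto simp: N_def[symmetric]\<close>)
    also have "\<dots> = ennreal (B * l ^ ?n)"
      using l by (simp add: B_def mult_ac flip: ennreal_mult)
    finally show ?thesis .
  qed
  \<comment> \<open>The factor 4 ensures that the mean of the truncation, which is at most the mean
    of \<open>\<bar>f - c\<bar>\<close> and hence at most \<open>B\<close>, does not exceed a
    quarter of its height \<open>b k\<close>.\<close>
  define b where "b k = 4 * B * 2 ^ k" for k :: nat
  have b: "0 < b k" for k using B by (simp add: b_def)
  have b4: "4 * B \<le> b k" for k using B by (simp add: b_def)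
  define F where "F k z = \<bar>trunc_deriv (b k) c (f z)\<bar> * N z" for k z
  have [measurable]: "trunc_deriv (b k) c \<in> borel_measurable borel" for k
    by (rule borel_measurable_continuous_onI[OF trunc_deriv_continuous[OF b]])
  have [measurable]: "F k \<in> borel_measurable borel" for k unfolding F_def by measurable
  have F0: "0 \<le> F k z" for k z by (simp add: F_def N0)
  define E where "E k = (\<integral>\<^sup>+x\<in>hcube a l. ennreal (F k x powr p * w x) \<partial>lborel)" for k
  have sumE: "(\<Sum>k. E k) \<le> ennreal (2 powr p * (G * W))"
  proof -
    have "(\<Sum>k. E k) = (\<integral>\<^sup>+x. (\<Sum>k. ennreal (F k x powr p * w x) * indicator (hcube a l) x) \<partial>lborel)"
      unfolding E_def by (rule nn_integral_suminf[symmetric]) measurable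
    also have "\<dots> \<le> (\<integral>\<^sup>+x. ennreal (2 powr p) * (ennreal (N x powr p * w x) * indicator (hcube a l) x) \<partial>lborel)"
    proof (rule nn_integral_mono)
      fix x
      have "(\<Sum>k. ennreal (F k x powr p * w x) * indicator (hcube a l) x)
        = (\<Sum>k. ennreal (F k x powr p)) * (ennreal (w x) * indicator (hcube a l) x)"
        using wp[of x] by (simp add: ennreal_mult mult.assoc less_imp_le)
      also have "\<dots> \<le> ennreal (2 powr p * N x powr p) * (ennreal (w x) * indicator (hcube a l) x)"
        unfolding F_def b_def using B p N0[of x]
        by (intro mult_right_mono dyadic_annuli_sum_le) auto
      also have "\<dots> = ennreal (2 powr p) * (ennreal (N x powr p * w x) * indicator (hcube a l) x)"
        using wp[of x] by (simp add: ennreal_mult mult.assoc less_imp_le)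
      finally show "(\<Sum>k. ennreal (F k x powr p * w x) * indicator (hcube a l) x)
        \<le> ennreal (2 powr p) * (ennreal (N x powr p * w x) * indicator (hcube a l) x)" .
    qed
    also have "\<dots> = ennreal (2 powr p) * (\<integral>\<^sup>+x\<in>hcube a l. ennreal (N x powr p * w x) \<partial>lborel)"
      by (rule nn_integral_cmult) measurable
    also have "\<dots> \<le> ennreal (2 powr p) * ennreal (G * W)"
      using le by (intro mult_left_mono) (auto simp: N_def W_def)
    also have "\<dots> = ennreal (2 powr p * (G * W))" using G W by (simp flip: ennreal_mult)
    finally show ?thesis .
  qed
  have Ele: "E k \<le> ennreal (2 powr p * (G * W))" for k
    using order_trans[OF _ sumE, of "E k"] sum_le_suminf[of E "{k}"] by simp
  then have Efin: "E k < top" for k using le_less_trans[OF Ele] by simp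
  define e where "e k = enn2real (E k) / W" for k
  have E: "E k = ennreal (e k * W)" for k using Efin[of k] W by (simp add: e_def)
  have e0: "0 \<le> e k" for k using W by (simp add: e_def)
  have level: "b k powr p * \<mu> (2 * b k) powr (p / r) \<le> (2 * D) powr p * e k" for k
  proof (rule le_mult_epsilon)
    show "0 < (2 * D) powr p" using D by simp
    \<comment> \<open>The energy \<open>e k\<close> may vanish, whereas
      \<open>weak_type_estimate\<close> asks for a positive bound on it; the slack is removed at the
      end.\<close>
    fix \<epsilon> :: real assume \<epsilon>: "0 < \<epsilon>"
    define u where "u x = trunc (b k) c (f x)" for x
    have "trunc (b k) c \<in> borel_measurable borel"
      by (intro borel_measurable_continuous_onI continuous_at_imp_continuous_on ballI DERIV_isCont[OF trunc_has_derivative[OF b]])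
    then have u_meas[measurable]: "u \<in> borel_measurable borel" unfolding u_def by measurable
    have u: "locally_integrable_borel u"
      using trunc_nonneg[OF b] trunc_le[OF b] by (intro locally_integrable_borel_bounded[of _ "b k"]) (auto simp: u_def)
    have umean: "hmean u a l \<le> b k / 4" "0 \<le> hmean u a l"
    proof -
      have "ennreal (\<bar>hmean u a l - 0\<bar> * l ^ ?n) \<le> (\<integral>\<^sup>+x\<in>hcube a l. ennreal \<bar>u x - 0\<bar> \<partial>lborel)"
        by (rule hmean_minus_const_le[OF u l])
      also have "\<dots> \<le> (\<integral>\<^sup>+x\<in>hcube a l. ennreal \<bar>f x - c\<bar> \<partial>lborel)"
        using trunc_nonneg[OF b] trunc_le[OF b]
        by (intro nn_integral_mono mult_right_mono) (auto simp: u_def intro!: ennreal_leI)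
      also note dev
      finally have "\<bar>hmean u a l\<bar> * l ^ ?n \<le> B * l ^ ?n"
        using B l by (subst (asm) ennreal_le_iff) auto
      then have "\<bar>hmean u a l\<bar> \<le> B" using l by (rule mult_right_le_imp_le[OF _ zero_less_power])
      then show "hmean u a l \<le> b k / 4" using b4[of k] by linarith
      have "0 \<le> (LINT x:hcube a l|lborel. u x)"
        unfolding set_lebesgue_integral_def using trunc_nonneg[OF b] by (intro Bochner_Integration.integral_nonneg) (simp add: u_def)
      then show "0 \<le> hmean u a l" using l by (simp add: hmean_def)
    qed
    define Gr where "Gr = e k + \<epsilon>"
    have Gr: "0 < Gr" using e0[of k] \<epsilon> by (simp add: Gr_def)
    have poin: "ennreal (\<bar>hmean u (subcorner c' m B') (m / 2) - hmean u c' m\<bar> * m ^ ?n)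
        \<le> ennreal (4 ^ ?n * real ?n * m) * (\<integral>\<^sup>+x\<in>hcube c' m. ennreal (F k x) \<partial>lborel)" if m: "0 < m" for c' m B'
      using poincare_child(1)[where H="trunc (b k) c" and h="trunc_deriv (b k) c" and Bh=2, OF fg trunc_has_derivative[OF b]
          trunc_deriv_continuous[OF b] trunc_deriv_bound[OF b] u[unfolded u_def[abs_def]] m, of c' B']
      by (simp add: u_def[abs_def] F_def N_def)
    have "M (2 * b k) \<le> (\<integral>\<^sup>+x\<in>{x \<in> hcube a l. b k / 2 < \<bar>u x - hmean u a l\<bar>}. ennreal (w x) \<partial>lborel)"
      unfolding M_def
    proof (intro nn_integral_mono mult_left_mono)
      fix x
      \<comment> \<open>At such a point the truncation has its full value \<open>b k\<close> and its
        mean is at most \<open>b k / 4\<close>, so it deviates from the mean by at least three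
        quarters of \<open>b k\<close>.\<close>
      have "b k / 2 < \<bar>u x - hmean u a l\<bar>" if "2 * b k < \<bar>f x - hmean f a l\<bar>"
        using trunc_eq[OF b, of k "f x" c] that umean b[of k] by (simp add: u_def c_def)
      then show "indicator {x \<in> hcube a l. 2 * b k < \<bar>f x - hmean f a l\<bar>} x
          \<le> (indicator {x \<in> hcube a l. b k / 2 < \<bar>u x - hmean u a l\<bar>} x :: ennreal)"
        by (auto simp: indicator_def)
    qed simp
    also have "\<dots> \<le> ennreal ((6 * (4 ^ ?n * real ?n) * l * (2 + 2 * r) * Gr powr (1 / p) / (b k / 2)) powr r * (hmean w a l * l ^ ?n))"
    proof (rule weak_type_estimate[OF w n d \<theta> p small r u])
      show "(\<integral>\<^sup>+x\<in>hcube a l. ennreal (F k x powr p * w x) \<partial>lborel) \<le> ennreal (Gr * (hmean w a l * l ^ ?n))"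
        unfolding E_def[symmetric] E W_def[symmetric] Gr_def using W \<epsilon> e0[of k] by (intro ennreal_leI mult_right_mono) auto
    qed (use F0 l Gr b[of k] poin in auto)
    also have "\<dots> = ennreal ((D * Gr powr (1 / p) / (b k / 2)) powr r * W)" by (simp add: D_def W_def)
    finally have "enn2real (M (2 * b k)) \<le> (D * Gr powr (1 / p) / (b k / 2)) powr r * W"
      using W by (intro enn2real_leI) auto
    then have "\<mu> (2 * b k) \<le> (D * Gr powr (1 / p) / (b k / 2)) powr r"
      using W by (simp add: \<mu> divide_le_eq)
    then have "\<mu> (2 * b k) powr (p / r) \<le> ((D * Gr powr (1 / p) / (b k / 2)) powr r) powr (p / r)"
      using \<mu>0 p r by (intro powr_mono2) auto
    also have "\<dots> = (2 * D * Gr powr (1 / p) / b k) powr p"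
      using r by (simp add: powr_powr mult_ac)
    also have "\<dots> = (2 * D) powr p * Gr / b k powr p"
      using D Gr b[of k] p by (simp add: powr_mult powr_divide powr_powr)
    finally show "b k powr p * \<mu> (2 * b k) powr (p / r) \<le> (2 * D) powr p * (e k + \<epsilon>)"
      using b[of k] by (simp add: Gr_def pos_le_divide_eq mult.commute)
  qed
  have "(\<integral>\<^sup>+t\<in>{0<..}. ennreal (t powr (p - 1)) * ennreal (\<mu> t powr (p / r)) \<partial>lborel)
    \<le> ennreal ((2 * (4 * B)) powr p) + (\<Sum>k. ennreal ((4 * B * 2 ^ k * 4) powr p * \<mu> (4 * B * 2 ^ k * 2) powr (p / r)))"
    using B p r by (intro lorentz_layer_sum \<mu>0 \<mu>1 \<mu>mono) auto
  also have "(\<Sum>k. ennreal ((4 * B * 2 ^ k * 4) powr p * \<mu> (4 * B * 2 ^ k * 2) powr (p / r)))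
      \<le> (\<Sum>k. ennreal ((8 * D) powr p / W) * E k)"
  proof (rule suminf_le)
    fix k
    have "(4 * B * 2 ^ k * 4) powr p * \<mu> (4 * B * 2 ^ k * 2) powr (p / r) = 4 powr p * (b k powr p * \<mu> (2 * b k) powr (p / r))"
      using B powr_mult[of "b k" 4 p] b[of k] by (simp add: b_def mult_ac)
    also have "\<dots> \<le> 4 powr p * ((2 * D) powr p * e k)" by (intro mult_left_mono level) simp
    also have "\<dots> = (8 * D) powr p / W * (e k * W)"
      using W D powr_mult[of 4 "2 * D" p] by simp
    finally have "ennreal ((4 * B * 2 ^ k * 4) powr p * \<mu> (4 * B * 2 ^ k * 2) powr (p / r)) \<le> ennreal ((8 * D) powr p / W * (e k * W))"
      by (rule ennreal_leI)
    also have "\<dots> = ennreal ((8 * D) powr p / W) * E k"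
      unfolding E using W e0[of k] by (intro ennreal_mult) auto
    finally show "ennreal ((4 * B * 2 ^ k * 4) powr p * \<mu> (4 * B * 2 ^ k * 2) powr (p / r)) \<le> ennreal ((8 * D) powr p / W) * E k" .
  qed auto
  also have "(\<Sum>k. ennreal ((8 * D) powr p / W) * E k) = ennreal ((8 * D) powr p / W) * (\<Sum>k. E k)" by simp
  also have "\<dots> \<le> ennreal ((8 * D) powr p / W) * ennreal (2 powr p * (G * W))"
    by (rule mult_left_mono[OF sumE]) simp
  also have "\<dots> = ennreal ((16 * D) powr p * G)"
    using W G D powr_mult[of 2 "8 * D" p] by (simp flip: ennreal_mult)
  \<comment> \<open>In \<open>16 * D\<close> the factors are 4 from the doubling intervals, 2 from
    the level \<open>b k / 2\<close>, and 2 from the bound for the derivative of the truncation.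
    Adding the part below \<open>8 * B\<close>, which is at most as large, doubles it to
    \<open>32 * D\<close>.\<close>
  also have "ennreal ((2 * (4 * B)) powr p) + ennreal ((16 * D) powr p * G) \<le> ennreal ((32 * D) powr p * G)"
  proof -
    have eq: "(x * G powr (1 / p)) powr p = x powr p * G" if "0 \<le> x" for x
      using that G p by (simp add: powr_mult powr_powr)
    have "(2 * (4 * B)) powr p + (16 * D * G powr (1 / p)) powr p \<le> (2 * (16 * D * G powr (1 / p))) powr p"
      using B BD p by (intro powr_add_le) auto
    then have "(2 * (4 * B)) powr p + (16 * D) powr p * G \<le> (32 * D) powr p * G"
      using eq[of "16 * D"] eq[of "32 * D"] D by (simp add: mult.assoc)
    then show ?thesis using G by (simp add: ennreal_leI flip: ennreal_plus)
  qed
  finally show ?thesis by (simp add: add_left_mono)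
qed

text \<open>Only the upper half of the range is used, where the integrand is almost constant. The
  loss \<open>2 powr r\<close> becomes a factor 2 once the \<open>r\<close>-th root is
  taken.\<close>

lemma powr_le_nn_integral:
  fixes x :: real
  assumes "0 \<le> x" "1 \<le> r"
  shows "ennreal (x powr r) \<le> ennreal (2 powr r) * (\<integral>\<^sup>+t\<in>{0<..<x}. ennreal (t powr (r - 1)) \<partial>lborel)"
proof (cases "x = 0")
  case False
  then have x: "0 < x" using assms by simp
  have "ennreal ((x / 2) powr (r - 1)) * ennreal (x / 2) = (\<integral>\<^sup>+t. ennreal ((x / 2) powr (r - 1)) * indicator {x / 2<..<x} t \<partial>lborel)"
    using x by (subst nn_integral_cmult_indicator) auto
  also have "\<dots> \<le> (\<integral>\<^sup>+t\<in>{0<..<x}. ennreal (t powr (r - 1)) \<partial>lborel)"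
    using x assms by (intro nn_integral_mono) (auto simp: indicator_def intro!: ennreal_leI powr_mono2)
  finally have 1: "ennreal ((x / 2) powr (r - 1)) * ennreal (x / 2) \<le> (\<integral>\<^sup>+t\<in>{0<..<x}. ennreal (t powr (r - 1)) \<partial>lborel)" .
  have e: "x powr r = 2 powr r * ((x / 2) powr (r - 1) * (x / 2))"
  proof -
    have "(x / 2) powr r = (x / 2) powr (r - 1) * (x / 2)" using x powr_add[of "x / 2" "r - 1" 1] by simp
    moreover have "x powr r = 2 powr r * (x / 2) powr r" using x by (simp add: powr_divide)
    ultimately show ?thesis by simp
  qed
  have "ennreal (x powr r) = ennreal (2 powr r) * (ennreal ((x / 2) powr (r - 1)) * ennreal (x / 2))"
  proof -
    have m3: "ennreal (a * (b * c)) = ennreal a * (ennreal b * ennreal c)" if "0 \<le> a" "0 \<le> b" "0 \<le> c" for a b c :: real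
      using that by (simp add: ennreal_mult)
    show ?thesis unfolding e by (rule m3) (use x in auto)
  qed
  also have "\<dots> \<le> ennreal (2 powr r) * (\<integral>\<^sup>+t\<in>{0<..<x}. ennreal (t powr (r - 1)) \<partial>lborel)"
    using 1 by (rule mult_left_mono) simp
  finally show ?thesis .
qed (use assms in simp)

lemma layer_cake_le:
  fixes w F :: "real^'n \<Rightarrow> real"
  assumes [measurable]: "w \<in> borel_measurable borel" "F \<in> borel_measurable borel" "Q \<in> sets borel"
    and pos: "\<And>x. 0 \<le> w x" "\<And>x. 0 \<le> F x" and r: "1 \<le> r"
  shows "(\<integral>\<^sup>+x\<in>Q. ennreal (F x powr r * w x) \<partial>lborel)
    \<le> ennreal (2 powr r) * (\<integral>\<^sup>+t\<in>{0<..}. ennreal (t powr (r - 1)) * (\<integral>\<^sup>+x\<in>{x \<in> Q. t < F x}. ennreal (w x) \<partial>lborel) \<partial>lborel)"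
proof -
  define \<Phi> where "\<Phi> x t = ennreal (t powr (r - 1)) * indicator {0<..} t * (ennreal (w x) * indicator {z \<in> Q. t < F z} x)" for x t
  have \<Phi>_meas[measurable]: "(\<lambda>(x, t). \<Phi> x t) \<in> borel_measurable (lborel \<Otimes>\<^sub>M lborel)"
  proof -
    \<comment> \<open>The set in \<open>\<Phi>\<close> varies with \<open>t\<close>; rewriting its
      indicator as a condition on the pair makes joint measurability derivable.\<close>
    have eq: "(\<lambda>(x, t). \<Phi> x t) = (\<lambda>p. ennreal (snd p powr (r - 1)) * indicator {0<..} (snd p)
        * (ennreal (w (fst p)) * indicator Q (fst p) * (if snd p < F (fst p) then 1 else 0)))"
      by (auto simp: fun_eq_iff \<Phi>_def indicator_def)
    show ?thesis unfolding eq by measurable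
  qed
  have "(\<integral>\<^sup>+x\<in>Q. ennreal (F x powr r * w x) \<partial>lborel) \<le> (\<integral>\<^sup>+x. ennreal (2 powr r) * (\<integral>\<^sup>+t. \<Phi> x t \<partial>lborel) \<partial>lborel)"
  proof (rule nn_integral_mono)
    fix x
    have "ennreal (F x powr r * w x) = ennreal (w x) * ennreal (F x powr r)"
      using pos by (simp add: ennreal_mult mult.commute)
    also have "\<dots> \<le> ennreal (w x) * (ennreal (2 powr r) * (\<integral>\<^sup>+t\<in>{0<..<F x}. ennreal (t powr (r - 1)) \<partial>lborel))"
      by (intro mult_left_mono powr_le_nn_integral pos r) simp
    also have "\<dots> = ennreal (2 powr r) * (\<integral>\<^sup>+t. ennreal (w x) * (ennreal (t powr (r - 1)) * indicator {0<..<F x} t) \<partial>lborel)"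
      by (subst nn_integral_cmult) (auto simp: mult_ac)
    finally have "ennreal (F x powr r * w x) * indicator Q x
      \<le> ennreal (2 powr r) * (\<integral>\<^sup>+t. ennreal (w x) * (ennreal (t powr (r - 1)) * indicator {0<..<F x} t) \<partial>lborel) * indicator Q x"
      by (rule mult_right_mono) simp
    also have "\<dots> = ennreal (2 powr r) * (\<integral>\<^sup>+t. \<Phi> x t \<partial>lborel)"
      by (cases "x \<in> Q")
         (auto simp: \<Phi>_def indicator_def mult.commute intro!: arg_cong[where f="(*) (ennreal (2 powr r))"] nn_integral_cong)
    finally show "ennreal (F x powr r * w x) * indicator Q x \<le> ennreal (2 powr r) * (\<integral>\<^sup>+t. \<Phi> x t \<partial>lborel)" .
  qed
  also have "\<dots> = ennreal (2 powr r) * (\<integral>\<^sup>+x. (\<integral>\<^sup>+t. \<Phi> x t \<partial>lborel) \<partial>lborel)"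
    by (rule nn_integral_cmult) measurable
  also have "(\<integral>\<^sup>+x. (\<integral>\<^sup>+t. \<Phi> x t \<partial>lborel) \<partial>lborel) = (\<integral>\<^sup>+t. (\<integral>\<^sup>+x. \<Phi> x t \<partial>lborel) \<partial>lborel)"
    by (rule lborel_pair.Fubini') measurable
  also have "\<dots> = (\<integral>\<^sup>+t\<in>{0<..}. ennreal (t powr (r - 1)) * (\<integral>\<^sup>+x\<in>{x \<in> Q. t < F x}. ennreal (w x) \<partial>lborel) \<partial>lborel)"
  proof (rule nn_integral_cong)
    fix t :: real
    have "(\<integral>\<^sup>+x. \<Phi> x t \<partial>lborel) = ennreal (t powr (r - 1)) * indicator {0<..} t * (\<integral>\<^sup>+x\<in>{x \<in> Q. t < F x}. ennreal (w x) \<partial>lborel)"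
      unfolding \<Phi>_def by (rule nn_integral_cmult) measurable
    then show "(\<integral>\<^sup>+x. \<Phi> x t \<partial>lborel) = ennreal (t powr (r - 1)) * (\<integral>\<^sup>+x\<in>{x \<in> Q. t < F x}. ennreal (w x) \<partial>lborel) * indicator {0<..} t"
      by (simp add: mult_ac)
  qed
  finally show ?thesis .
qed

text \<open>The embedding of Lorentz spaces as the second exponent grows from \<open>p\<close> to
  \<open>r\<close>. Monotonicity of \<open>\<mu>\<close> on the interval from \<open>t / 2\<close>
  to \<open>t\<close> turns the integral bound into a pointwise one, \<open>weak\<close>; its power
  \<open>(r - p) / p\<close> is taken out of the strong integrand and the rest is the given
  integral.\<close>

lemma lorentz_to_strong:
  fixes \<mu> :: "real \<Rightarrow> real"
  assumes \<mu>: "\<And>t. 0 \<le> \<mu> t" "\<And>s t. s \<le> t \<Longrightarrow> \<mu> t \<le> \<mu> s" and p: "1 \<le> p" "p \<le> r" and L: "0 < L"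
    and le: "(\<integral>\<^sup>+t\<in>{0<..}. ennreal (t powr (p - 1)) * ennreal (\<mu> t powr (p / r)) \<partial>lborel) \<le> ennreal (L powr p)"
    and meas: "\<mu> \<in> borel_measurable borel"
  shows "(\<integral>\<^sup>+t\<in>{0<..}. ennreal (t powr (r - 1)) * ennreal (\<mu> t) \<partial>lborel) \<le> ennreal ((2 * L) powr r)"
proof -
  note meas[measurable]
  have r: "1 \<le> r" using p by simp
  have weak: "t powr p * \<mu> t powr (p / r) \<le> (2 * L) powr p" if t: "0 < t" for t
  proof -
    have "ennreal ((t / 2) powr (p - 1) * \<mu> t powr (p / r) * (t / 2))
      = (\<integral>\<^sup>+s. ennreal ((t / 2) powr (p - 1) * \<mu> t powr (p / r)) * indicator {t / 2<..t} s \<partial>lborel)"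
      using t by (subst nn_integral_cmult_indicator) (auto simp flip: ennreal_mult)
    also have "\<dots> \<le> (\<integral>\<^sup>+s\<in>{0<..}. ennreal (s powr (p - 1)) * ennreal (\<mu> s powr (p / r)) \<partial>lborel)"
    proof (rule nn_integral_mono)
      fix s
      show "ennreal ((t / 2) powr (p - 1) * \<mu> t powr (p / r)) * indicator {t / 2<..t} s
        \<le> ennreal (s powr (p - 1)) * ennreal (\<mu> s powr (p / r)) * indicator {0<..} s"
      proof (cases "s \<in> {t / 2<..t}")
        case True
        then have "(t / 2) powr (p - 1) * \<mu> t powr (p / r) \<le> s powr (p - 1) * \<mu> s powr (p / r)"
          using t p \<mu> by (intro mult_mono powr_mono2) auto
        then show ?thesis using True t by (simp add: ennreal_leI flip: ennreal_mult)
      qed simp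
    qed
    also note le
    finally have "(t / 2) powr (p - 1) * \<mu> t powr (p / r) * (t / 2) \<le> L powr p"
      by (subst (asm) ennreal_le_iff) auto
    moreover have "(t / 2) powr p = (t / 2) powr (p - 1) * (t / 2)"
      using t powr_add[of "t / 2" "p - 1" 1] by simp
    ultimately have "(t / 2) powr p * \<mu> t powr (p / r) \<le> L powr p" by (simp only: mult_ac)
    then have "2 powr p * ((t / 2) powr p * \<mu> t powr (p / r)) \<le> 2 powr p * L powr p" by (rule mult_left_mono) simp
    then show ?thesis using t L by (simp add: powr_divide powr_mult)
  qed
  have pt: "t powr (r - 1) * \<mu> t \<le> (2 * L) powr (r - p) * (t powr (p - 1) * \<mu> t powr (p / r))" if t: "0 < t" for t
  proof (cases "\<mu> t = 0")
    case False
    then have m: "0 < \<mu> t" using \<mu>(1)[of t] by simp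
    have "(t powr p * \<mu> t powr (p / r)) powr ((r - p) / p) \<le> ((2 * L) powr p) powr ((r - p) / p)"
      using weak[OF t] p by (intro powr_mono2) auto
    moreover have "((2 * L) powr p) powr ((r - p) / p) = (2 * L) powr (r - p)"
      using p by (simp add: powr_powr)
    moreover have "(t powr p * \<mu> t powr (p / r)) powr ((r - p) / p) = t powr (r - p) * \<mu> t powr (1 - p / r)"
    proof -
      have e: "p / r * ((r - p) / p) = 1 - p / r" "p * ((r - p) / p) = r - p" using p by (auto simp: field_simps)
      show ?thesis using t m by (simp only: powr_mult powr_powr e)
    qed
    ultimately have "t powr (r - p) * \<mu> t powr (1 - p / r) \<le> (2 * L) powr (r - p)" by simp
    then have "(t powr (r - p) * \<mu> t powr (1 - p / r)) * (t powr (p - 1) * \<mu> t powr (p / r))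
      \<le> (2 * L) powr (r - p) * (t powr (p - 1) * \<mu> t powr (p / r))" by (rule mult_right_mono) simp
    moreover have "(t powr (r - p) * \<mu> t powr (1 - p / r)) * (t powr (p - 1) * \<mu> t powr (p / r)) = t powr (r - 1) * \<mu> t"
    proof -
      have "t powr (r - p) * t powr (p - 1) = t powr (r - 1)" by (simp flip: powr_add)
      moreover have "\<mu> t powr (1 - p / r) * \<mu> t powr (p / r) = \<mu> t" using m by (simp flip: powr_add)
      ultimately show ?thesis by (metis mult.assoc mult.left_commute)
    qed
    ultimately show ?thesis by simp
  qed simp
  have "(\<integral>\<^sup>+t\<in>{0<..}. ennreal (t powr (r - 1)) * ennreal (\<mu> t) \<partial>lborel)
    \<le> (\<integral>\<^sup>+t. ennreal ((2 * L) powr (r - p)) * (ennreal (t powr (p - 1)) * ennreal (\<mu> t powr (p / r)) * indicator {0<..} t) \<partial>lborel)"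
  proof (rule nn_integral_mono)
    fix t :: real
    show "ennreal (t powr (r - 1)) * ennreal (\<mu> t) * indicator {0<..} t
      \<le> ennreal ((2 * L) powr (r - p)) * (ennreal (t powr (p - 1)) * ennreal (\<mu> t powr (p / r)) * indicator {0<..} t)"
      using pt[of t] \<mu>(1)[of t] by (cases "0 < t") (auto simp: ennreal_leI simp flip: ennreal_mult)
  qed
  also have "\<dots> = ennreal ((2 * L) powr (r - p)) * (\<integral>\<^sup>+t\<in>{0<..}. ennreal (t powr (p - 1)) * ennreal (\<mu> t powr (p / r)) \<partial>lborel)"
    by (rule nn_integral_cmult) measurable
  also have "\<dots> \<le> ennreal ((2 * L) powr (r - p)) * ennreal (L powr p)" using le by (rule mult_left_mono) simp
  also have "\<dots> \<le> ennreal ((2 * L) powr (r - p)) * ennreal ((2 * L) powr p)"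
    using L p by (intro mult_left_mono ennreal_leI powr_mono2) auto
  also have "\<dots> = ennreal ((2 * L) powr r)" by (simp flip: ennreal_mult powr_add)
  finally show ?thesis .
qed

text \<open>The factor 4 consists of one 2 from the layer-cake inequality and one from
  \<open>lorentz_to_strong\<close>.\<close>

lemma weighted_strong_sobolev:
  fixes w f :: "real^'n \<Rightarrow> real" and a :: "real^'n" and c :: real
  assumes lw: "locally_integrable_borel w" and wp: "\<And>x. 0 < w x" and f: "f \<in> borel_measurable borel"
    and l: "0 < l" and p: "1 \<le> p" "p \<le> r" and L: "0 < L"
  defines "\<mu> \<equiv> \<lambda>t. enn2real (\<integral>\<^sup>+x\<in>{x \<in> hcube a l. t < \<bar>f x - c\<bar>}. ennreal (w x) \<partial>lborel) / (hmean w a l * l ^ CARD('n))"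
  assumes le: "(\<integral>\<^sup>+t\<in>{0<..}. ennreal (t powr (p - 1)) * ennreal (\<mu> t powr (p / r)) \<partial>lborel) \<le> ennreal (L powr p)"
  shows "(\<integral>\<^sup>+x\<in>hcube a l. ennreal (\<bar>f x - c\<bar> powr r * w x) \<partial>lborel) \<le> ennreal ((4 * L) powr r * (hmean w a l * l ^ CARD('n)))"
proof -
  note f[measurable]
  have [measurable]: "w \<in> borel_measurable borel" using lw by measurable
  define W where "W = hmean w a l * l ^ CARD('n)"
  have W: "0 < W" unfolding W_def using l by (intro mult_pos_pos hmean_pos[OF lw wp l]) auto
  have Wint: "(\<integral>\<^sup>+x\<in>hcube a l. ennreal (w x) \<partial>lborel) = ennreal W"
    unfolding W_def by (rule nn_integral_hcube_eq[OF lw less_imp_le[OF wp] l])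
  define M where "M t = (\<integral>\<^sup>+x\<in>{x \<in> hcube a l. t < \<bar>f x - c\<bar>}. ennreal (w x) \<partial>lborel)" for t
  have \<mu>: "\<mu> t = enn2real (M t) / W" for t by (simp add: \<mu>_def M_def W_def)
  have Mle: "M t \<le> ennreal W" for t
    unfolding M_def Wint[symmetric] by (intro nn_integral_mono) (auto simp: indicator_def)
  have Mfin: "M t < top" for t using Mle[of t] by (rule le_less_trans) simp
  have Mmono: "M t \<le> M s" if "s \<le> t" for s t
    unfolding M_def using that by (intro nn_integral_mono) (auto simp: indicator_def)
  have \<mu>0: "0 \<le> \<mu> t" for t using W by (simp add: \<mu>)
  have \<mu>mono: "\<mu> t \<le> \<mu> s" if "s \<le> t" for s t
    unfolding \<mu> using W enn2real_mono[OF Mmono[OF that] Mfin] by (intro divide_right_mono) auto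
  have "mono (\<lambda>t. - \<mu> t)" using \<mu>mono by (auto simp: mono_def)
  then have "(\<lambda>t. - \<mu> t) \<in> borel_measurable borel" by (rule borel_measurable_mono)
  then have \<mu>meas[measurable]: "\<mu> \<in> borel_measurable borel" by simp
  have M\<mu>: "M t = ennreal W * ennreal (\<mu> t)" for t
    using W Mfin[of t] by (simp add: \<mu> flip: ennreal_mult)
  have "(\<integral>\<^sup>+x\<in>hcube a l. ennreal (\<bar>f x - c\<bar> powr r * w x) \<partial>lborel)
    \<le> ennreal (2 powr r) * (\<integral>\<^sup>+t\<in>{0<..}. ennreal (t powr (r - 1)) * M t \<partial>lborel)"
    unfolding M_def using p by (intro layer_cake_le) (auto simp: less_imp_le[OF wp])
  also have "(\<integral>\<^sup>+t\<in>{0<..}. ennreal (t powr (r - 1)) * M t \<partial>lborel)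
    = (\<integral>\<^sup>+t. ennreal W * (ennreal (t powr (r - 1)) * ennreal (\<mu> t) * indicator {0<..} t) \<partial>lborel)"
    by (intro nn_integral_cong) (simp add: M\<mu> mult_ac)
  also have "\<dots> = ennreal W * (\<integral>\<^sup>+t\<in>{0<..}. ennreal (t powr (r - 1)) * ennreal (\<mu> t) \<partial>lborel)"
    by (rule nn_integral_cmult) measurable
  also have "ennreal (2 powr r) * \<dots> \<le> ennreal (2 powr r) * (ennreal W * ennreal ((2 * L) powr r))"
    by (intro mult_left_mono lorentz_to_strong[OF \<mu>0 \<mu>mono p L le \<mu>meas]) auto
  also have "\<dots> = ennreal (2 powr r * (2 * L) powr r * W)" using W by (simp add: ennreal_mult mult_ac)
  also have "2 powr r * (2 * L) powr r = (4 * L) powr r" using L by (simp flip: powr_mult)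
  finally show ?thesis by (simp add: W_def)
qed

subsection \<open>Passage from Lebesgue to Borel functions\<close>

text \<open>Local integrability speaks about compact sets only. Global measurability follows since
  \<open>f\<close> is the pointwise limit of its restrictions to growing boxes; then a Borel
  function that agrees with \<open>f\<close> almost everywhere exists.\<close>

lemma borel_version:
  fixes f :: "real^'n \<Rightarrow> real"
  assumes f: "locally_integrable f"
  shows "f \<in> borel_measurable lebesgue"
    and "\<exists>f0. locally_integrable_borel f0 \<and> (AE x in lborel. f x = f0 x)"
proof -
  have si: "set_integrable lebesgue (cbox a b) f" for a b
    using f compact_cbox[of a b] unfolding locally_integrable_def by blast
  show meas: "f \<in> borel_measurable lebesgue"
  proof (rule borel_measurable_LIMSEQ_real[where u="\<lambda>k x. indicator (cbox (- vec (real k)) (vec (real k))) x *\<^sub>R f x"])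
    fix x :: "real^'n"
    obtain K :: nat where K: "norm x \<le> real K" using real_arch_simple by blast
    have "x \<in> cbox (- vec (real k)) (vec (real k))" if "K \<le> k" for k
    proof -
      have "\<bar>x $ i\<bar> \<le> real k" for i using component_le_norm_cart[of x i] K that by linarith
      then have "- real k \<le> x $ i" "x $ i \<le> real k" for i by (simp_all add: abs_le_iff minus_le_iff)
      then show ?thesis by (simp add: mem_box_cart)
    qed
    then have "\<forall>\<^sub>F k in sequentially. indicator (cbox (- vec (real k)) (vec (real k))) x *\<^sub>R f x = f x"
      unfolding eventually_sequentially by (intro exI[of _ K]) simp
    then show "(\<lambda>k. indicator (cbox (- vec (real k)) (vec (real k))) x *\<^sub>R f x) \<longlonglongrightarrow> f x"
      by (rule tendsto_eventually)
  next
    show "(\<lambda>x. indicator (cbox (- vec (real k)) (vec (real k))) x *\<^sub>R f x) \<in> borel_measurable lebesgue" for k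
      using si unfolding set_integrable_def by (rule borel_measurable_integrable)
  qed
  obtain f0 where f0: "f0 \<in> borel_measurable lborel" "AE x in lborel. f x = f0 x"
    using completion_ex_borel_measurable_real[OF meas] by blast
  have "set_integrable lborel (cbox a b) f0" for a b
  proof -
    have [measurable]: "f0 \<in> borel_measurable borel" using f0 by simp
    have "integrable lebesgue (\<lambda>x. indicator (cbox a b) x *\<^sub>R f0 x)"
    proof (rule integrable_cong_AE_imp)
      show "integrable lebesgue (\<lambda>x. indicator (cbox a b) x *\<^sub>R f x)" using si by (simp add: set_integrable_def)
      show "(\<lambda>x. indicator (cbox a b) x *\<^sub>R f0 x) \<in> borel_measurable lebesgue" by (rule measurable_completion) measurable
      show "AE x in lebesgue. indicator (cbox a b) x *\<^sub>R f x = indicator (cbox a b) x *\<^sub>R f0 x"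
        using AE_completion[OF f0(2)] by eventually_elim simp
    qed
    then show ?thesis unfolding set_integrable_def by (subst (asm) integrable_completion) measurable
  qed
  then show "\<exists>f0. locally_integrable_borel f0 \<and> (AE x in lborel. f x = f0 x)"
    using f0 by (auto simp: locally_integrable_borel_def)
qed

lemma weight_borel_version:
  fixes w :: "real^'n \<Rightarrow> real"
  assumes w: "weight w"
  obtains w0 where "locally_integrable_borel w0" "\<And>x. 0 < w0 x" "AE x in lborel. w x = w0 x"
proof -
  have "locally_integrable w" using w by (simp add: weight_def)
  from borel_version(2)[OF this] obtain v where v: "locally_integrable_borel v" "AE x in lborel. w x = v x" by blast
  have [measurable]: "v \<in> borel_measurable borel" using v by measurable
  \<comment> \<open>The value 1 replaces nonpositive values on a null set, so that strict positivity
    holds everywhere and real powers of the weight behave.\<close>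
  define w0 where "w0 x = (if 0 < v x then v x else 1)" for x
  have [measurable]: "w0 \<in> borel_measurable borel" unfolding w0_def by measurable
  have "AE x in lborel. 0 < w x" using w unfolding weight_def AE_completion_iff by blast
  with v(2) have ae: "AE x in lborel. v x = w0 x" by eventually_elim (simp add: w0_def)
  have "set_integrable lborel (cbox a b) w0" for a b
    unfolding set_integrable_def
  proof (rule integrable_cong_AE_imp)
    show "integrable lborel (\<lambda>x. indicator (cbox a b) x *\<^sub>R v x)"
      using v(1) by (simp add: locally_integrable_borel_def set_integrable_def)
    show "AE x in lborel. indicator (cbox a b) x *\<^sub>R v x = indicator (cbox a b) x *\<^sub>R w0 x"
      using ae by eventually_elim simp
  qed measurable
  then have "locally_integrable_borel w0" by (simp add: locally_integrable_borel_def)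
  moreover have "AE x in lborel. w x = w0 x" using v(2) ae by eventually_elim simp
  moreover have "0 < w0 x" for x by (simp add: w0_def)
  ultimately show ?thesis using that by blast
qed

lemma nn_integral_lebesgue_cube:
  fixes F F0 :: "real^'n \<Rightarrow> ennreal"
  assumes "0 < l" "AE x in lborel. F x = F0 x"
  shows "(\<integral>\<^sup>+x\<in>cube a l. F x \<partial>lebesgue) = (\<integral>\<^sup>+x\<in>hcube a l. F0 x \<partial>lborel)"
proof -
  have "(\<integral>\<^sup>+x\<in>cube a l. F x \<partial>lebesgue) = (\<integral>\<^sup>+x\<in>cbox a (a + vec l). F x \<partial>lborel)"
    by (simp add: nn_integral_completion cube_def)
  also have "\<dots> = (\<integral>\<^sup>+x\<in>hcube a l. F x \<partial>lborel)" by (rule nn_integral_cbox_eq_hcube[OF assms(1)])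
  also have "\<dots> = (\<integral>\<^sup>+x\<in>hcube a l. F0 x \<partial>lborel)"
    by (rule nn_integral_cong_AE) (use assms(2) in \<open>eventually_elim, simp\<close>)
  finally show ?thesis .
qed

lemma emeasure_lebesgue_cube:
  fixes a :: "real^'n"
  assumes "0 < l"
  shows "emeasure lebesgue (cube a l) = ennreal (l ^ CARD('n))"
proof -
  have "cube a l \<in> sets lborel" by (simp add: cube_def)
  then have "emeasure lebesgue (cube a l) = emeasure lborel (cube a l)" by simp
  also have "\<dots> = ennreal (l ^ CARD('n))"
    unfolding cube_def by (rule emeasure_lborel_cbox_vec[OF less_imp_le[OF assms]])
  finally show ?thesis .
qed

section \<open>The maximal function and the Fujii-Wilson constant\<close>

lemma maximal_function_ge_emean:
  assumes "0 < l" "x \<in> cube a l"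
  shows "(\<integral>\<^sup>+y\<in>cube a l. ennreal \<bar>f y\<bar> \<partial>lebesgue) / ennreal (l ^ CARD('n)) \<le> maximal_function f (x :: real^'n)"
proof -
  have "cube a l \<in> {Q \<in> cubes. x \<in> Q}" using assms by (auto simp: cubes_def)
  then have "cube_emean (\<lambda>y. ennreal \<bar>f y\<bar>) (cube a l) \<le> maximal_function f x"
    unfolding maximal_function_def by (rule SUP_upper)
  then show ?thesis using assms(1) by (simp add: cube_emean_def emeasure_lebesgue_cube)
qed

text \<open>On the cube of side \<open>2 * \<rho>\<close> centred at \<open>x\<close>, the value
  \<open>\<bar>v x\<bar>\<close> is at most the mean of \<open>\<bar>v\<bar>\<close> plus the mean
  of \<open>\<bar>v y - v x\<bar>\<close>. The first is below the maximal function, the second below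
  \<open>mean_osc v \<rho> x\<close>, which tends to zero along a subsequence of radii.\<close>

lemma maximal_function_ge_AE:
  fixes h v :: "real^'n \<Rightarrow> real"
  assumes v: "locally_integrable_borel v" and hv: "AE x in lborel. h x = v x"
  shows "AE x in lborel. x \<in> cbox a b \<longrightarrow> ennreal \<bar>v x\<bar> \<le> maximal_function h x"
proof -
  have [measurable]: "v \<in> borel_measurable borel" using v by measurable
  let ?n = "CARD('n)"
  define r where "r k = 1 / real (Suc k)" for k
  have r: "r \<longlonglongrightarrow> 0" "\<And>k. 0 < r k"
    unfolding r_def using LIMSEQ_inverse_real_of_nat by (auto simp: inverse_eq_divide)
  have hv': "AE x in lborel. ennreal \<bar>h x\<bar> = ennreal \<bar>v x\<bar>" using hv by eventually_elim simp
  obtain s :: "nat \<Rightarrow> nat" where s: "AE x in lborel. x \<in> cbox a b \<longrightarrow> (\<lambda>k. mean_osc v (r (s k)) x) \<longlonglongrightarrow> 0"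
    by (rule mean_osc_AE_subseq[OF v r])
  have bound: "ennreal \<bar>v x\<bar> \<le> maximal_function h x + mean_osc v \<rho> x" if \<rho>: "0 < \<rho>" for x \<rho>
  proof -
    let ?c = "x - vec \<rho>" and ?l = "2 * \<rho>"
    let ?Q = "cbox ?c (?c + vec ?l)" and ?V = "ennreal (?l ^ ?n)"
    have l: "0 < ?l" using \<rho> by simp
    have "x \<in> cube ?c ?l" using \<rho> by (auto simp: cube_def mem_box_cart)
    from maximal_function_ge_emean[OF l this, of h]
    have 1: "(\<integral>\<^sup>+y\<in>?Q. ennreal \<bar>v y\<bar> \<partial>lborel) / ?V \<le> maximal_function h x"
      unfolding nn_integral_lebesgue_cube[OF l hv'] nn_integral_cbox_eq_hcube[OF l] .
    have 2: "(\<integral>\<^sup>+y\<in>?Q. ennreal \<bar>v y - v x\<bar> \<partial>lborel) = (\<integral>\<^sup>+z\<in>cbox (- vec \<rho>) (vec \<rho>). ennreal \<bar>v (x + z) - v x\<bar> \<partial>lborel)"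
    proof -
      have "(\<integral>\<^sup>+y\<in>?Q. ennreal \<bar>v y - v x\<bar> \<partial>lborel) = (\<integral>\<^sup>+z. ennreal \<bar>v (z + x) - v x\<bar> * indicator ?Q (z + x) \<partial>lborel)"
        by (rule nn_integral_lborel_shift[symmetric, where f="\<lambda>y. ennreal \<bar>v y - v x\<bar> * indicator ?Q y"]) measurable
      moreover have "z + x \<in> ?Q \<longleftrightarrow> z \<in> cbox (- vec \<rho>) (vec \<rho>)" for z
        unfolding mem_box_cart by (intro all_cong1) auto
      ultimately show ?thesis by (simp only: indicator_def add.commute[of x])
    qed
    have "ennreal \<bar>v x\<bar> * ?V = (\<integral>\<^sup>+y\<in>?Q. ennreal \<bar>v x\<bar> \<partial>lborel)"
      using emeasure_lborel_cbox_vec[of ?l ?c] l by (subst nn_integral_cmult_indicator) auto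
    also have "\<dots> \<le> (\<integral>\<^sup>+y. (ennreal \<bar>v y\<bar> * indicator ?Q y + ennreal \<bar>v y - v x\<bar> * indicator ?Q y) \<partial>lborel)"
      by (intro nn_integral_mono) (auto simp: indicator_def simp flip: ennreal_plus)
    also have "\<dots> = (\<integral>\<^sup>+y\<in>?Q. ennreal \<bar>v y\<bar> \<partial>lborel) + (\<integral>\<^sup>+y\<in>?Q. ennreal \<bar>v y - v x\<bar> \<partial>lborel)"
      by (rule nn_integral_add) measurable
    finally have "ennreal \<bar>v x\<bar> * ?V / ?V \<le> ((\<integral>\<^sup>+y\<in>?Q. ennreal \<bar>v y\<bar> \<partial>lborel) + (\<integral>\<^sup>+y\<in>?Q. ennreal \<bar>v y - v x\<bar> \<partial>lborel)) / ?V"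
      by (rule divide_right_mono_ennreal)
    also have "\<dots> = (\<integral>\<^sup>+y\<in>?Q. ennreal \<bar>v y\<bar> \<partial>lborel) / ?V + (\<integral>\<^sup>+y\<in>?Q. ennreal \<bar>v y - v x\<bar> \<partial>lborel) / ?V"
      by (simp add: add_divide_distrib_ennreal)
    finally have 3: "ennreal \<bar>v x\<bar> * ?V / ?V
      \<le> (\<integral>\<^sup>+y\<in>?Q. ennreal \<bar>v y\<bar> \<partial>lborel) / ?V + (\<integral>\<^sup>+y\<in>?Q. ennreal \<bar>v y - v x\<bar> \<partial>lborel) / ?V" .
    have "\<rho> ^ ?n \<le> ?l ^ ?n" using \<rho> by (intro power_mono) auto
    then have "inverse (?l ^ ?n) \<le> inverse (\<rho> ^ ?n)" by (rule le_imp_inverse_le) (use \<rho> in simp)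
    then have "ennreal (inverse (?l ^ ?n)) \<le> ennreal (inverse (\<rho> ^ ?n))" by (rule ennreal_leI)
    moreover have "inverse ?V = ennreal (inverse (?l ^ ?n))"
      by (rule inverse_ennreal[OF zero_less_power[OF l]])
    moreover have "inverse (ennreal (\<rho> ^ ?n)) = ennreal (inverse (\<rho> ^ ?n))"
      by (rule inverse_ennreal[OF zero_less_power[OF \<rho>]])
    ultimately have "inverse ?V \<le> inverse (ennreal (\<rho> ^ ?n))" by (simp only:)
    then have 4: "(\<integral>\<^sup>+y\<in>?Q. ennreal \<bar>v y - v x\<bar> \<partial>lborel) / ?V \<le> mean_osc v \<rho> x"
      unfolding mean_osc_def 2 divide_ennreal_def by (rule mult_left_mono) simp
    have 5: "ennreal \<bar>v x\<bar> * ?V / ?V = ennreal \<bar>v x\<bar>"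
      by (rule mult_divide_eq_ennreal) (use l in auto)
    show ?thesis using order_trans[OF 3 add_mono[OF 1 4]] unfolding 5 .
  qed
  show ?thesis
    using s
  proof eventually_elim
    case (elim x)
    show ?case
    proof
      assume "x \<in> cbox a b"
      then have "(\<lambda>k. mean_osc v (r (s k)) x) \<longlonglongrightarrow> 0" using elim by (rule rev_mp)
      from tendsto_add[OF tendsto_const this]
      have "(\<lambda>k. maximal_function h x + mean_osc v (r (s k)) x) \<longlonglongrightarrow> maximal_function h x + 0" .
      then have "ennreal \<bar>v x\<bar> \<le> maximal_function h x + 0"
        by (rule LIMSEQ_le_const) (intro exI[of _ 0] allI impI bound r(2))
      then show "ennreal \<bar>v x\<bar> \<le> maximal_function h x" by simp
    qed
  qed
qed

lemma FW_almost_constant: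
  fixes w w0 :: "real^'n \<Rightarrow> real"
  assumes w0: "locally_integrable_borel w0" "\<And>x. 0 < w0 x" and ae: "AE x in lborel. w x = w0 x"
    and fin: "FW_const w < top"
  defines "\<delta> \<equiv> enn2real (FW_const w) - 1"
  shows "0 \<le> \<delta>" "almost_constant \<delta> w0"
proof -
  let ?n = "CARD('n)"
  have [measurable]: "w0 \<in> borel_measurable borel" using w0 by measurable
  have FW: "FW_const w = ennreal (1 + \<delta>)" using fin by (simp add: \<delta>_def)
  have key: "ennreal (hmean w0 a l * l ^ ?n) + (\<integral>\<^sup>+x\<in>hcube a l. ennreal (hmean w0 a l - w0 x) \<partial>lborel)
      \<le> FW_const w * ennreal (hmean w0 a l * l ^ ?n)" if l: "0 < l" for a l
  proof -
    let ?m = "hmean w0 a l" and ?V = "ennreal (l ^ ?n)" and ?Q = "cbox a (a + vec l)"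
    define h where "h y = w y * indicator (cube a l) y" for y
    define v where "v y = w0 y * indicator (cbox a (a + vec l)) y" for y
    have m: "0 < ?m" by (rule hmean_pos[OF w0 l])
    have [measurable]: "v \<in> borel_measurable borel" unfolding v_def by measurable
    have vm: "v \<in> borel_measurable borel" unfolding v_def by measurable
    have "set_integrable lborel (cbox c d) v" for c d
    proof -
      have "set_integrable lborel (cbox c d) w0" using w0(1) by (simp add: locally_integrable_borel_def)
      then have "set_integrable lborel (cbox c d \<inter> ?Q) w0" by (rule set_integrable_subset) simp_all
      then have "integrable lborel (\<lambda>x. indicator (cbox c d \<inter> ?Q) x *\<^sub>R w0 x)" by (simp only: set_integrable_def)
      moreover have "(\<lambda>x. indicator (cbox c d \<inter> ?Q) x *\<^sub>R w0 x) = (\<lambda>x. indicator (cbox c d) x *\<^sub>R v x)"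
        by (rule ext) (simp add: v_def indicator_inter_arith)
      ultimately show ?thesis by (simp only: set_integrable_def)
    qed
    with vm have v: "locally_integrable_borel v" by (simp add: locally_integrable_borel_def)
    have hv: "AE x in lborel. h x = v x"
      using ae by eventually_elim (simp add: h_def v_def cube_def)
    have hv': "AE x in lborel. ennreal \<bar>h x\<bar> = ennreal \<bar>v x\<bar>" using hv by eventually_elim simp
    have W: "(\<integral>\<^sup>+x\<in>hcube a l. ennreal (w0 x) \<partial>lborel) = ennreal (?m * l ^ ?n)"
      by (rule nn_integral_hcube_eq[OF w0(1) less_imp_le[OF w0(2)] l])
    have Ww: "weight_of w (cube a l) = ennreal (?m * l ^ ?n)"
      unfolding weight_of_def W[symmetric] by (rule nn_integral_lebesgue_cube[OF l]) (use ae in \<open>eventually_elim, simp\<close>)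
    have M1: "AE x in lborel. x \<in> ?Q \<longrightarrow> ennreal (w0 x) \<le> maximal_function h x"
      using maximal_function_ge_AE[OF v hv, of a "a + vec l"]
    proof eventually_elim
      case (elim x)
      then show ?case using w0(2)[of x] by (auto simp: v_def abs_of_pos)
    qed
    have M2: "ennreal ?m \<le> maximal_function h x" if "x \<in> ?Q" for x
    proof -
      have "x \<in> cube a l" using that by (simp add: cube_def)
      from maximal_function_ge_emean[OF l this, of h]
      have "(\<integral>\<^sup>+x\<in>hcube a l. ennreal \<bar>v x\<bar> \<partial>lborel) / ?V \<le> maximal_function h x"
        unfolding nn_integral_lebesgue_cube[OF l hv'] .
      moreover have "(\<integral>\<^sup>+x\<in>hcube a l. ennreal \<bar>v x\<bar> \<partial>lborel) = (\<integral>\<^sup>+x\<in>hcube a l. ennreal (w0 x) \<partial>lborel)"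
        using hcube_subset_cbox[of a l] w0(2)
        by (intro nn_integral_cong) (auto simp: v_def indicator_def abs_of_pos)
      moreover have "ennreal (?m * l ^ ?n) / ?V = ennreal ?m" using l m by (simp add: divide_ennreal)
      ultimately show ?thesis using W by simp
    qed
    have "ennreal (?m * l ^ ?n) + (\<integral>\<^sup>+x\<in>hcube a l. ennreal (?m - w0 x) \<partial>lborel)
      = (\<integral>\<^sup>+x. (ennreal (w0 x) * indicator (hcube a l) x + ennreal (?m - w0 x) * indicator (hcube a l) x) \<partial>lborel)"
      unfolding W[symmetric] by (rule nn_integral_add[symmetric]) measurable
    also have "\<dots> \<le> (\<integral>\<^sup>+x\<in>?Q. maximal_function h x \<partial>lborel)"
    proof (rule nn_integral_mono_AE)
      show "AE x in lborel. ennreal (w0 x) * indicator (hcube a l) x + ennreal (?m - w0 x) * indicator (hcube a l) x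
          \<le> maximal_function h x * indicator ?Q x"
        using M1
      proof eventually_elim
        case (elim x)
        show ?case
        proof (cases "x \<in> hcube a l")
          case True
          then have x: "x \<in> ?Q" using hcube_subset_cbox by blast
          \<comment> \<open>In \<open>ennreal\<close> a negative difference counts as 0, so the
            second summand is the positive part of the deficit and the sum is a maximum; both of its
            arguments lie below the maximal function.\<close>
          have "ennreal (w0 x) + ennreal (?m - w0 x) = ennreal (max (w0 x) ?m)"
            using w0(2)[of x] by (cases "w0 x \<le> ?m") (auto simp: ennreal_neg max_def simp flip: ennreal_plus)
          also have "\<dots> \<le> maximal_function h x" using elim M2 x by (simp add: max_def)
          finally show ?thesis using True x by simp
        qed simp
      qed
    qed
    also have "\<dots> = (\<integral>\<^sup>+x\<in>cube a l. maximal_function h x \<partial>lebesgue)"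
      by (simp add: nn_integral_completion cube_def)
    also have "\<dots> \<le> FW_const w * ennreal (?m * l ^ ?n)"
    proof -
      have "cube a l \<in> cubes" using l by (auto simp: cubes_def)
      then have "(\<integral>\<^sup>+x\<in>cube a l. maximal_function h x \<partial>lebesgue) / ennreal (?m * l ^ ?n) \<le> FW_const w"
        unfolding FW_const_def h_def Ww[symmetric] by (rule SUP_upper)
      then have "(\<integral>\<^sup>+x\<in>cube a l. maximal_function h x \<partial>lebesgue) / ennreal (?m * l ^ ?n) * ennreal (?m * l ^ ?n)
          \<le> FW_const w * ennreal (?m * l ^ ?n)" by (rule mult_right_mono) simp
      moreover have "ennreal (?m * l ^ ?n) / ennreal (?m * l ^ ?n) = 1" using m l by (simp add: divide_ennreal)
      ultimately show ?thesis by (simp only: ennreal_divide_times mult_1_right)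
    qed
    finally show ?thesis .
  qed
  show \<delta>: "0 \<le> \<delta>"
  proof -
    \<comment> \<open>On the unit cube, \<open>key\<close> without the deficit term reads
      \<open>W \<le> (1 + \<delta>) * W\<close>, which is the bound of the constant from below by
      1.\<close>
    define W where "W = hmean w0 0 1 * 1 ^ ?n"
    have W: "0 < W" unfolding W_def using hmean_pos[OF w0, of 1 0] by simp
    have "ennreal W \<le> ennreal W + (\<integral>\<^sup>+x\<in>hcube 0 1. ennreal (hmean w0 0 1 - w0 x) \<partial>lborel)"
      by (rule add_increasing2) simp_all
    also have "\<dots> \<le> ennreal (1 + \<delta>) * ennreal W"
      using key[OF zero_less_one, of 0] unfolding W_def FW .
    also have "\<dots> = ennreal ((1 + \<delta>) * W)" by (rule ennreal_mult''[symmetric]) (use W in simp)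
    finally have "W \<le> (1 + \<delta>) * W \<or> W \<le> 0" by (auto simp: ennreal_le_iff2)
    with W show ?thesis by auto
  qed
  show "almost_constant \<delta> w0"
    unfolding almost_constant_def
  proof (intro conjI allI impI w0)
    fix a :: "real^'n" and l :: real
    assume l: "0 < l"
    define W where "W = hmean w0 a l * l ^ ?n"
    have W: "0 < W" unfolding W_def using hmean_pos[OF w0 l] l by simp
    have "FW_const w * ennreal W = ennreal W + ennreal (\<delta> * W)"
      using W \<delta> by (simp add: FW distrib_right flip: ennreal_mult ennreal_plus)
    with key[OF l, of a] show "(\<integral>\<^sup>+x\<in>hcube a l. ennreal (hmean w0 a l - w0 x) \<partial>lborel) \<le> ennreal (\<delta> * (hmean w0 a l * l ^ ?n))"
      unfolding W_def[symmetric] by (simp add: ennreal_add_left_cancel_le)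
  qed
qed

section \<open>Weak gradients in terms of Borel representatives\<close>

lemma test_function_continuous:
  assumes "\<phi> \<in> test_functions"
  shows "continuous_on UNIV \<phi>" "continuous_on UNIV (partial_deriv i \<phi>)"
proof -
  have C: "C_k k \<phi>" for k using assms by (simp add: test_functions_def)
  from C[of 0] show "continuous_on UNIV \<phi>" by simp
  from C[of "Suc 0"] show "continuous_on UNIV (partial_deriv i \<phi>)" by simp
qed

lemma integral_lebesgue_eq_lborel:
  fixes F F0 :: "real^'n \<Rightarrow> real"
  assumes "F \<in> borel_measurable lebesgue" "F0 \<in> borel_measurable borel" "AE x in lborel. F x = F0 x"
  shows "(LINT x|lebesgue. F x) = (LINT x|lborel. F0 x)"
proof -
  have m: "F0 \<in> borel_measurable lborel" using assms(2) by simp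
  have "(LINT x|lebesgue. F x) = (LINT x|lebesgue. F0 x)"
    by (rule integral_cong_AE[OF assms(1) measurable_completion[OF m] AE_completion[OF assms(3)]])
  also have "\<dots> = (LINT x|lborel. F0 x)" by (rule integral_completion[OF m])
  finally show ?thesis .
qed

lemma weak_gradient_borel_version:
  fixes f :: "real^'n \<Rightarrow> real" and Df :: "real^'n \<Rightarrow> real^'n"
  assumes f: "locally_integrable f" and D: "has_weak_gradient f Df"
  obtains f0 g where "weak_gradient_borel f0 g" "AE x in lborel. f x = f0 x" "AE x in lborel. Df x = (\<chi> i. g i x)"
proof -
  obtain f0 where f0: "locally_integrable_borel f0" "AE x in lborel. f x = f0 x"
    using borel_version(2)[OF f] by blast
  have Dl: "locally_integrable (\<lambda>x. Df x $ i)" for i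
    unfolding locally_integrable_def
  proof (intro allI impI)
    fix K :: "(real^'n) set" assume "compact K"
    then have "Df absolutely_integrable_on K" using D by (simp add: has_weak_gradient_def locally_integrable_def)
    then have "(\<lambda>x. Df x \<bullet> axis i 1) absolutely_integrable_on K"
      by (rule absolutely_integrable_component)
    then show "(\<lambda>x. Df x $ i) absolutely_integrable_on K" by (simp add: inner_axis)
  qed
  have "\<forall>i. \<exists>g. locally_integrable_borel g \<and> (AE x in lborel. Df x $ i = g x)"
    using borel_version(2)[OF Dl] by blast
  then obtain g where g: "\<And>i. locally_integrable_borel (g i)" "\<And>i. AE x in lborel. Df x $ i = g i x" by metis
  have "AE x in lborel. \<forall>i\<in>UNIV. Df x $ i = g i x"
    by (rule AE_finite_allI) (use g in auto)
  then have Dae: "AE x in lborel. Df x = (\<chi> i. g i x)"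
    by eventually_elim (simp add: vec_eq_iff)
  have "(LINT x|lborel. f0 x * partial_deriv i \<phi> x) = - (LINT x|lborel. g i x * \<phi> x)" if \<phi>: "\<phi> \<in> test_functions" for \<phi> i
  proof -
    have [measurable]: "f0 \<in> borel_measurable borel" "g i \<in> borel_measurable borel" using f0 g by measurable
    have c[measurable]: "\<phi> \<in> borel_measurable borel" "partial_deriv i \<phi> \<in> borel_measurable borel"
      using test_function_continuous[OF \<phi>] by (auto intro: borel_measurable_continuous_onI)
    then have cl: "\<phi> \<in> borel_measurable lebesgue" "partial_deriv i \<phi> \<in> borel_measurable lebesgue"
      by (auto intro: measurable_completion)
    have "(LINT x|lebesgue. f x * partial_deriv i \<phi> x) = (LINT x|lborel. f0 x * partial_deriv i \<phi> x)"
      by (rule integral_lebesgue_eq_lborel)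
         (use borel_version(1)[OF f] cl f0(2) in \<open>auto elim: eventually_mono\<close>)
    moreover have "(LINT x|lebesgue. Df x $ i * \<phi> x) = (LINT x|lborel. g i x * \<phi> x)"
      by (rule integral_lebesgue_eq_lborel)
         (use borel_version(1)[OF Dl] cl g(2)[of i] in \<open>auto elim: eventually_mono\<close>)
    ultimately show ?thesis using D \<phi> by (simp add: has_weak_gradient_def)
  qed
  then have "weak_gradient_borel f0 g" using f0 g by (simp add: weak_gradient_borel_def)
  with that f0 Dae show ?thesis by blast
qed

subsection \<open>The weighted inequality\<close>

lemma epowr_le:
  assumes "x \<le> ennreal y" "0 \<le> y" "0 \<le> a"
  shows "x epowr a \<le> ennreal (y powr a)"
proof -
  have "x < top" using assms(1) by (rule le_less_trans) simp
  moreover have "enn2real x powr a \<le> y powr a"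
    using assms by (intro powr_mono2 enn2real_leI) auto
  ultimately show ?thesis by (auto simp: epowr_def ennreal_leI)
qed

lemma epowr_ennreal: "0 \<le> x \<Longrightarrow> ennreal x epowr a = ennreal (x powr a)"
  by (simp add: epowr_def)

lemma cube_mean_eq_hmean:
  fixes f f0 :: "real^'n \<Rightarrow> real"
  assumes f: "f \<in> borel_measurable lebesgue" and f0: "locally_integrable_borel f0" and ae: "AE x in lborel. f x = f0 x"
    and l: "0 < l"
  shows "cube_mean f (cube a l) = hmean f0 a l"
proof -
  have [measurable]: "f0 \<in> borel_measurable borel" using f0 by measurable
  have c: "cube a l \<in> sets lebesgue" by (simp add: cube_def)
  have "(LINT x:cube a l|lebesgue. f x) = (LINT x:hcube a l|lborel. f0 x)"
    unfolding set_lebesgue_integral_def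
  proof (rule integral_lebesgue_eq_lborel)
    show "(\<lambda>x. indicator (cube a l) x *\<^sub>R f x) \<in> borel_measurable lebesgue"
      using f c by (intro borel_measurable_scaleR borel_measurable_indicator)
    show "AE x in lborel. indicator (cube a l) x *\<^sub>R f x = indicator (hcube a l) x *\<^sub>R f0 x"
      using ae AE_hcube_iff_cbox[OF l, of a] by eventually_elim (simp add: cube_def indicator_def)
  qed measurable
  moreover have "measure lebesgue (cube a l) = l ^ CARD('n)"
    using l by (simp add: measure_def emeasure_lebesgue_cube)
  ultimately show ?thesis by (simp add: cube_mean_def hmean_def)
qed

text \<open>This identifies the distribution function inside \<open>lorentz_norm\<close> with the
  real-valued \<open>\<mu>\<close> of the Borel estimates; finiteness of the mass of the cube makes
  the conversion by \<open>enn2real\<close> lossless.\<close>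

lemma emeasure_weighted_prob:
  fixes w w0 f f0 :: "real^'n \<Rightarrow> real" and a :: "real^'n"
  assumes w: "w \<in> borel_measurable lebesgue" "locally_integrable_borel w0" "\<And>x. 0 < w0 x" "AE x in lborel. w x = w0 x"
    and f: "f \<in> borel_measurable lebesgue" "f0 \<in> borel_measurable borel" "AE x in lborel. f x = f0 x"
    and W: "weight_of w (cube a l) = ennreal W" "0 < W"
    and Wint: "(\<integral>\<^sup>+x\<in>hcube a l. ennreal (w0 x) \<partial>lborel) = ennreal W" and l: "0 < l"
  shows "emeasure (weighted_prob w (cube a l)) {x \<in> space (weighted_prob w (cube a l)). t < \<bar>f x - c\<bar>}
    = ennreal (enn2real (\<integral>\<^sup>+x\<in>{x \<in> hcube a l. t < \<bar>f0 x - c\<bar>}. ennreal (w0 x) \<partial>lborel) / W)"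
proof -
  note w(1)[measurable] f(1,2)[measurable]
  have [measurable]: "w0 \<in> borel_measurable borel" using w(2) by measurable
  let ?Q = "cube a l" and ?L = "lebesgue_on (cube a l)"
  let ?S = "{x \<in> ?Q. t < \<bar>f x - c\<bar>}" and ?T = "{x \<in> hcube a l. t < \<bar>f0 x - c\<bar>}"
  define M where "M = (\<integral>\<^sup>+x\<in>?T. ennreal (w0 x) \<partial>lborel)"
  have Q: "?Q \<in> sets lebesgue" by (simp add: cube_def)
  have sp: "space (weighted_prob w ?Q) = ?Q" by (simp add: weighted_prob_def)
  have fL: "f \<in> borel_measurable ?L" and wL: "w \<in> borel_measurable ?L"
    using f(1) w(1) by (auto intro: measurable_restrict_space1)
  have "{x \<in> space ?L. t < \<bar>f x - c\<bar>} \<in> sets ?L"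
    using fL by measurable
  then have S: "?S \<in> sets ?L" by simp
  have "emeasure (weighted_prob w ?Q) ?S = (\<integral>\<^sup>+x. ennreal (w x) / ennreal W * indicator ?S x \<partial>?L)"
    unfolding weighted_prob_def W(1) by (rule emeasure_density[OF _ S]) (use wL in measurable)
  also have "\<dots> = (\<integral>\<^sup>+x. ennreal (w x) / ennreal W * indicator ?S x * indicator ?Q x \<partial>lebesgue)"
    by (rule nn_integral_restrict_space) (use Q in simp)
  also have "\<dots> = (\<integral>\<^sup>+x. ennreal (w x) / ennreal W * indicator ?S x * indicator ?Q x \<partial>lborel)"
    by (rule nn_integral_completion)
  also have "\<dots> = (\<integral>\<^sup>+x. ennreal (w0 x) * indicator ?T x / ennreal W \<partial>lborel)"
  proof (rule nn_integral_cong_AE)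
    show "AE x in lborel. ennreal (w x) / ennreal W * indicator ?S x * indicator ?Q x = ennreal (w0 x) * indicator ?T x / ennreal W"
      using w(4) f(3) AE_hcube_iff_cbox[OF l, of a]
      by eventually_elim (simp add: cube_def indicator_def)
  qed
  also have "\<dots> = M / ennreal W" unfolding M_def by (rule nn_integral_divide) measurable
  also have "\<dots> = ennreal (enn2real M / W)"
  proof -
    have "M \<le> ennreal W"
      unfolding M_def Wint[symmetric] by (intro nn_integral_mono) (auto simp: indicator_def)
    then have "M < top" by (rule le_less_trans) simp
    then have "M = ennreal (enn2real M)" by simp
    then have "M / ennreal W = ennreal (enn2real M) / ennreal W" by simp
    also have "\<dots> = ennreal (enn2real M / W)" using W(2) by (intro divide_ennreal) auto
    finally show ?thesis .
  qed
  finally show ?thesis unfolding sp M_def .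
qed

text \<open>The estimates are proved for strictly positive bounds \<open>G\<close> on the mean
  energy, while the energy \<open>\<rho>\<close> itself may be zero; continuity of the power at
  \<open>\<rho>\<close> closes the gap.\<close>

lemma le_ennreal_powr_limit:
  fixes X :: ennreal and \<rho> C a :: real
  assumes "\<And>\<epsilon>. 0 < \<epsilon> \<Longrightarrow> X \<le> ennreal (C * (\<rho> + \<epsilon>) powr a)" and \<rho>: "0 \<le> \<rho>" and a: "0 < a"
  shows "X \<le> ennreal (C * \<rho> powr a)"
proof (rule LIMSEQ_le_const)
  have "(\<lambda>k. \<rho> + inverse (real (Suc k))) \<longlonglongrightarrow> \<rho> + 0"
    by (intro tendsto_add tendsto_const LIMSEQ_inverse_real_of_nat)
  then have lim: "(\<lambda>k. \<rho> + inverse (real (Suc k))) \<longlonglongrightarrow> \<rho>" by simp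
  have "(\<lambda>k. (\<rho> + inverse (real (Suc k))) powr a) \<longlonglongrightarrow> \<rho> powr a"
    by (rule tendsto_powr2[OF lim tendsto_const _ a]) (intro always_eventually allI, use \<rho> in simp)
  then show "(\<lambda>k. ennreal (C * (\<rho> + inverse (real (Suc k))) powr a)) \<longlonglongrightarrow> ennreal (C * \<rho> powr a)"
    by (intro tendsto_ennrealI tendsto_mult_left)
  show "\<exists>N. \<forall>k\<ge>N. X \<le> ennreal (C * (\<rho> + inverse (real (Suc k))) powr a)"
    using assms(1) by simp
qed

lemma sobolev_exponent:
  fixes p pw q n :: real
  assumes p: "1 < p" "p < n" and q: "1 \<le> q" and pw: "1 / p - 1 / pw = 1 / n * (1 / q)"
  shows "p \<le> pw" "pw \<le> n * p / (n - p)" "0 < 1 / p - 1 / pw"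
proof -
  have n: "0 < n" using p by simp
  have nq: "n \<le> n * q" using mult_left_mono[OF q, of n] n by simp
  have r1: "0 < 1 / n * (1 / q)" using n q by simp
  then show "0 < 1 / p - 1 / pw" using pw by simp
  have "1 / n * (1 / q) \<le> 1 / n"
    using n q nq by (simp add: divide_le_eq frac_le)
  moreover have "1 / n < 1 / p" using p by (simp add: divide_strict_left_mono)
  \<comment> \<open>Since \<open>1 / q\<close> is at most 1, \<open>1 / pw\<close> is at least
    \<open>1 / p - 1 / n\<close>, the reciprocal of the Sobolev exponent. It is positive because
    \<open>p < n\<close>, and this fixes the sign of \<open>pw\<close>.\<close>
  ultimately have inv: "1 / p - 1 / n \<le> 1 / pw" "0 < 1 / p - 1 / n" using pw by auto
  then have "0 < 1 / pw" by linarith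
  then have pw0: "0 < pw" by simp
  have "1 / pw \<le> 1 / p" using pw r1 by linarith
  then show "p \<le> pw" using pw0 p by (simp add: divide_le_cancel frac_le_eq divide_simps split: if_splits)
  have e: "1 / p - 1 / n = (n - p) / (n * p)" using p n by (simp add: field_simps)
  have "(n - p) / (n * p) * pw \<le> 1"
    using inv(1) pw0 unfolding e by (simp add: le_divide_eq)
  then show "pw \<le> n * p / (n - p)" using p n by (simp add: field_simps)
qed

text \<open>The origin of \<open>\<tau> = 2 ^ (n + 1)\<close>. With
  \<open>y = \<tau> * \<delta>\<close> one has \<open>1 / \<theta> = n * (1 + y)\<close>, and
  \<open>2 powr - y \<le> 1 - y / 2\<close> turns the loss in the exponent into the loss of mean
  from a cube to a child, because \<open>y / 2\<close> is exactly
  \<open>2 ^ n * \<delta>\<close>.\<close>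

lemma doubling_exponent:
  fixes \<delta> :: real
  assumes "0 \<le> \<delta>" "2 ^ n * \<delta> \<le> 1 / 2" "0 < n"
    and \<theta>: "\<theta> = 1 / real n * (1 / (1 + 2 ^ (n + 1) * \<delta>))"
  shows "2 powr - (1 / \<theta>) \<le> (1 - 2 ^ n * \<delta>) / 2 ^ n"
proof -
  define y where "y = 2 * (2 ^ n * \<delta>)"
  have y: "0 \<le> y" "y \<le> 1" using assms by (auto simp: y_def)
  have ny: "y \<le> n * y" using assms(3) y mult_right_mono[of 1 "real n" y] by simp
  have "1 / \<theta> = n + n * y" using assms by (simp add: \<theta> y_def field_simps)
  then have "2 powr - (1 / \<theta>) = 2 powr - real n * 2 powr - (n * y)" by (simp flip: powr_add)
  also have "\<dots> \<le> 2 powr - real n * 2 powr - y"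
    using ny by (intro mult_left_mono powr_mono) auto
  also have "2 powr - y = (1 / 2) powr y" by (simp add: powr_minus_divide powr_divide)
  also have "2 powr - real n * (1 / 2) powr y \<le> 2 powr - real n * (1 - y / 2)"
    using y by (intro mult_left_mono half_powr_le) auto
  also have "\<dots> = (1 - 2 ^ n * \<delta>) / 2 ^ n"
    by (simp add: y_def powr_minus_divide powr_realpow)
  finally show ?thesis .
qed

text \<open>The first entry of the minimum keeps \<open>2 ^ n * \<delta>\<close> below 1/4, as the
  estimates for children need; the second provides the condition for the negative moment of order
  \<open>1 / (p - 1)\<close>. The constant \<open>C\<close> is linear in \<open>pw\<close>, with a
  factor that depends on the dimension only.\<close>

lemma weighted_poincare_sobolev:
  fixes w f :: "real^'n \<Rightarrow> real" and Df :: "real^'n \<Rightarrow> real^'n" and a :: "real^'n" and l p pw :: real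
  assumes n: "2 \<le> CARD('n)" and p: "1 < p" "p < CARD('n)" and w: "weight w"
    and FW: "FW_const w \<le> ennreal (1 + min (1 / (4 * 2 ^ CARD('n))) (1 / (4 * 4 powr (1 / (p - 1)))))"
    and pw: "1 / p - 1 / pw = 1 / real CARD('n) * (1 / (1 + 2 ^ (CARD('n) + 1) * (enn2real (FW_const w) - 1)))"
    and f: "locally_integrable f" and Df: "has_weak_gradient f Df" and l: "0 < l"
  defines "Q \<equiv> cube a l"
  defines "C \<equiv> 3072 * real CARD('n) * 4 ^ CARD('n) * pw * l"
  shows "0 \<le> enn2real (FW_const w) - 1" "pw \<le> CARD('n) * p / (CARD('n) - p)"
    and "((\<integral>\<^sup>+x\<in>Q. ennreal (\<bar>f x - cube_mean f Q\<bar> powr pw * w x) \<partial>lebesgue) / weight_of w Q) epowr (1 / pw)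
      \<le> ennreal C * ((\<integral>\<^sup>+x\<in>Q. ennreal (norm (Df x) powr p * w x) \<partial>lebesgue) / weight_of w Q) epowr (1 / p)" (is "?strong \<le> ?R")
    and "lorentz_norm (weighted_prob w Q) pw p (\<lambda>x. f x - cube_mean f Q)
      \<le> ennreal C * ((\<integral>\<^sup>+x\<in>Q. ennreal (norm (Df x) powr p * w x) \<partial>lebesgue) / weight_of w Q) epowr (1 / p)" (is "?lorentz \<le> _")
proof -
  let ?n = "CARD('n)"
  obtain w0 where w0: "locally_integrable_borel w0" "\<And>x. 0 < w0 x" "AE x in lborel. w x = w0 x"
    using weight_borel_version[OF w] by blast
  have fin: "FW_const w < top" using FW by (rule le_less_trans) simp
  define \<delta> where "\<delta> = enn2real (FW_const w) - 1"
  have \<delta>0: "0 \<le> \<delta>" and ac: "almost_constant \<delta> w0"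
    using FW_almost_constant[OF w0 fin] by (auto simp: \<delta>_def)
  then show "0 \<le> enn2real (FW_const w) - 1" by (simp add: \<delta>_def)
  have "enn2real (FW_const w) \<le> 1 + min (1 / (4 * 2 ^ ?n)) (1 / (4 * 4 powr (1 / (p - 1))))"
    by (rule enn2real_leI[OF _ FW]) simp
  then have \<delta>le: "\<delta> \<le> 1 / (4 * 2 ^ ?n)" "\<delta> \<le> 1 / (4 * 4 powr (1 / (p - 1)))" by (auto simp: \<delta>_def)
  have \<delta>n: "2 ^ ?n * \<delta> \<le> 1 / 4" using \<delta>le(1) by (simp add: field_simps)
  have \<delta>2: "2 ^ ?n * \<delta> \<le> 1 / 2" using \<delta>n by linarith
  have "1 * \<delta> \<le> 2 ^ ?n * \<delta>" using \<delta>0 by (intro mult_right_mono) auto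
  then have \<delta>4: "\<delta> \<le> 1 / 4" using \<delta>n by linarith
  have small: "4 * \<delta> * 4 powr (1 / (p - 1)) \<le> 1"
  proof -
    have "0 < (4::real) powr (1 / (p - 1))" by simp
    then show ?thesis using \<delta>le(2) by (simp add: field_simps)
  qed
  define \<theta> where "\<theta> = 1 / p - 1 / pw"
  have \<theta>eq: "\<theta> = 1 / real ?n * (1 / (1 + 2 ^ (?n + 1) * \<delta>))" using pw by (simp add: \<theta>_def \<delta>_def)
  have q: "1 \<le> 1 + 2 ^ (?n + 1) * \<delta>" using \<delta>0 by simp
  note ex = sobolev_exponent[OF p q pw[folded \<delta>_def]]
  show "pw \<le> CARD('n) * p / (CARD('n) - p)" using ex(2) .
  have \<theta>0: "0 < \<theta>" using ex(3) by (simp add: \<theta>_def)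
  have \<theta>2: "2 powr - (1 / \<theta>) \<le> (1 - 2 ^ ?n * \<delta>) / 2 ^ ?n"
    by (rule doubling_exponent[OF \<delta>0 \<delta>2 _ \<theta>eq]) simp
  have pw1: "1 \<le> pw" using ex(1) p by simp
  obtain f0 g where fg: "weak_gradient_borel f0 g" "AE x in lborel. f x = f0 x" "AE x in lborel. Df x = (\<chi> i. g i x)"
    using weak_gradient_borel_version[OF f Df] by blast
  have f0: "locally_integrable_borel f0" using fg(1) by (simp add: weak_gradient_borel_def)
  have f0b: "f0 \<in> borel_measurable borel" using f0 by measurable
  have fm: "f \<in> borel_measurable lebesgue" by (rule borel_version(1)[OF f])
  have wm: "w \<in> borel_measurable lebesgue" using w by (intro borel_version(1)) (simp add: weight_def)
  define W where "W = hmean w0 a l * l ^ ?n"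
  have W: "0 < W" unfolding W_def using hmean_pos[OF w0(1,2) l] l by simp
  have Wint: "(\<integral>\<^sup>+x\<in>hcube a l. ennreal (w0 x) \<partial>lborel) = ennreal W"
    unfolding W_def by (rule nn_integral_hcube_eq[OF w0(1) less_imp_le[OF w0(2)] l])
  have wQ: "weight_of w Q = ennreal W"
    unfolding weight_of_def Wint[symmetric] Q_def
    by (rule nn_integral_lebesgue_cube[OF l]) (use w0(3) in \<open>eventually_elim, simp\<close>)
  define c where "c = hmean f0 a l"
  have cm: "cube_mean f Q = c" unfolding Q_def c_def by (rule cube_mean_eq_hmean[OF fm f0 fg(2) l])
  define R where "R = (\<integral>\<^sup>+x\<in>Q. ennreal (norm (Df x) powr p * w x) \<partial>lebesgue)"
  have R: "R = (\<integral>\<^sup>+x\<in>hcube a l. ennreal (norm (\<chi> i. g i x) powr p * w0 x) \<partial>lborel)"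
  proof -
    have "AE x in lborel. ennreal (norm (Df x) powr p * w x) = ennreal (norm (\<chi> i. g i x) powr p * w0 x)"
      using fg(3) w0(3) by eventually_elim simp
    then show ?thesis unfolding R_def Q_def by (rule nn_integral_lebesgue_cube[OF l])
  qed
  define \<mu> where "\<mu> t = enn2real (\<integral>\<^sup>+x\<in>{x \<in> hcube a l. t < \<bar>f0 x - c\<bar>}. ennreal (w0 x) \<partial>lborel) / W" for t
  have C: "0 < C" using l pw1 by (simp add: C_def)
  define D where "D = 6 * (4 ^ ?n * real ?n) * l * (2 + 2 * pw)"
  have D: "0 < D" using l pw1 by (simp add: D_def)
  \<comment> \<open>Here 128 is 4 times 32: \<open>32 * D\<close> is the Lorentz constant and 4 the
    cost of the strong norm. With \<open>2 + 2 * pw \<le> 4 * pw\<close> the numerical constant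
    becomes 128 * 6 * 4 = 3072.\<close>
  have DC: "128 * D \<le> C"
  proof -
    have "128 * D = 768 * (4 ^ ?n * real ?n * l) * (2 + 2 * pw)" by (simp add: D_def)
    also have "\<dots> \<le> 768 * (4 ^ ?n * real ?n * l) * (4 * pw)"
      using l pw1 by (intro mult_left_mono) auto
    finally show ?thesis by (simp add: C_def mult_ac)
  qed
  have S: "(\<integral>\<^sup>+x\<in>Q. ennreal (\<bar>f x - c\<bar> powr pw * w x) \<partial>lebesgue) = (\<integral>\<^sup>+x\<in>hcube a l. ennreal (\<bar>f0 x - c\<bar> powr pw * w0 x) \<partial>lborel)"
  proof -
    have "AE x in lborel. ennreal (\<bar>f x - c\<bar> powr pw * w x) = ennreal (\<bar>f0 x - c\<bar> powr pw * w0 x)"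
      using fg(2) w0(3) by eventually_elim simp
    then show ?thesis unfolding Q_def by (rule nn_integral_lebesgue_cube[OF l])
  qed
  have Lz: "?lorentz = (ennreal p * (\<integral>\<^sup>+t\<in>{0<..}. ennreal (t powr (p - 1)) * ennreal (\<mu> t powr (p / pw)) \<partial>lborel)) epowr (1 / p)"
  proof -
    have "0 \<le> \<mu> t" for t using W by (simp add: \<mu>_def)
    then show ?thesis
      unfolding lorentz_norm_def cm
      unfolding Q_def \<mu>_def
        emeasure_weighted_prob[OF wm w0 fm f0b fg(2) wQ[unfolded Q_def] W Wint l]
      by (simp add: epowr_ennreal)
  qed
  have both: "?strong \<le> ?R \<and> ?lorentz \<le> ?R"
  proof (cases "R = top")
    case True
    \<comment> \<open>An infinite energy makes the right-hand side infinite, as its factor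
      \<open>C\<close> is positive.\<close>
    have "R / ennreal W = top" using True W by (simp add: ennreal_top_divide)
    then have "?R = top" using C unfolding R_def[symmetric] wQ by (simp add: epowr_def ennreal_mult_top)
    then show ?thesis by simp
  next
    case False
    define \<rho> where "\<rho> = enn2real R / W"
    have \<rho>: "0 \<le> \<rho>" using W by (simp add: \<rho>_def)
    have RW: "R = ennreal (\<rho> * W)" using False W by (simp add: \<rho>_def less_top)
    have "R / ennreal W = ennreal \<rho>" unfolding RW using W \<rho> by (simp add: divide_ennreal)
    then have rhs: "?R = ennreal (C * \<rho> powr (1 / p))"
      unfolding R_def[symmetric] wQ using \<rho> C by (simp add: epowr_ennreal ennreal_mult)
    have est: "?strong \<le> ennreal (C * (\<rho> + \<epsilon>) powr (1 / p)) \<and> ?lorentz \<le> ennreal (C * (\<rho> + \<epsilon>) powr (1 / p))" if \<epsilon>: "0 < \<epsilon>" for \<epsilon>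
    proof -
      define G where "G = \<rho> + \<epsilon>"
      have G: "0 < G" using \<rho> \<epsilon> by (simp add: G_def)
      have le: "(\<integral>\<^sup>+x\<in>hcube a l. ennreal (norm (\<chi> i. g i x) powr p * w0 x) \<partial>lborel) \<le> ennreal (G * (hmean w0 a l * l ^ ?n))"
        unfolding R[symmetric] RW W_def[symmetric] G_def using W \<epsilon> by (intro ennreal_leI mult_right_mono) auto
      define L where "L = 32 * D * G powr (1 / p)"
      have L: "0 < L" using D G by (simp add: L_def)
      have "(\<integral>\<^sup>+t\<in>{0<..}. ennreal (t powr (p - 1)) * ennreal (\<mu> t powr (p / pw)) \<partial>lborel) \<le> ennreal ((32 * D) powr p * G)"
        unfolding \<mu>_def D_def W_def c_def
        by (rule weighted_lorentz_sobolev[OF ac n \<delta>0 \<delta>4 \<delta>2 \<theta>0 \<theta>2 p(1) small pw1 \<theta>_def fg(1) l G le])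
      also have "(32 * D) powr p * G = L powr p"
        using D G p by (simp add: L_def powr_mult powr_powr)
      finally have I: "(\<integral>\<^sup>+t\<in>{0<..}. ennreal (t powr (p - 1)) * ennreal (\<mu> t powr (p / pw)) \<partial>lborel) \<le> ennreal (L powr p)" .
      have L4: "4 * L \<le> C * G powr (1 / p)"
        unfolding L_def using mult_right_mono[OF DC, of "G powr (1 / p)"] by simp
      have "(\<integral>\<^sup>+x\<in>Q. ennreal (\<bar>f x - c\<bar> powr pw * w x) \<partial>lebesgue) \<le> ennreal ((4 * L) powr pw * W)"
        unfolding S W_def using weighted_strong_sobolev[OF w0(1,2) f0b l less_imp_le[OF p(1)] ex(1) L I[unfolded \<mu>_def W_def]] .
      then have "(\<integral>\<^sup>+x\<in>Q. ennreal (\<bar>f x - c\<bar> powr pw * w x) \<partial>lebesgue) / ennreal W \<le> ennreal ((4 * L) powr pw * W) / ennreal W"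
        by (rule divide_right_mono_ennreal)
      also have "\<dots> = ennreal ((4 * L) powr pw)" using W by (simp add: divide_ennreal)
      finally have "?strong \<le> ennreal (((4 * L) powr pw) powr (1 / pw))"
        unfolding cm wQ using pw1 by (intro epowr_le) auto
      also have "((4 * L) powr pw) powr (1 / pw) = 4 * L" using L pw1 by (simp add: powr_powr)
      finally have 1: "?strong \<le> ennreal (C * G powr (1 / p))" using L4 by (meson ennreal_leI order_trans)
      \<comment> \<open>This absorbs the factor \<open>p\<close> in the definition of the Lorentz
        norm: after the \<open>p\<close>-th root it costs at most 2, less than the 4 already granted
        to the strong norm.\<close>
      have "p \<le> 2 powr p"
      proof -
        define m where "m = nat \<lfloor>p\<rfloor>"
        have m: "real m \<le> p" "p \<le> real (Suc m)" using p by (auto simp: m_def) linarith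
        have "Suc m \<le> 2 ^ m" by (simp add: Suc_le_eq)
        then have "real (Suc m) \<le> 2 powr real m" by (simp add: powr_realpow del: of_nat_Suc)
        also have "\<dots> \<le> 2 powr p" using m(1) by (intro powr_mono) auto
        finally show ?thesis using m(2) by simp
      qed
      then have "ennreal p * (\<integral>\<^sup>+t\<in>{0<..}. ennreal (t powr (p - 1)) * ennreal (\<mu> t powr (p / pw)) \<partial>lborel)
        \<le> ennreal (2 powr p) * ennreal (L powr p)"
        using I by (intro mult_mono ennreal_leI) auto
      also have "\<dots> = ennreal ((2 * L) powr p)" using L by (simp add: powr_mult flip: ennreal_mult)
      finally have "?lorentz \<le> ennreal (((2 * L) powr p) powr (1 / p))"
        unfolding Lz using p by (intro epowr_le) auto
      also have "((2 * L) powr p) powr (1 / p) = 2 * L" using L p by (simp add: powr_powr)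
      finally have "?lorentz \<le> ennreal (2 * L)" .
      moreover have "2 * L \<le> C * G powr (1 / p)" using L L4 by simp
      ultimately have 2: "?lorentz \<le> ennreal (C * G powr (1 / p))" by (meson ennreal_leI order_trans)
      from 1 2 show ?thesis by (simp add: G_def)
    qed
    have p0: "0 < 1 / p" using p by simp
    have "?strong \<le> ennreal (C * \<rho> powr (1 / p))" by (rule le_ennreal_powr_limit[OF _ \<rho> p0]) (use est in blast)
    moreover have "?lorentz \<le> ennreal (C * \<rho> powr (1 / p))" by (rule le_ennreal_powr_limit[OF _ \<rho> p0]) (use est in blast)
    ultimately show ?thesis unfolding rhs by blast
  qed
  from both show "?strong \<le> ?R" "?lorentz \<le> ?R" by auto
qed

theorem theorem1p4:
  assumes "CARD('n::finite) \<ge> 2"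
  shows "\<exists>\<tau> c :: real. 0 < \<tau> \<and> 0 < c \<and>
    (\<forall>p::real. 1 < p \<and> p < CARD('n) \<longrightarrow>
      (\<exists>c_np::real. 0 < c_np \<and>
        (\<forall>w :: real^'n \<Rightarrow> real. \<forall>pw::real.
          w \<in> A_infty \<longrightarrow> FW_const w \<le> ennreal (1 + c_np) \<longrightarrow>
          1 / p - 1 / pw = (1 / CARD('n)) * (1 / (1 + \<tau> * (enn2real (FW_const w) - 1))) \<longrightarrow>
          (let pstar = CARD('n) * p / (CARD('n) - p);
               K = c * pstar * (1 + \<tau> * (enn2real (FW_const w) - 1)) powr (1 / p)
           in
            (\<forall>a l f Df. 0 < l \<longrightarrow> f \<in> W11_loc \<longrightarrow> has_weak_gradient f Df \<longrightarrow>
              (let Q = cube a l in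
                ((\<integral>\<^sup>+x\<in>Q. ennreal (\<bar>f x - cube_mean f Q\<bar> powr pw * w x) \<partial>lebesgue)
                    / weight_of w Q) epowr (1 / pw)
                \<le> ennreal (K * l) *
                  ((\<integral>\<^sup>+x\<in>Q. ennreal (norm (Df x) powr p * w x) \<partial>lebesgue)
                    / weight_of w Q) epowr (1 / p))) \<and>
            (\<forall>a l f Df. 0 < l \<longrightarrow> f \<in> W11_loc \<longrightarrow> has_weak_gradient f Df \<longrightarrow>
              (let Q = cube a l in
                lorentz_norm (weighted_prob w Q) pw p (\<lambda>x. f x - cube_mean f Q)
                \<le> ennreal (K * l) *
                  ((\<integral>\<^sup>+x\<in>Q. ennreal (norm (Df x) powr p * w x) \<partial>lebesgue)
                    / weight_of w Q) epowr (1 / p)))))))"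
proof -
  let ?n = "CARD('n)"
  define \<tau> :: real where "\<tau> = 2 ^ (?n + 1)"
  define c :: real where "c = 3072 * real ?n * 4 ^ ?n"
  define c_np :: "real \<Rightarrow> real" where "c_np p = min (1 / (4 * 2 ^ ?n)) (1 / (4 * 4 powr (1 / (p - 1))))" for p
  have pos: "0 < \<tau>" "0 < c" "0 < c_np p" for p by (auto simp: \<tau>_def c_def c_np_def)
  define K where "K p w = c * (?n * p / (?n - p)) * (1 + \<tau> * (enn2real (FW_const w) - 1)) powr (1 / p)"
    for p :: real and w :: "real^'n \<Rightarrow> real"
  define X where "X p w Df a l = ((\<integral>\<^sup>+x\<in>cube a l. ennreal (norm (Df x) powr p * w x) \<partial>lebesgue)
      / weight_of w (cube a l)) epowr (1 / p)"
    for p l :: real and w :: "real^'n \<Rightarrow> real" and Df :: "real^'n \<Rightarrow> real^'n" and a :: "real^'n"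
  have main: "((\<integral>\<^sup>+x\<in>cube a l. ennreal (\<bar>f x - cube_mean f (cube a l)\<bar> powr pw * w x) \<partial>lebesgue)
        / weight_of w (cube a l)) epowr (1 / pw)
      \<le> ennreal (K p w * l) * X p w Df a l"
    "lorentz_norm (weighted_prob w (cube a l)) pw p (\<lambda>x. f x - cube_mean f (cube a l)) \<le> ennreal (K p w * l) * X p w Df a l"
    if p: "1 < p \<and> p < ?n" and w: "w \<in> A_infty" and FW: "FW_const w \<le> ennreal (1 + c_np p)"
      and pw: "1 / p - 1 / pw = (1 / ?n) * (1 / (1 + \<tau> * (enn2real (FW_const w) - 1)))"
      and l: "0 < l" and f: "f \<in> W11_loc" and Df: "has_weak_gradient f Df"
    for p pw l :: real and w f :: "real^'n \<Rightarrow> real" and Df :: "real^'n \<Rightarrow> real^'n" and a :: "real^'n"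
  proof -
    have wt: "weight w" using w by (auto simp: A_infty_def A_class_def)
    have fl: "locally_integrable f" using f by (simp add: W11_loc_def)
    have p1: "1 < p" "p < ?n" using p by auto
    note core = weighted_poincare_sobolev[OF assms p1 wt FW[unfolded c_np_def] pw[unfolded \<tau>_def] fl Df l]
    have q: "1 \<le> 1 + \<tau> * (enn2real (FW_const w) - 1)" using core(1) pos by simp
    have "1 \<le> (1 + \<tau> * (enn2real (FW_const w) - 1)) powr (1 / p)"
      using q p1 by (intro ge_one_powr_ge_zero) auto
    \<comment> \<open>The estimate at hand has \<open>pw\<close> where the statement has the larger
      Sobolev exponent, and 1 where it has a power that is at least 1.\<close>
    then have "c * pw * 1 \<le> K p w"
      unfolding K_def using core(2) pos p1 by (intro mult_mono mult_left_mono) auto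
    then have "3072 * real ?n * 4 ^ ?n * pw * l \<le> K p w * l"
      using l by (simp add: c_def)
    then have "ennreal (3072 * real ?n * 4 ^ ?n * pw * l) * X p w Df a l \<le> ennreal (K p w * l) * X p w Df a l"
      by (rule mult_right_mono[OF ennreal_leI]) simp
    from order_trans[OF core(3)[of a, folded X_def] this] order_trans[OF core(4)[of a, folded X_def] this]
    show "((\<integral>\<^sup>+x\<in>cube a l. ennreal (\<bar>f x - cube_mean f (cube a l)\<bar> powr pw * w x) \<partial>lebesgue)
        / weight_of w (cube a l)) epowr (1 / pw) \<le> ennreal (K p w * l) * X p w Df a l"
      and "lorentz_norm (weighted_prob w (cube a l)) pw p (\<lambda>x. f x - cube_mean f (cube a l)) \<le> ennreal (K p w * l) * X p w Df a l" .
  qed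
  show ?thesis
    unfolding Let_def
    by (rule exI[of _ \<tau>], rule exI[of _ c], intro conjI allI impI pos(1,2),
        rule exI[where x="c_np p" for p], intro conjI allI impI pos(3)) (rule main[unfolded K_def X_def]; assumption)+
qed

end
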